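(* Let $\mathbf{X}_1,\mathbf{X}_2,\dots$ be i.i.d. $d$-dimensional random vectors with an absolutely continuous distribution which is centrally symmetric around $\boldsymbol{0}$. Let $Y_1,Y_2,\dots$ be i.i.d. random variables with $\mathrm{P}[Y_i=1]=\mathrm{P}[Y_i=-1]=1/2$, independent of $(\mathbf{X}_i)_{i\ge1}$. For each $n$ put $\mathbf{X}_i^{\circ}=Y_i\mathbf{X}_i$, $i=1,\dots,n$, $\mathcal{I}^{+}=\{i\in\{1,\dots,n\}:Y_i=1\}$ and $n_+=|\mathcal{I}^{+}|$. Let $\mathbf{F}_{\pm}^{(n)}$ be the empirical center-outward distribution function computed for the sample $\mathbf{X}_1^{\circ},\dots,\mathbf{X}_n^{\circ}$ and a grid $\mathcal{G}_n$, and let $R_i$ and $\mathbf{S}_i$ be the corresponding center-outward rank and sign of $\mathbf{X}_i^{\circ}$. Let $J:[0,1)\to\mathbb{R}$ be a score function continuous on $(0,1)$ with a bounded variation and $\int_0^1J^2(u)\,\mathrm{d}u<\infty$. For $\mathbf{u}$ in the unit ball of $\mathbb{R}^d$ define $\boldsymbol{J}(\mathbf{u})=J(\|\mathbf{u}\|)\,\mathbf{u}/\|\mathbf{u}\|$ if $\mathbf{u}\neq\boldsymbol{0}$ and $\boldsymbol{J}(\boldsymbol{0})=\boldsymbol{0}$, and denote $K_J(\mathcal{G}_n)=\sum_{\boldsymbol{g}\in\mathcal{G}_n}\boldsymbol{J}(\boldsymbol{g})$. Then $$\boldsymbol{T}=\sqrt{\frac{n}{n_+(n-n_+)}}\left[\sum_{i\in\mathcal{I}^{+}}J\!\left(\frac{R_i}{n_R+1}\right)\mathbf{S}_i-\frac{n_+}{n}K_J(\mathcal{G}_n)\right]$$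 converges in distribution for $n\to\infty$ to a centred normal distribution with variance matrix $\frac1d\int_0^1J^2(u)\,\mathrm{d}u\cdot\boldsymbol{I}_d$ with probability one (that is, with probability one along the sequence of realizations of $\{Y_i\}$), where $\boldsymbol{I}_d$ is the $d\times d$ identity matrix.
   Context: The distribution of $\mathbf{X}$ is centrally symmetric around $\boldsymbol{0}$ if $\mathrm{P}[\mathbf{X}\in A]=\mathrm{P}[-\mathbf{X}\in A]$ for all Borel sets $A\subseteq\mathbb{R}^d$. $U_d$ denotes the distribution of $R\mathbf{Z}$ with $R$ and $\mathbf{Z}$ independent, $R$ uniform on $[0,1]$ and $\mathbf{Z}$ uniform on the unit sphere of $\mathbb{R}^d$. Grid: $\mathcal{G}_n$ is a regular grid of $n$ points in the closed unit ball of $\mathbb{R}^d$, assumed to be such that the discrete uniform distribution on $\mathcal{G}_n$ converges weakly to $U_d$ as $n\to\infty$. One possibility (not required) is the set of points $r_i\mathbf{u}_j$, $i=1,\dots,n_R$, $j=1,\dots,n_S$, with $r_i=i/(n_R+1)$ and unit vectors $\mathbf{u}_j$ distributed approximately regularly over the unit sphere, $n=n_Rn_S$, or the union of such a set with $n_0$ replications of $\boldsymbol{0}$, in which case $n=n_0+n_Rn_S$. Empirical center-outward distribution function: for a sample $\mathbf{x}_1,\dots,\mathbf{x}_n$, $\mathbf{F}_{\pm}^{(n)}$ is the (one-to-one) mapping of the $n$ sample points to the $n$ points of $\mathcal{G}_n$ such that $\sum_{i=1}^n\|\mathbf{F}_{\pm}^{(n)}(\mathbf{x}_i)-\mathbf{x}_i\|^2$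 is minimal. The center-outward rank and sign of $\mathbf{x}_i$ are $R_i=(n_R+1)\|\mathbf{F}_{\pm}^{(n)}(\mathbf{x}_i)\|$ and $\mathbf{S}_i=\mathbf{F}_{\pm}^{(n)}(\mathbf{x}_i)/\|\mathbf{F}_{\pm}^{(n)}(\mathbf{x}_i)\|$ if $\mathbf{F}_{\pm}^{(n)}(\mathbf{x}_i)\neq\boldsymbol{0}$, $\mathbf{S}_i=\boldsymbol{0}$ otherwise. Here $n_R$ is the number of spheres (radii) of the grid; it enters $\boldsymbol{T}$ only through $R_i/(n_R+1)=\|\mathbf{F}_{\pm}^{(n)}(\mathbf{X}_i^{\circ})\|$. *)

theory Defs
  imports "HOL-Probability.Probability"
begin

section \<open>Distributions on Euclidean space\<close>

definition weakly_converges ::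
  "(nat \<Rightarrow> 'a::euclidean_space measure) \<Rightarrow> 'a measure \<Rightarrow> bool" where
  "weakly_converges \<mu> \<nu> \<longleftrightarrow>
     (\<forall>f :: 'a \<Rightarrow> real. continuous_on UNIV f \<longrightarrow> bounded (range f) \<longrightarrow>
        (\<lambda>n. \<integral>x. f x \<partial>\<mu> n) \<longlonglongrightarrow> (\<integral>x. f x \<partial>\<nu>))"

definition centrally_symmetric :: "'w measure \<Rightarrow> ('w \<Rightarrow> 'a::euclidean_space) \<Rightarrow> bool" where
  "centrally_symmetric M X \<longleftrightarrow>
     (\<forall>A \<in> sets borel. measure M {\<omega> \<in> space M. X \<omega> \<in> A} = measure M {\<omega> \<in> space M. - X \<omega> \<in> A})"

text \<open>Normalised surface measure, as the law of the direction of a uniform point of the ball.\<close>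

definition uniform_sphere :: "'a::euclidean_space measure" where
  "uniform_sphere = distr (uniform_measure lborel (ball 0 1)) borel sgn"

lemma
  shows prob_space_uniform_sphere: "prob_space (uniform_sphere :: 'a::euclidean_space measure)"
    and AE_uniform_sphere: "AE z in uniform_sphere. norm (z :: 'a) = 1"
proof -
  have fin: "emeasure lborel (ball (0::'a) 1) \<noteq> \<infinity>"
    using emeasure_lborel_ball_finite[of "0::'a" 1] by simp
  have pos: "emeasure lborel (ball (0::'a) 1) \<noteq> 0"
    by (subst emeasure_ball) (auto simp: unit_ball_vol_pos less_imp_neq[symmetric])
  interpret B: prob_space "uniform_measure lborel (ball (0::'a) 1)"
    using prob_space_uniform_measure[OF pos fin] .
  show "prob_space (uniform_sphere :: 'a measure)"
    unfolding uniform_sphere_def by (rule B.prob_space_distr) simp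
  have "AE x in lborel. x \<noteq> (0::'a)"
    by (rule AE_lborel_singleton)
  then show "AE z in uniform_sphere. norm (z :: 'a) = 1"
    unfolding uniform_sphere_def
    by (subst AE_distr_iff) (auto simp: norm_sgn intro!: AE_uniform_measureI)
qed

definition spherical_uniform :: "'a::euclidean_space measure" where
  "spherical_uniform =
     distr (uniform_measure lborel {0..1::real} \<Otimes>\<^sub>M uniform_sphere) borel (\<lambda>(r, z). r *\<^sub>R z)"

definition std_normal_vec :: "(real ^ 'd) measure" where
  "std_normal_vec =
     distr (\<Pi>\<^sub>M i\<in>(UNIV :: 'd set). density lborel (\<lambda>x. ennreal (std_normal_density x))) borel (\<lambda>z. \<chi> i. z i)"

text \<open>The case of a singular \<open>S\<close>, including \<open>S = 0\<close>, is covered.\<close>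

definition multivariate_normal :: "real ^ 'd \<Rightarrow> real ^ 'd ^ 'd \<Rightarrow> (real ^ 'd) measure \<Rightarrow> bool" where
  "multivariate_normal m S N \<longleftrightarrow>
     (\<exists>A :: real ^ 'd ^ 'd. S = A ** transpose A \<and> N = distr std_normal_vec borel (\<lambda>z. m + A *v z))"

text \<open>\<open>\<kappa> y\<close> is a version of the conditional distribution of \<open>T\<close> given \<open>Y = y\<close>.\<close>

definition conditional_distr ::
  "'w measure \<Rightarrow> 'y measure \<Rightarrow> ('w \<Rightarrow> 'y) \<Rightarrow> 't measure \<Rightarrow> ('w \<Rightarrow> 't) \<Rightarrow> ('y \<Rightarrow> 't measure) \<Rightarrow> bool" where
  "conditional_distr M S Y N T \<kappa> \<longleftrightarrow>
     Y \<in> M \<rightarrow>\<^sub>M S \<and> T \<in> M \<rightarrow>\<^sub>M N \<and> \<kappa> \<in> S \<rightarrow>\<^sub>M prob_algebra N \<and>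
     (\<forall>A \<in> sets S. \<forall>B \<in> sets N.
        emeasure M {\<omega> \<in> space M. Y \<omega> \<in> A \<and> T \<omega> \<in> B} = (\<integral>\<^sup>+y\<in>A. emeasure (\<kappa> y) B \<partial>distr M S Y))"

definition bounded_variation_on :: "real set \<Rightarrow> (real \<Rightarrow> real) \<Rightarrow> bool" where
  "bounded_variation_on S f \<longleftrightarrow>
     (\<exists>B. \<forall>(n::nat) t. (\<forall>i\<le>n. t i \<in> S) \<longrightarrow> (\<forall>i<n. t i \<le> t (Suc i)) \<longrightarrow>
        (\<Sum>i<n. \<bar>f (t (Suc i)) - f (t i)\<bar>) \<le> B)"

section \<open>Grids, center-outward ranks and signs\<close>

text \<open>A grid of \<open>n\<close> points is a family \<open>g 0, \<dots>, g (n - 1)\<close>; points may be repeated.\<close>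

definition grid_distr :: "nat \<Rightarrow> (nat \<Rightarrow> 'a::euclidean_space) \<Rightarrow> 'a measure" where
  "grid_distr n g = distr (uniform_count_measure {..<n}) borel g"

definition grid_sequence :: "(nat \<Rightarrow> nat \<Rightarrow> 'a::euclidean_space) \<Rightarrow> bool" where
  "grid_sequence g \<longleftrightarrow>
     (\<forall>n. \<forall>i<n. g n i \<in> cball 0 1) \<and>
     weakly_converges (\<lambda>n. grid_distr n (g n)) spherical_uniform"

text \<open>
  The value of the empirical center-outward distribution function at the \<open>i\<close>-th point of the sample
  \<open>x 0, \<dots>, x (n - 1)\<close>. One-to-one maps from the sample to the grid are \<open>x i \<mapsto> g (p i)\<close> for
  permutations \<open>p\<close> of the indices. Ties between minimisers that give different maps are broken
  arbitrarily; for a sample with an absolutely continuous joint law they have probability zero.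
\<close>

definition center_outward_df ::
  "nat \<Rightarrow> (nat \<Rightarrow> 'a::euclidean_space) \<Rightarrow> (nat \<Rightarrow> 'a) \<Rightarrow> nat \<Rightarrow> 'a" where
  "center_outward_df n g x i =
     g (arg_min (\<lambda>p. \<Sum>j<n. (norm (g (p j) - x j))\<^sup>2) (\<lambda>p. p permutes {..<n}) i)"

definition co_rank ::
  "nat \<Rightarrow> nat \<Rightarrow> (nat \<Rightarrow> 'a::euclidean_space) \<Rightarrow> (nat \<Rightarrow> 'a) \<Rightarrow> nat \<Rightarrow> real" where
  "co_rank nR n g x i = (real nR + 1) * norm (center_outward_df n g x i)"

definition co_sign ::
  "nat \<Rightarrow> (nat \<Rightarrow> 'a::euclidean_space) \<Rightarrow> (nat \<Rightarrow> 'a) \<Rightarrow> nat \<Rightarrow> 'a" where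
  "co_sign n g x i = sgn (center_outward_df n g x i)"

definition vector_score :: "(real \<Rightarrow> real) \<Rightarrow> 'a::euclidean_space \<Rightarrow> 'a" where
  "vector_score J u = J (norm u) *\<^sub>R sgn u"

definition grid_score :: "(real \<Rightarrow> real) \<Rightarrow> nat \<Rightarrow> (nat \<Rightarrow> 'a::euclidean_space) \<Rightarrow> 'a" where
  "grid_score J n g = (\<Sum>i<n. vector_score J (g i))"

definition positive_indices :: "nat \<Rightarrow> (nat \<Rightarrow> real) \<Rightarrow> nat set" where
  "positive_indices n y = {i \<in> {..<n}. y i = 1}"

definition rank_statistic ::
  "(real \<Rightarrow> real) \<Rightarrow> nat \<Rightarrow> nat \<Rightarrow> (nat \<Rightarrow> 'a::euclidean_space) \<Rightarrow> (nat \<Rightarrow> real) \<Rightarrow> (nat \<Rightarrow> 'a) \<Rightarrow> 'a" where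
  "rank_statistic J nR n g y x =
     (let I = positive_indices n y; np = real (card I); xo = (\<lambda>i. y i *\<^sub>R x i) in
      sqrt (real n / (np * (real n - np))) *\<^sub>R
        ((\<Sum>i\<in>I. J (co_rank nR n g xo i / (real nR + 1)) *\<^sub>R co_sign n g xo i)
           - (np / real n) *\<^sub>R grid_score J n g))"

end

theory Submission
  imports Defs
begin

text \<open>
  Fix the signs \<open>y\<close>. By central symmetry the vectors \<open>y i *\<^sub>R X i\<close> are again independent with the law
  of \<open>X 0\<close>, so the optimal assignment of sample points to grid points is exchangeable. Two assignments
  that place different grid points on the sample have equal cost only on a hyperplane of the sample
  space, which absolute continuity makes null; hence the assignment is almost surely unique as a map,
  and an exchangeable arrangement of a fixed list is a uniformly random one (\<open>expectation_opt_perm\<close>).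
  Given \<open>y\<close>, the statistic is therefore distributed as the standardised sum of a simple random sample,
  drawn without replacement from the finite population of grid scores (\<open>conditional_law_rank_statistic\<close>).
  Plugging \<open>y\<close> into the statistic is a version of the conditional law because \<open>X\<close> and \<open>Y\<close> are independent
  (\<open>conditional_distr_of_independent\<close>). What remains is a central limit theorem for random sampling.

  Scores of bounded variation are bounded, and for bounded populations Stein's method gives that theorem.
  Let \<open>S\<close> be the sum over the sampled index set \<open>I\<close> of a centred real population of size \<open>n\<close>. Exchanging a
  sampled index with an unsampled one preserves the uniform law of the permutation and changes \<open>S\<close> by the
  difference of two population values. Since these differences add up to \<open>n * S\<close>, one obtains an exact
  identity for the mean of \<open>S * h S\<close> (\<open>exchange_identity\<close>). With the identity function for \<open>h\<close> it bounds
  the variance of \<open>S\<close>. With \<open>h\<close> a complex exponential it becomes an approximate form of the differential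
  equation \<open>\<psi>' s = - (s * v * \<psi> s)\<close> of the characteristic function of a normal law with variance \<open>v\<close>. The
  result is an explicit bound, which vanishes as soon as the numbers of sampled and of unsampled indices
  tend to infinity (\<open>characteristic_function_bound\<close>); almost every realisation of the signs has this property.

  The population variances converge because the grid does. The score is discontinuous at the origin and on
  the unit sphere, but \<open>spherical_uniform\<close> charges neither, so a cutoff extends weak convergence to such
  functions (\<open>grid_average_tendsto\<close>). In polar coordinates the limit factors into the integral of \<open>J\<^sup>2\<close> and
  a second moment of a uniform direction, which is isotropic by symmetry (\<open>uniform_sphere_moments\<close>).

  In several dimensions, convergence of characteristic functions and tightness imply weak convergence
  (\<open>weakly_converges_trigI\<close>): on a large ball a test function is approximated by a trigonometric polynomial,
  whose size outside of the ball is controlled by composing it with a polynomial close to a clipping function.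
\<close>


section \<open>Means over random permutations\<close>

text \<open>
  The expectation under a uniformly random permutation, written as a finite average; values are taken in
  any real vector space because characteristic functions need complex ones.
\<close>

definition perm_mean :: "nat \<Rightarrow> ((nat \<Rightarrow> nat) \<Rightarrow> 'a::real_vector) \<Rightarrow> 'a" where
  "perm_mean n f = (\<Sum>p | p permutes {..<n}. f p) /\<^sub>R fact n"

lemma finite_perms: "finite {p. p permutes {..<n::nat}}"
  by (simp add: finite_permutations)

lemma perm_mean_cong:
  assumes "\<And>p. p permutes {..<n} \<Longrightarrow> f p = g p"
  shows "perm_mean n f = perm_mean n g"
  unfolding perm_mean_def using assms by simp

lemma perm_mean_const: "perm_mean n (\<lambda>_. c) = c"
  unfolding perm_mean_def
  by (subst sum_constant_scaleR) (simp add: card_permutations[OF refl])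

lemma perm_mean_add: "perm_mean n (\<lambda>p. f p + g p) = perm_mean n f + perm_mean n g"
  by (simp add: perm_mean_def sum.distrib scaleR_add_right)

lemma perm_mean_diff: "perm_mean n (\<lambda>p. f p - g p) = perm_mean n f - perm_mean n g"
  by (simp add: perm_mean_def sum_subtractf scaleR_diff_right)

lemma perm_mean_scaleR: "perm_mean n (\<lambda>p. c *\<^sub>R f p) = c *\<^sub>R perm_mean n f"
  by (simp add: perm_mean_def scaleR_sum_right[symmetric] mult.commute)

lemma perm_mean_mult: "perm_mean n (\<lambda>p. c * f p) = c * perm_mean n f"
  for f :: "(nat \<Rightarrow> nat) \<Rightarrow> 'a::real_algebra"
  by (simp add: perm_mean_def sum_distrib_left[symmetric])

lemma perm_mean_sum: "perm_mean n (\<lambda>p. \<Sum>i\<in>A. f i p) = (\<Sum>i\<in>A. perm_mean n (f i))"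
  unfolding perm_mean_def by (subst sum.swap) (simp add: scaleR_sum_right)

lemma perm_mean_mono:
  fixes f g :: "(nat \<Rightarrow> nat) \<Rightarrow> real"
  assumes "\<And>p. p permutes {..<n} \<Longrightarrow> f p \<le> g p"
  shows "perm_mean n f \<le> perm_mean n g"
  unfolding perm_mean_def using assms by (intro scaleR_left_mono sum_mono) auto

lemma perm_mean_norm: "norm (perm_mean n f) \<le> perm_mean n (\<lambda>p. norm (f p))"
  for f :: "(nat \<Rightarrow> nat) \<Rightarrow> 'a::real_normed_vector"
  by (simp add: perm_mean_def norm_sum divide_right_mono mult_left_mono)

text \<open>
  Translation by a fixed permutation is a bijection. From the right it serves to exchange two indices, from the
  left to absorb the optimal permutation of a given sample.
\<close>

lemma perm_mean_compose_right:
  assumes "q permutes {..<n}"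
  shows "perm_mean n (\<lambda>p. f (p \<circ> q)) = perm_mean n f"
proof -
  have "bij_betw (\<lambda>p. p \<circ> q) {p. p permutes {..<n}} {p. p permutes {..<n}}"
    using assms permutes_inv[OF assms] permutes_inv_o[OF assms]
    by (intro bij_betw_byWitness[where f' = "\<lambda>p. p \<circ> inv q"])
      (auto intro: permutes_compose simp: comp_assoc)
  then show ?thesis
    unfolding perm_mean_def
    using sum.reindex_bij_betw[where g = f] by fastforce
qed

lemma perm_mean_compose_left:
  assumes "q permutes {..<n}"
  shows "perm_mean n (\<lambda>p. f (q \<circ> p)) = perm_mean n f"
proof -
  have "bij_betw (\<lambda>p. q \<circ> p) {p. p permutes {..<n}} {p. p permutes {..<n}}"
    using assms permutes_inv[OF assms] permutes_inv_o[OF assms]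
    by (intro bij_betw_byWitness[where f' = "\<lambda>p. inv q \<circ> p"])
      (auto intro: permutes_compose simp: comp_assoc[symmetric])
  then show ?thesis
    unfolding perm_mean_def
    using sum.reindex_bij_betw[where g = f] by fastforce
qed

lemma sum_transpose_exchange:
  fixes b :: "nat \<Rightarrow> real"
  assumes "finite I" "i \<in> I" "k \<notin> I"
  shows "(\<Sum>j\<in>I. b ((p \<circ> Transposition.transpose i k) j)) = (\<Sum>j\<in>I. b (p j)) - (b (p i) - b (p k))"
proof -
  have "(\<Sum>j\<in>I. b ((p \<circ> Transposition.transpose i k) j)) = b (p k) + (\<Sum>j\<in>I
      - {i}. b ((p \<circ> Transposition.transpose i k) j))"
    using assms by (subst sum.remove[of I i]) auto
  also have "(\<Sum>j\<in>I - {i}. b ((p \<circ> Transposition.transpose i k) j)) = (\<Sum>j\<in>I - {i}. b (p j))"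
    using assms by (intro sum.cong) (auto simp: Transposition.transpose_def)
  also have "\<dots> = (\<Sum>j\<in>I. b (p j)) - b (p i)"
    using assms by (subst sum.remove[of I i]) auto
  finally show ?thesis by simp
qed

section \<open>Stein's method for simple random sampling\<close>

text \<open>
  This factor turns the sum over \<open>I\<close> of a centred population into a statistic whose variance is close to
  the population variance. For \<open>I = {}\<close> and \<open>I = {..<n}\<close> it is \<open>0\<close>, since division by zero yields zero.
\<close>

definition srs_scale :: "nat \<Rightarrow> nat set \<Rightarrow> real" where
  "srs_scale n I = sqrt (real n / (real (card I) * real (card ({..<n} - I))))"

locale sampling =
  fixes n :: nat and I :: "nat set" and b :: "nat \<Rightarrow> real" and B :: real
  assumes I_subset: "I \<subseteq> {..<n}"
    and centred: "(\<Sum>j<n. b j) = 0"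
    and bound: "\<And>j. j < n \<Longrightarrow> \<bar>b j\<bar> \<le> B"
begin

definition S :: "(nat \<Rightarrow> nat) \<Rightarrow> real" where
  "S p = (\<Sum>i\<in>I. b (p i))"

abbreviation "K \<equiv> {..<n} - I"

lemma finite_I: "finite I"
  using I_subset finite_subset by blast

lemma card_K: "real (card K) = real n - real (card I)"
  using I_subset finite_I card_mono[OF _ I_subset] by (subst card_Diff_subset) (auto simp: of_nat_diff)

lemma sum_split:
  fixes u :: "nat \<Rightarrow> real"
  assumes "p permutes {..<n}"
  shows "(\<Sum>k\<in>K. u (p k)) = (\<Sum>j<n. u j) - (\<Sum>i\<in>I. u (p i))"
proof -
  have "(\<Sum>j<n. u j) = (\<Sum>j<n. u (p j))"
    using sum.permute[OF assms, of u] by (simp add: o_def)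
  also have "\<dots> = (\<Sum>k\<in>K. u (p k)) + (\<Sum>i\<in>I. u (p i))"
    using I_subset by (intro sum.subset_diff) auto
  finally show ?thesis by simp
qed

text \<open>
  Because the population is centred, the unsampled values add up to \<open>- S p\<close>; this is what makes the
  exchange of indices act linearly on \<open>S\<close>.
\<close>

lemma sum_differences:
  assumes "p permutes {..<n}"
  shows "(\<Sum>i\<in>I. \<Sum>k\<in>K. b (p i) - b (p k)) = real n * S p"
proof -
  have "(\<Sum>i\<in>I. \<Sum>k\<in>K. b (p i) - b (p k)) = card K * S p - card I * (\<Sum>k\<in>K. b (p k))"
    by (simp add: sum_subtractf S_def sum_distrib_left)
  also have "\<dots> = real n * S p"
    using sum_split[OF assms, of b] card_K centred by (simp add: S_def left_diff_distrib)
  finally show ?thesis .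
qed

lemma sum_square_differences:
  assumes "p permutes {..<n}"
  shows "(\<Sum>i\<in>I. \<Sum>k\<in>K. (b (p i) - b (p k))\<^sup>2) =
    real (card K) * (\<Sum>i\<in>I. (b (p i))\<^sup>2) + real (card I) * (\<Sum>k\<in>K. (b (p k))\<^sup>2) + 2 * (S p)\<^sup>2"
proof -
  have "(\<Sum>i\<in>I. \<Sum>k\<in>K. (b (p i) - b (p k))\<^sup>2) =
      (\<Sum>i\<in>I. \<Sum>k\<in>K. (b (p i))\<^sup>2 + (b (p k))\<^sup>2 - 2 * (b (p i) * b (p k)))"
    by (simp add: power2_diff algebra_simps)
  also have "\<dots> = real (card K) * (\<Sum>i\<in>I. (b (p i))\<^sup>2) + real (card I) * (\<Sum>k\<in>K. (b (p k))\<^sup>2)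
      - 2 * (S p * (\<Sum>k\<in>K. b (p k)))"
    by (simp add: sum.distrib sum_subtractf S_def sum_distrib_left[symmetric] sum_product)
  also have "(\<Sum>k\<in>K. b (p k)) = - S p"
    using sum_split[OF assms, of b] centred by (simp add: S_def)
  finally show ?thesis by (simp add: power2_eq_square)
qed

text \<open>
  For \<open>i \<in> I\<close> and \<open>k \<notin> I\<close>, exchanging \<open>i\<close> and \<open>k\<close> reverses the sign of \<open>b (p i) - b (p k)\<close> and subtracts
  it from \<open>S p\<close>. So the mean of the difference times \<open>h (S p)\<close> equals half the mean of the difference times
  the increment of \<open>h\<close>, and summation over all pairs gives \<open>n * S p\<close> on the left.
\<close>

lemma exchange_identity:
  fixes h :: "real \<Rightarrow> 'a::real_vector"
  shows "real n *\<^sub>R perm_mean n (\<lambda>p. S p *\<^sub>R h (S p)) =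
    (1/2) *\<^sub>R perm_mean n (\<lambda>p. \<Sum>i\<in>I. \<Sum>k\<in>K.
      (b (p i) - b (p k)) *\<^sub>R (h (S p) - h (S p - (b (p i) - b (p k)))))"
proof -
  let ?d = "\<lambda>p i k. b (p i) - b (p k)"
  have swap: "perm_mean n (\<lambda>p. ?d p i k *\<^sub>R h (S p)) = - perm_mean n (\<lambda>p. ?d p i k *\<^sub>R h (S p
      - ?d p i k))"
    if "i \<in> I" "k \<in> K" for i k
  proof -
    have "Transposition.transpose i k permutes {..<n}"
      using that I_subset by (intro permutes_swap_id) auto
    then have "perm_mean n (\<lambda>p. ?d p i k *\<^sub>R h (S p)) =
        perm_mean n (\<lambda>p. ?d (p \<circ> Transposition.transpose i k) i k *\<^sub>R h (S (p \<circ> Transposition.transpose i k)))"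
      by (rule perm_mean_compose_right[symmetric])
    also have "\<dots> = perm_mean n (\<lambda>p. (-1) *\<^sub>R (?d p i k *\<^sub>R h (S p - ?d p i k)))"
      using that by (intro perm_mean_cong)
        (auto simp: S_def sum_transpose_exchange[OF finite_I, unfolded o_def] scaleR_left_diff_distrib)
    also have "\<dots> = - perm_mean n (\<lambda>p. ?d p i k *\<^sub>R h (S p - ?d p i k))"
      by (subst perm_mean_scaleR) simp
    finally show ?thesis .
  qed
  have "real n *\<^sub>R perm_mean n (\<lambda>p. S p *\<^sub>R h (S p)) = perm_mean n (\<lambda>p. (real n * S p) *\<^sub>R h (S p))"
    by (simp add: perm_mean_scaleR[symmetric])
  also have "\<dots> = perm_mean n (\<lambda>p. \<Sum>i\<in>I. \<Sum>k\<in>K. ?d p i k *\<^sub>R h (S p))"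
    by (intro perm_mean_cong) (simp add: sum_differences[symmetric] scaleR_sum_left)
  also have "\<dots> = (\<Sum>i\<in>I. \<Sum>k\<in>K. perm_mean n (\<lambda>p. ?d p i k *\<^sub>R h (S p)))"
    by (simp add: perm_mean_sum)
  also have "\<dots> = (\<Sum>i\<in>I. \<Sum>k\<in>K. (1/2) *\<^sub>R perm_mean n (\<lambda>p. ?d p i k *\<^sub>R (h (S p) - h (S p - ?d p i k))))"
  proof (intro sum.cong refl)
    fix i k assume ik: "i \<in> I" "k \<in> K"
    have "perm_mean n (\<lambda>p. ?d p i k *\<^sub>R (h (S p) - h (S p - ?d p i k))) =
       perm_mean n (\<lambda>p. ?d p i k *\<^sub>R h (S p)) + perm_mean n (\<lambda>p. ?d p i k *\<^sub>R h (S p))"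
      by (subst (2) swap[OF ik]) (simp add: scaleR_diff_right perm_mean_diff)
    also have "\<dots> = 2 *\<^sub>R perm_mean n (\<lambda>p. ?d p i k *\<^sub>R h (S p))"
      by (simp add: scaleR_2)
    finally show "perm_mean n (\<lambda>p. ?d p i k *\<^sub>R h (S p))
        = (1/2) *\<^sub>R perm_mean n (\<lambda>p. ?d p i k *\<^sub>R (h (S p) - h (S p - ?d p i k)))"
      by simp
  qed
  also have "\<dots> = (1/2) *\<^sub>R perm_mean n (\<lambda>p. \<Sum>i\<in>I. \<Sum>k\<in>K. ?d p i k *\<^sub>R (h (S p) - h (S p - ?d p i k)))"
    by (simp add: perm_mean_sum scaleR_sum_right)
  finally show ?thesis .
qed

lemma difference_bound:
  assumes "p permutes {..<n}" "i \<in> I" "k \<in> K"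
  shows "\<bar>b (p i) - b (p k)\<bar> \<le> 2 * B"
proof -
  have "p i < n" "p k < n"
    using assms I_subset permutes_in_image[OF assms(1)] by (auto simp: lessThan_iff[symmetric] simp del: lessThan_iff)
  then show ?thesis using bound[of "p i"] bound[of "p k"] by linarith
qed

text \<open>
  The identity above for \<open>h\<close> the identity function, whose increments are the differences themselves.
\<close>

lemma second_moment:
  "real n * perm_mean n (\<lambda>p. (S p)\<^sup>2) \<le> 2 * B\<^sup>2 * real (card I) * real (card K)"
proof -
  have "real n * perm_mean n (\<lambda>p. (S p)\<^sup>2) =
      (1/2) * perm_mean n (\<lambda>p. \<Sum>i\<in>I. \<Sum>k\<in>K. (b (p i) - b (p k))\<^sup>2)"
    using exchange_identity[of "\<lambda>x. x"] by (simp add: power2_eq_square)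
  also have "\<dots> \<le> (1/2) * perm_mean n (\<lambda>p. \<Sum>i\<in>I. \<Sum>k\<in>K. (2 * B)\<^sup>2)"
    using power_mono[OF difference_bound abs_ge_zero, of _ _ _ 2]
    by (intro mult_left_mono perm_mean_mono sum_mono) auto
  also have "\<dots> = 2 * B\<^sup>2 * real (card I) * real (card K)"
    by (simp add: perm_mean_const power2_eq_square)
  finally show ?thesis .
qed

text \<open>
  The population variance, as the population is centred.
\<close>

definition v :: real where "v = (\<Sum>j<n. (b j)\<^sup>2) / real n"

abbreviation "c \<equiv> srs_scale n I"

text \<open>
  The random coefficient that replaces the variance when the increment of \<open>h\<close> in \<open>exchange_identity\<close> is
  linearised; Stein's method works because it concentrates at \<open>v\<close>.
\<close>

definition Q :: "(nat \<Rightarrow> nat) \<Rightarrow> real" where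
  "Q p = c\<^sup>2 / (2 * real n) * (\<Sum>i\<in>I. \<Sum>k\<in>K. (b (p i) - b (p k))\<^sup>2)"

lemma v_nonneg: "0 \<le> v"
  by (simp add: v_def sum_nonneg)

context
  assumes I_proper: "I \<noteq> {}" "I \<noteq> {..<n}"
begin

lemma card_pos: "0 < real (card I)" "0 < real (card K)" "real n = real (card I)
    + real (card K)" "0 < real n"
proof -
  show "0 < real (card I)" "0 < real (card K)"
    using I_proper I_subset finite_I by (auto simp: card_gt_0_iff)
  then show "real n = real (card I) + real (card K)" "0 < real n"
    using card_K by linarith+
qed

lemma c_pos: "0 < c"
  unfolding srs_scale_def using card_pos by (intro real_sqrt_gt_zero divide_pos_pos mult_pos_pos)

lemma c_square: "c\<^sup>2 * real (card I) * real (card K) = real n"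
proof -
  have "c\<^sup>2 = real n / (real (card I) * real (card K))"
    by (simp add: srs_scale_def)
  then show ?thesis
    using card_pos(1,2) by (metis nonzero_mult_div_cancel_right less_irrefl mult.assoc mult_pos_pos
        nonzero_eq_divide_eq)
qed

lemma inverse_n_le: "1 / real n \<le> c\<^sup>2"
proof -
  have "real (card I) * real (card K) \<le> real n * real n"
    using card_pos by (intro mult_mono) auto
  then show ?thesis
    using card_pos by (simp add: srs_scale_def field_simps)
qed

lemma variance_bound: "perm_mean n (\<lambda>p. (c * S p)\<^sup>2) \<le> 2 * B\<^sup>2"
proof -
  have "real n * perm_mean n (\<lambda>p. (c * S p)\<^sup>2) = c\<^sup>2 * (real n * perm_mean n (\<lambda>p. (S p)\<^sup>2))"
    by (simp add: power_mult_distrib perm_mean_mult)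
  also have "\<dots> \<le> c\<^sup>2 * (2 * B\<^sup>2 * real (card I) * real (card K))"
    by (intro mult_left_mono second_moment) auto
  also have "\<dots> = real n * (2 * B\<^sup>2)"
    by (simp flip: c_square)
  finally show ?thesis using card_pos by simp
qed

lemma B_nonneg: "0 \<le> B"
  using card_pos bound[of 0] by (smt (verit) of_nat_0_less_iff)

text \<open>
  The centred squares form a population of the same kind, so that the variance bound applies to them, too.
  It is used to show that the sampled second moments concentrate.
\<close>

lemma squares_sampling: "sampling n I (\<lambda>j. (b j)\<^sup>2 - v) (B\<^sup>2)"
proof
  have sq: "(b j)\<^sup>2 \<le> B\<^sup>2" if "j < n" for j
    using power_mono[OF bound[OF that] abs_ge_zero, of 2] by simp
  then have "(\<Sum>j<n. (b j)\<^sup>2) \<le> real n * B\<^sup>2"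
    using sum_mono[of "{..<n}" "\<lambda>j. (b j)\<^sup>2" "\<lambda>_. B\<^sup>2"] by simp
  then have "v \<le> B\<^sup>2"
    using card_pos by (simp add: v_def field_simps)
  then show "\<bar>(b j)\<^sup>2 - v\<bar> \<le> B\<^sup>2" if "j < n" for j
    using sq[OF that] v_nonneg by (smt (verit) zero_le_power2)
  show "(\<Sum>j<n. (b j)\<^sup>2 - v) = 0"
    using card_pos by (simp add: sum_subtractf v_def)
qed (rule I_subset)

text \<open>
  Expanding the squares, \<open>Q p - v\<close> is a combination of \<open>(S p)\<^sup>2\<close> and of the sampling error of the squared
  population. Both are small in mean by the variance bound.
\<close>

lemma Q_concentration: "perm_mean n (\<lambda>p. \<bar>Q p - v\<bar>) \<le> (2 * B ^ 4 + 1) * c / 4 + 2 * B\<^sup>2 * c\<^sup>2"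
proof -
  interpret sq: sampling n I "\<lambda>j. (b j)\<^sup>2 - v" "B\<^sup>2" by (rule squares_sampling)
  let ?r = "real (card I)" and ?m = "real (card K)"
  have pointwise: "\<bar>Q p - v\<bar> \<le> (c * (c * sq.S p)\<^sup>2 + c) / 4 + (c * S p)\<^sup>2 / real n"
    if p: "p permutes {..<n}" for p
  proof -
    let ?D = "sq.S p"
    have SI: "(\<Sum>i\<in>I. (b (p i))\<^sup>2) = ?r * v + ?D"
      by (simp add: sq.S_def sum_subtractf)
    have "(\<Sum>j<n. (b j)\<^sup>2) = (?r + ?m) * v"
      using card_pos by (simp add: v_def)
    then have SK: "(\<Sum>k\<in>K. (b (p k))\<^sup>2) = ?m * v - ?D"
      using sum_split[OF p, of "\<lambda>x. x\<^sup>2" for b] sum_split[OF p, of "\<lambda>j. (b j)\<^sup>2"] SI by (simp add: algebra_simps)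
    have "real n * Q p = c\<^sup>2 / 2 * (2 * (?r * ?m) * v + (?m - ?r) * ?D + 2 * (S p)\<^sup>2)"
      using card_pos(4) unfolding Q_def sum_square_differences[OF p] SI SK by (simp add: algebra_simps)
    also have "\<dots> = real n * v + c\<^sup>2 / 2 * ((?m - ?r) * ?D) + (c * S p)\<^sup>2"
      by (simp flip: c_square add: algebra_simps power_mult_distrib)
    finally have "real n * (Q p - v) = c\<^sup>2 / 2 * ((?m - ?r) * ?D) + (c * S p)\<^sup>2"
      by (simp add: algebra_simps)
    then have "real n * \<bar>Q p - v\<bar> \<le> \<bar>c\<^sup>2 / 2 * ((?m - ?r) * ?D)\<bar> + (c * S p)\<^sup>2"
      using abs_triangle_ineq[of "c\<^sup>2 / 2 * ((?m - ?r) * ?D)" "(c * S p)\<^sup>2"]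
      by (metis abs_mult abs_of_nat abs_power2)
    also have "\<bar>c\<^sup>2 / 2 * ((?m - ?r) * ?D)\<bar> = c\<^sup>2 / 2 * (\<bar>?m - ?r\<bar> * \<bar>?D\<bar>)"
      by (simp add: abs_mult)
    also have "\<dots> \<le> c\<^sup>2 / 2 * (real n * \<bar>?D\<bar>)"
      using card_pos by (intro mult_left_mono mult_right_mono) auto
    finally have "\<bar>Q p - v\<bar> \<le> c\<^sup>2 / 2 * \<bar>?D\<bar> + (c * S p)\<^sup>2 / real n"
      using card_pos(4) by (simp add: field_simps)
    \<comment> \<open>The arithmetic-geometric mean inequality replaces the Cauchy-Schwarz inequality for the mean of the error.\<close>
    moreover have "c\<^sup>2 * \<bar>?D\<bar> \<le> c * ((c * ?D)\<^sup>2 + 1) / 2"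
    proof -
      have "2 * (c * \<bar>?D\<bar>) \<le> (c * \<bar>?D\<bar>)\<^sup>2 + 1"
        using sum_squares_bound[of "c * \<bar>?D\<bar>" 1] by simp
      then have "c * (2 * (c * \<bar>?D\<bar>)) \<le> c * ((c * ?D)\<^sup>2 + 1)"
        using c_pos by (intro mult_left_mono) (auto simp: power_mult_distrib)
      then show ?thesis by (simp add: power2_eq_square algebra_simps)
    qed
    moreover have "c\<^sup>2 / 2 * \<bar>?D\<bar> = c\<^sup>2 * \<bar>?D\<bar> / 2"
      by simp
    ultimately show ?thesis by (simp only: distrib_left mult_1_right)
  qed
  have "perm_mean n (\<lambda>p. \<bar>Q p - v\<bar>) \<le>
      perm_mean n (\<lambda>p. (c / 4) * (c * sq.S p)\<^sup>2 + c / 4 + (1 / real n) * (c * S p)\<^sup>2)"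
    using pointwise by (intro perm_mean_mono) (auto simp: add_divide_distrib)
  also have "\<dots> = (c / 4) * perm_mean n (\<lambda>p. (c * sq.S p)\<^sup>2) + c / 4
      + (1 / real n) * perm_mean n (\<lambda>p. (c * S p)\<^sup>2)"
    by (simp only: perm_mean_add perm_mean_mult perm_mean_const)
  also have "\<dots> \<le> (c / 4) * (2 * (B\<^sup>2)\<^sup>2) + c / 4 + c\<^sup>2 * (2 * B\<^sup>2)"
  proof (intro add_mono mult_mono order_refl)
    show "perm_mean n (\<lambda>p. (c * sq.S p)\<^sup>2) \<le> 2 * (B\<^sup>2)\<^sup>2"
      using sq.variance_bound[OF I_proper].
    show "0 \<le> perm_mean n (\<lambda>p. (c * S p)\<^sup>2)" "0 \<le> perm_mean n (\<lambda>p. (c * sq.S p)\<^sup>2)"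
      by (auto simp: perm_mean_def intro!: mult_nonneg_nonneg sum_nonneg)
  qed (use c_pos variance_bound inverse_n_le in auto)
  finally show ?thesis by (simp add: field_simps)
qed

text \<open>
  In \<open>exchange_identity\<close> for a complex exponential, the increment is replaced by its first-order Taylor
  approximation. The quadratic remainder, weighted by the differences, gives the third-order bound.
\<close>

lemma stein_equation:
  "norm (perm_mean n (\<lambda>p. (c * S p) *\<^sub>R iexp (s * (c * S p)))
      - perm_mean n (\<lambda>p. (\<i> * s) * (Q p *\<^sub>R iexp (s * (c * S p)))))
    \<le> 2 * c * B ^ 3 * s\<^sup>2"
proof -
  let ?h = "\<lambda>x. iexp (s * (c * x))"
  let ?d = "\<lambda>p i k. b (p i) - b (p k)"
  define e where "e p i k = ?h (S p) - ?h (S p - ?d p i k) - \<i> * s * c * ?d p i k * ?h (S p)" for p i k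
  have e_bound: "norm (e p i k) \<le> (s * c * ?d p i k)\<^sup>2 / 2" for p i k
  proof -
    let ?x = "- (s * c * ?d p i k)"
    have "e p i k = - (?h (S p) * (iexp ?x - (1 + \<i> * ?x)))"
      by (simp add: e_def algebra_simps exp_add[symmetric] exp_diff exp_minus field_simps)
    then have "norm (e p i k) = norm (iexp ?x - (1 + \<i> * ?x))"
      by (simp add: norm_mult)
    also have "\<dots> \<le> ?x\<^sup>2 / 2"
      using iexp_approx1[of ?x 1] by (simp add: numeral_2_eq_2)
    finally show ?thesis by simp
  qed
  have "real n *\<^sub>R perm_mean n (\<lambda>p. (c * S p) *\<^sub>R ?h (S p))
      = c *\<^sub>R (real n *\<^sub>R perm_mean n (\<lambda>p. S p *\<^sub>R ?h (S p)))"
    by (simp add: perm_mean_scaleR[symmetric] ac_simps)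
  also have "\<dots> = (c / 2) *\<^sub>R perm_mean n (\<lambda>p. \<Sum>i\<in>I. \<Sum>k\<in>K. ?d p i k *\<^sub>R (?h (S p) - ?h (S p - ?d p i k)))"
    by (subst exchange_identity) simp
  also have "\<dots> = (c / 2) *\<^sub>R perm_mean n (\<lambda>p. \<Sum>i\<in>I. \<Sum>k\<in>K. (?d p i k)\<^sup>2 *\<^sub>R (\<i> * s * c * ?h (S p))
      + ?d p i k *\<^sub>R e p i k)"
    by (simp add: e_def scaleR_conv_of_real power2_eq_square algebra_simps)
  also have "\<dots> = perm_mean n (\<lambda>p. (c / 2) *\<^sub>R ((\<Sum>i\<in>I. \<Sum>k\<in>K. (?d p i k)\<^sup>2) *\<^sub>R (\<i> * s * c * ?h (S p))))
      + (c / 2) *\<^sub>R perm_mean n (\<lambda>p. \<Sum>i\<in>I. \<Sum>k\<in>K. ?d p i k *\<^sub>R e p i k)"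
    by (simp add: sum.distrib perm_mean_add perm_mean_scaleR scaleR_sum_left scaleR_add_right)
  also have "(\<lambda>p. (c / 2) *\<^sub>R ((\<Sum>i\<in>I. \<Sum>k\<in>K. (?d p i k)\<^sup>2) *\<^sub>R (\<i> * s * c * ?h (S p))))
      = (\<lambda>p. real n *\<^sub>R ((\<i> * s) * (Q p *\<^sub>R ?h (S p))))"
    using card_pos(4) by (auto simp: Q_def scaleR_conv_of_real power2_eq_square fun_eq_iff)
  finally have eq: "real n *\<^sub>R (perm_mean n (\<lambda>p. (c * S p) *\<^sub>R ?h (S p))
      - perm_mean n (\<lambda>p. (\<i> * s) * (Q p *\<^sub>R ?h (S p))))
     = (c / 2) *\<^sub>R perm_mean n (\<lambda>p. \<Sum>i\<in>I. \<Sum>k\<in>K. ?d p i k *\<^sub>R e p i k)"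
    by (simp only: perm_mean_scaleR scaleR_diff_right) simp
  have "norm (perm_mean n (\<lambda>p. \<Sum>i\<in>I. \<Sum>k\<in>K. ?d p i k *\<^sub>R e p i k))
     \<le> perm_mean n (\<lambda>p. norm (\<Sum>i\<in>I. \<Sum>k\<in>K. ?d p i k *\<^sub>R e p i k))"
    by (rule perm_mean_norm)
  also have "\<dots> \<le> perm_mean n (\<lambda>_. \<Sum>i\<in>I. \<Sum>k\<in>K. 2 * B * ((s * c * (2 * B))\<^sup>2 / 2))"
  proof (intro perm_mean_mono sum_norm_le)
    fix p i k assume p: "p permutes {..<n}" "i \<in> I" "k \<in> K"
    note d = difference_bound[OF p]
    have "(s * c * ?d p i k)\<^sup>2 \<le> (s * c * (2 * B))\<^sup>2"
      using power_mono[OF d abs_ge_zero, of 2] by (simp add: power_mult_distrib mult_left_mono)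
    then show "norm (?d p i k *\<^sub>R e p i k) \<le> 2 * B * ((s * c * (2 * B))\<^sup>2 / 2)"
      using e_bound[of p i k] d B_nonneg unfolding norm_scaleR real_norm_def by (intro mult_mono) auto
  qed
  also have "\<dots> = 4 * B ^ 3 * s\<^sup>2 * (c\<^sup>2 * real (card I) * real (card K))"
    by (simp add: perm_mean_const power2_eq_square power3_eq_cube)
  also have "\<dots> = 4 * B ^ 3 * s\<^sup>2 * real n" by (simp only: c_square)
  finally have "(c / 2) * norm (perm_mean n (\<lambda>p. \<Sum>i\<in>I. \<Sum>k\<in>K. ?d p i k *\<^sub>R e p i k))
      \<le> (c / 2) * (4 * B ^ 3 * s\<^sup>2 * real n)"
    using c_pos by (intro mult_left_mono) auto
  then have "norm ((c / 2) *\<^sub>R perm_mean n (\<lambda>p. \<Sum>i\<in>I. \<Sum>k\<in>K. ?d p i k *\<^sub>R e p i k))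
      \<le> (c / 2) * (4 * B ^ 3 * s\<^sup>2 * real n)"
    using c_pos by (simp only: norm_scaleR)
  then have "real n * norm (perm_mean n (\<lambda>p. (c * S p) *\<^sub>R ?h (S p))
      - perm_mean n (\<lambda>p. (\<i> * s) * (Q p *\<^sub>R ?h (S p))))
      \<le> real n * (2 * c * B ^ 3 * s\<^sup>2)"
    unfolding eq[symmetric] by (simp only: norm_scaleR) simp
  then show ?thesis
    using card_pos(4) by (simp only: mult_le_cancel_left_pos)
qed

text \<open>
  The characteristic function \<open>\<psi>\<close> of the standardised sum solves \<open>\<psi>' s = - (s * v * \<psi> s)\<close> up to a small error.
  Multiplied by the integrating factor \<open>exp (v * s\<^sup>2 / 2)\<close> it has a small derivative, so at \<open>s = 1\<close> it still is
  close to its value \<open>1\<close> at \<open>s = 0\<close>.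
\<close>

lemma characteristic_function_bound:
  "norm (perm_mean n (\<lambda>p. iexp (c * S p)) - complex_of_real (exp (- v / 2)))
     \<le> (2 * B ^ 4 + 1) * c / 4 + 2 * B\<^sup>2 * c\<^sup>2 + 2 * c * B ^ 3" (is "_ \<le> ?bd")
proof -
  let ?W = "\<lambda>p. c * S p"
  define \<psi> where "\<psi> s = perm_mean n (\<lambda>p. iexp (s * ?W p))" for s :: real
  define \<psi>' where "\<psi>' s = perm_mean n (\<lambda>p. \<i> * (?W p *\<^sub>R iexp (s * ?W p)))" for s :: real
  define g where "g s = exp (v * s\<^sup>2 / 2) *\<^sub>R \<psi> s" for s :: real
  define g' where "g' s = exp (v * s\<^sup>2 / 2) *\<^sub>R \<psi>' s
      + (exp (v * s\<^sup>2 / 2) * (v * s)) *\<^sub>R \<psi> s" for s :: real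
  have \<psi>_deriv: "(\<psi> has_vector_derivative \<psi>' s) (at s within T)" for s T
    unfolding \<psi>_def \<psi>'_def perm_mean_def
  proof (intro has_vector_derivative_scaleR[where f="\<lambda>_. inverse (fact n)" and f'=0, simplified] has_vector_derivative_sum)
    show "((\<lambda>s. iexp (s * ?W p)) has_vector_derivative \<i> * (?W p *\<^sub>R iexp (s * ?W p))) (at s within T)" for p
    proof -
      have "((\<lambda>z. exp (\<i> * (z * complex_of_real (?W p)))) has_field_derivative \<i> * ?W p * iexp (s * ?W p))
          (at (complex_of_real s) within of_real ` T)"
        by (auto intro!: derivative_eq_intros)
      from field_vector_diff_chain_within[OF has_vector_derivative_of_real[OF DERIV_ident] this]
      show ?thesis by (simp add: o_def scaleR_conv_of_real mult.assoc)
    qed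
  qed
  have g_deriv: "(g has_vector_derivative g' s) (at s within T)" for s T
    unfolding g_def g'_def
    by (auto intro!: has_vector_derivative_scaleR \<psi>_deriv derivative_eq_intros simp: power2_eq_square)
  have g'_bound: "norm (g' s) \<le> exp (v / 2) * ?bd" if s: "0 < s" "s < 1" for s
  proof -
    let ?A = "perm_mean n (\<lambda>p. (?W p) *\<^sub>R iexp (s * ?W p))"
    let ?Q = "perm_mean n (\<lambda>p. (\<i> * s) * (Q p *\<^sub>R iexp (s * ?W p)))"
    have "\<psi>' s = \<i> * ?A"
      unfolding \<psi>'_def by (rule perm_mean_mult)
    then have "\<psi>' s + (v * s) *\<^sub>R \<psi> s = \<i> * (?A - ?Q) + (\<i> * ?Q + (v * s) *\<^sub>R \<psi> s)"
      by (simp only: right_diff_distrib diff_add_cancel add.assoc[symmetric])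
    also have "\<i> * ?Q + (v * s) *\<^sub>R \<psi> s = perm_mean n (\<lambda>p. \<i> * ((\<i> * s) * (Q p *\<^sub>R iexp (s * ?W p)))
        + (v * s) *\<^sub>R iexp (s * ?W p))"
      unfolding \<psi>_def perm_mean_add perm_mean_mult[of n \<i>] perm_mean_scaleR[of n "v * s"] ..
    also have "\<dots> = perm_mean n (\<lambda>p. (- s) *\<^sub>R ((Q p - v) *\<^sub>R iexp (s * ?W p)))"
    proof (rule perm_mean_cong)
      have "\<i> * ((\<i> * s) * (q *\<^sub>R z)) + (v * s) *\<^sub>R z = (- s) *\<^sub>R ((q
          - v) *\<^sub>R z)" for q :: real and z :: complex
        by (simp add: complex_eq_iff algebra_simps)
      then show "\<i> * ((\<i> * s) * (Q p *\<^sub>R iexp (s * ?W p))) + (v * s) *\<^sub>R iexp (s * ?W p)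
          = (- s) *\<^sub>R ((Q p - v) *\<^sub>R iexp (s * ?W p))" for p
        by blast
    qed
    finally have "norm (\<psi>' s + (v * s) *\<^sub>R \<psi> s) \<le> norm (\<i> * (?A - ?Q))
        + norm (perm_mean n (\<lambda>p. (- s) *\<^sub>R ((Q p - v) *\<^sub>R iexp (s * ?W p))))"
      by (simp only: norm_triangle_ineq)
    also have "norm (\<i> * (?A - ?Q)) \<le> 2 * c * B ^ 3 * s\<^sup>2"
      using stein_equation[of s] by (simp add: norm_mult)
    also have "norm (perm_mean n (\<lambda>p. (- s) *\<^sub>R ((Q p - v) *\<^sub>R iexp (s * ?W p))))
        \<le> perm_mean n (\<lambda>p. norm ((- s) *\<^sub>R ((Q p - v) *\<^sub>R iexp (s * ?W p))))"
      by (rule perm_mean_norm)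
    also have "\<dots> \<le> perm_mean n (\<lambda>p. \<bar>Q p - v\<bar>)"
      using s by (intro perm_mean_mono) (auto simp: abs_mult mult_left_le_one_le)
    also have "\<dots> \<le> (2 * B ^ 4 + 1) * c / 4 + 2 * B\<^sup>2 * c\<^sup>2"
      by (rule Q_concentration)
    also have "2 * c * B ^ 3 * s\<^sup>2 \<le> 2 * c * B ^ 3 * 1"
      using s c_pos B_nonneg by (intro mult_left_mono) (auto simp: power_le_one)
    finally have *: "norm (\<psi>' s + (v * s) *\<^sub>R \<psi> s) \<le> ?bd" by simp
    have "g' s = exp (v * s\<^sup>2 / 2) *\<^sub>R (\<psi>' s + (v * s) *\<^sub>R \<psi> s)"
      by (simp add: g'_def scaleR_add_right)
    then have "norm (g' s) = exp (v * s\<^sup>2 / 2) * norm (\<psi>' s + (v * s) *\<^sub>R \<psi> s)"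
      by simp
    also have "\<dots> \<le> exp (v / 2) * ?bd"
      using * s v_nonneg by (intro mult_mono) (auto intro!: mult_left_le power_le_one)
    finally show ?thesis .
  qed
  have "norm (g 1 - g 0) \<le> (exp (v / 2) * ?bd) * 1 - (exp (v / 2) * ?bd) * 0"
    by (rule differentiable_bound_general[where f'=g' and \<phi>'="\<lambda>_. exp (v / 2) * ?bd"])
      (use g'_bound g_deriv in \<open>auto intro!: continuous_on_vector_derivative derivative_eq_intros continuous_intros simp: has_real_derivative_iff_has_vector_derivative[symmetric]\<close>)
  moreover have "g 0 = 1" "g 1 = exp (v / 2) *\<^sub>R \<psi> 1"
    by (simp_all add: g_def \<psi>_def perm_mean_const)
  ultimately have "norm (exp (v / 2) *\<^sub>R \<psi> 1 - 1) \<le> exp (v / 2) * ?bd"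
    by simp
  moreover have "exp (v / 2) * exp (- v / 2) = 1"
    by (simp add: exp_minus)
  then have "exp (v / 2) *\<^sub>R (\<psi> 1 - complex_of_real (exp (- v / 2))) = exp (v / 2) *\<^sub>R \<psi> 1 - 1"
    unfolding scaleR_diff_right by (simp only: scaleR_conv_of_real of_real_mult[symmetric] of_real_1)
  ultimately have "exp (v / 2) * norm (\<psi> 1 - complex_of_real (exp (- v / 2))) \<le> exp (v / 2) * ?bd"
    by (metis norm_scaleR abs_exp_cancel)
  then show ?thesis by (simp add: \<psi>_def)
qed

end

end

text \<open>
  The square of the scale is the sum of the reciprocals of the two sample sizes.
\<close>

lemma srs_scale_tendsto_0:
  assumes sub: "\<And>n. I n \<subseteq> {..<n}"
    and I: "filterlim (\<lambda>n. card (I n)) at_top sequentially"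
    and K: "filterlim (\<lambda>n. card ({..<n} - I n)) at_top sequentially"
  shows "(\<lambda>n. srs_scale n (I n)) \<longlonglongrightarrow> 0"
proof -
  have "(\<lambda>n. sqrt (inverse (real (card ({..<n} - I n))) + inverse (real (card (I n))))) \<longlonglongrightarrow> sqrt (0 + 0)"
    by (intro tendsto_intros tendsto_inverse_0_at_top filterlim_compose[OF filterlim_real_sequentially] I K)
  moreover have "\<forall>\<^sub>F n in sequentially. sqrt (inverse (real (card ({..<n} - I n)))
      + inverse (real (card (I n)))) = srs_scale n (I n)"
    using filterlim_at_top[THEN iffD1, OF I, rule_format, of 1]
      filterlim_at_top[THEN iffD1, OF K, rule_format, of 1]
  proof eventually_elim
    case (elim n)
    have "real n = real (card (I n)) + real (card ({..<n} - I n))"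
      using card_Diff_subset[OF finite_subset[OF sub finite_lessThan] sub, of n]
        card_mono[OF finite_lessThan sub, of n] by simp
    moreover have "inverse m + inverse r = (r + m) / (r * m)" if "0 < r" "0 < m" for r m :: real
      using that by (simp add: field_simps)
    moreover have "0 < real (card (I n))" "0 < real (card ({..<n} - I n))"
      using elim by linarith+
    ultimately show ?case
      by (simp only: srs_scale_def)
  qed
  ultimately show ?thesis
    by (simp add: tendsto_cong)
qed

theorem simple_random_sampling_clt:
  fixes b :: "nat \<Rightarrow> nat \<Rightarrow> real"
  assumes sub: "\<And>n. I n \<subseteq> {..<n}"
    and centred: "\<And>n. (\<Sum>j<n. b n j) = 0"
    and bound: "\<And>n j. j < n \<Longrightarrow> \<bar>b n j\<bar> \<le> B"
    and I: "filterlim (\<lambda>n. card (I n)) at_top sequentially"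
    and K: "filterlim (\<lambda>n. card ({..<n} - I n)) at_top sequentially"
    and var: "(\<lambda>n. (\<Sum>j<n. (b n j)\<^sup>2) / real n) \<longlonglongrightarrow> \<sigma>2"
  shows "(\<lambda>n. perm_mean n (\<lambda>p. iexp (srs_scale n (I n) * (\<Sum>i\<in>I n. b n (p i)))))
      \<longlonglongrightarrow> complex_of_real (exp (- \<sigma>2 / 2))"
proof -
  let ?c = "\<lambda>n. srs_scale n (I n)" and ?v = "\<lambda>n. (\<Sum>j<n. (b n j)\<^sup>2) / real n"
  let ?\<phi> = "\<lambda>n. perm_mean n (\<lambda>p. iexp (?c n * (\<Sum>i\<in>I n. b n (p i))))"
  let ?bd = "\<lambda>c. (2 * B ^ 4 + 1) * c / 4 + 2 * B\<^sup>2 * c\<^sup>2 + 2 * c * B ^ 3"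
  have "(\<lambda>n. ?bd (?c n)) \<longlonglongrightarrow> ?bd 0"
    by (intro tendsto_intros srs_scale_tendsto_0 sub I K) auto
  then have bd: "(\<lambda>n. ?bd (?c n)) \<longlonglongrightarrow> 0"
    by (rule tendsto_eq_rhs) simp
  have "\<forall>\<^sub>F n in sequentially. norm (?\<phi> n - complex_of_real (exp (- ?v n / 2))) \<le> ?bd (?c n)"
    using filterlim_at_top[THEN iffD1, OF I, rule_format, of 1]
      filterlim_at_top[THEN iffD1, OF K, rule_format, of 1]
  proof eventually_elim
    case (elim n)
    interpret sampling n "I n" "b n" B
      by standard (fact sub centred bound)+
    have "I n \<noteq> {}" "I n \<noteq> {..<n}" using elim by fastforce+
    from characteristic_function_bound[OF this] show ?case
      unfolding S_def v_def .
  qed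
  then have "(\<lambda>n. ?\<phi> n - complex_of_real (exp (- ?v n / 2))) \<longlonglongrightarrow> 0"
    by (rule Lim_null_comparison[OF _ bd])
  moreover have "(\<lambda>n. complex_of_real (exp (- ?v n / 2))) \<longlonglongrightarrow> complex_of_real (exp (- \<sigma>2 / 2))"
    by (intro tendsto_intros var) simp
  ultimately show ?thesis
    by (rule Lim_transform[rotated])
qed


section \<open>Weak convergence from trigonometric test functions\<close>

text \<open>
  The real trigonometric polynomials are introduced as a linear span, since integrals of \<open>cos\<close> and \<open>sin\<close>
  determine those of linear combinations; closure under products is a consequence of the addition formulas.
\<close>

inductive_set trig_poly :: "('a::euclidean_space \<Rightarrow> real) set" where
  cos: "(\<lambda>x. cos (t \<bullet> x)) \<in> trig_poly"
| sin: "(\<lambda>x. sin (t \<bullet> x)) \<in> trig_poly"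
| scale: "f \<in> trig_poly \<Longrightarrow> (\<lambda>x. c * f x) \<in> trig_poly"
| add: "f \<in> trig_poly \<Longrightarrow> g \<in> trig_poly \<Longrightarrow> (\<lambda>x. f x + g x) \<in> trig_poly"

lemma trig_poly_const: "(\<lambda>_::'a::euclidean_space. c) \<in> trig_poly"
  using trig_poly.scale[OF trig_poly.cos[of "0::'a"], of c] by simp

lemma trig_poly_times_cos_sin:
  assumes "f \<in> trig_poly"
  shows "(\<lambda>x. f x * cos (t \<bullet> x)) \<in> trig_poly \<and> (\<lambda>x. f x * sin (t \<bullet> x)) \<in> trig_poly"
  using assms
proof induction
  case (cos s)
  have "(\<lambda>x. (1/2) * (cos ((s - t) \<bullet> x) + cos ((s + t) \<bullet> x))) \<in> trig_poly"
    "(\<lambda>x. (1/2) * (sin ((s + t) \<bullet> x) + (-1) * sin ((s - t) \<bullet> x))) \<in> trig_poly"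
    by (intro trig_poly.intros)+
  then show ?case
    by (simp add: cos_times_cos cos_times_sin inner_diff_left inner_add_left)
next
  case (sin s)
  have "(\<lambda>x. (1/2) * (sin ((s + t) \<bullet> x) + sin ((s - t) \<bullet> x))) \<in> trig_poly"
    "(\<lambda>x. (1/2) * (cos ((s - t) \<bullet> x) + (-1) * cos ((s + t) \<bullet> x))) \<in> trig_poly"
    by (intro trig_poly.intros)+
  then show ?case
    by (simp add: sin_times_cos sin_times_sin inner_diff_left inner_add_left)
next
  case (scale f c)
  then show ?case
    using trig_poly.scale by (fastforce simp: mult.assoc)
next
  case (add f g)
  then show ?case
    by (auto simp: distrib_right intro: trig_poly.add)
qed

lemma trig_poly_mult:
  assumes "g \<in> trig_poly" "f \<in> trig_poly"
  shows "(\<lambda>x. f x * g x) \<in> trig_poly"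
  using assms
proof induction
  case (scale g c)
  then show ?case
    using trig_poly.scale[of "\<lambda>x. f x * g x" c] by (simp add: algebra_simps)
next
  case (add g h)
  then show ?case
    by (auto simp: distrib_left intro: trig_poly.add)
qed (use trig_poly_times_cos_sin in blast)+

lemma trig_poly_real_polynomial:
  assumes "real_polynomial_function q" "f \<in> trig_poly"
  shows "(\<lambda>x. q (f x)) \<in> trig_poly"
  using assms(1)
proof induction
  case (linear q)
  then interpret bounded_linear q .
  have "q y = q 1 * y" for y
    using scaleR[of y 1] by simp
  then have "(\<lambda>x. q (f x)) = (\<lambda>x. q 1 * f x)"
    by blast
  then show ?case
    using trig_poly.scale[OF assms(2), of "q 1"] by simp
qed (auto intro: trig_poly_const trig_poly.add trig_poly_mult)

lemma continuous_on_trig_poly: "f \<in> trig_poly \<Longrightarrow> continuous_on A f"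
  by (induction rule: trig_poly.induct) (auto intro!: continuous_intros)

lemma bounded_trig_poly: "f \<in> trig_poly \<Longrightarrow> \<exists>C. \<forall>x. \<bar>f x\<bar> \<le> C"
proof (induction rule: trig_poly.induct)
  case (scale f c)
  then obtain C where "\<And>x. \<bar>f x\<bar> \<le> C" by blast
  then have "\<bar>c * f x\<bar> \<le> \<bar>c\<bar> * C" for x
    by (simp add: abs_mult mult_left_mono)
  then show ?case by blast
next
  case (add f g)
  then obtain C D where "\<And>x. \<bar>f x\<bar> \<le> C" "\<And>x. \<bar>g x\<bar> \<le> D" by blast
  then have "\<bar>f x + g x\<bar> \<le> C + D" for x
    by (meson abs_triangle_ineq add_mono order_trans)
  then show ?case by blast
qed (auto intro: abs_cos_le_one abs_sin_le_one)

lemma trig_poly_separates: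
  fixes x y :: "'a::euclidean_space"
  assumes "x \<noteq> y"
  shows "\<exists>f\<in>trig_poly. f x \<noteq> f y"
proof -
  obtain s :: 'a where s: "s \<bullet> (x - y) = 1"
    using assms by (intro that[of "(1 / ((x - y) \<bullet> (x - y))) *\<^sub>R (x - y)"]) simp
  have "cos (s \<bullet> x) \<noteq> cos (s \<bullet> y) \<or> sin (s \<bullet> x) \<noteq> sin (s \<bullet> y)"
  proof (rule ccontr)
    assume "\<not> ?thesis"
    then have "cos (s \<bullet> x - s \<bullet> y) = 1"
      by (simp add: cos_diff)
    moreover have "cos (1::real) \<noteq> 1"
      using cos_monotone_0_pi[of 0 1] pi_gt3 by simp
    ultimately show False
      using s by (simp add: inner_diff_right)
  qed
  then show ?thesis
    using trig_poly.cos[of s] trig_poly.sin[of s] by (metis (no_types, lifting))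
qed

lemma trig_poly_approx_compact:
  fixes f :: "'a::euclidean_space \<Rightarrow> real"
  assumes "compact K" "continuous_on K f" "0 < e"
  shows "\<exists>P\<in>trig_poly. \<forall>x\<in>K. \<bar>f x - P x\<bar> < e"
proof -
  interpret function_ring_on trig_poly K
    using assms(1) by unfold_locales (auto intro: continuous_on_trig_poly trig_poly.add trig_poly_mult
        trig_poly_const trig_poly_separates)
  show ?thesis
    by (rule Stone_Weierstrass_basic[OF assms(2,3)])
qed

text \<open>
  An approximation on \<open>K\<close> alone may be huge elsewhere. Composing it with a polynomial that is uniformly close
  to the clipping function \<open>max (- C) (min C u)\<close> on the range of the approximation keeps it a trigonometric
  polynomial, bounds it globally, and hardly changes it on \<open>K\<close>, where it already is close to \<open>f\<close>.
\<close>

lemma trig_poly_approx_bounded: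
  fixes f :: "'a::euclidean_space \<Rightarrow> real"
  assumes K: "compact K" and f: "continuous_on K f" and e: "0 < e"
    and C: "\<And>x. x \<in> K \<Longrightarrow> \<bar>f x\<bar> \<le> C" "0 \<le> C"
  obtains P where "P \<in> trig_poly" "\<And>x. x \<in> K \<Longrightarrow> \<bar>f x - P x\<bar> \<le> e" "\<And>x. \<bar>P x\<bar> \<le> C + e"
proof -
  obtain P where P: "P \<in> trig_poly" "\<And>x. x \<in> K \<Longrightarrow> \<bar>f x - P x\<bar> < e / 2"
    using trig_poly_approx_compact[OF K f, of "e / 2"] e by auto
  obtain M where M: "\<And>x. \<bar>P x\<bar> \<le> M"
    using bounded_trig_poly[OF P(1)] by blast
  let ?clip = "\<lambda>u::real. max (- C) (min C u)"
  obtain q where q: "real_polynomial_function q" "\<And>u. u \<in> {- M..M} \<Longrightarrow> \<bar>?clip u - q u\<bar> < e / 2"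
    by (rule Stone_Weierstrass_real_polynomial_function[of "{- M..M}" ?clip "e / 2"])
      (use e in \<open>auto intro!: continuous_intros\<close>)
  have qP: "\<bar>?clip (P x) - q (P x)\<bar> < e / 2" for x
    using q(2)[of "P x"] M[of x] by (simp add: abs_le_iff)
  show thesis
  proof
    show "(\<lambda>x. q (P x)) \<in> trig_poly"
      by (rule trig_poly_real_polynomial[OF q(1) P(1)])
    show "\<bar>f x - q (P x)\<bar> \<le> e" if "x \<in> K" for x
      proof -
      have "\<bar>f x - ?clip (P x)\<bar> \<le> \<bar>f x - P x\<bar>"
        using C(1)[OF that] by (auto simp: max_def min_def abs_if split: if_splits)
      then show ?thesis using qP[of x] P(2)[OF that] by linarith
    qed
    show "\<bar>q (P x)\<bar> \<le> C + e" for x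
    proof -
      have "\<bar>?clip (P x)\<bar> \<le> C"
        using C(2) by (auto simp: max_def min_def abs_if split: if_splits)
      then show ?thesis using qP[of x] e by linarith
    qed
  qed
qed

lemma integrable_bounded_continuous:
  fixes \<rho> :: "'a::euclidean_space measure" and h :: "'a \<Rightarrow> real"
  assumes "prob_space \<rho>" and "sets \<rho> = sets borel" and "continuous_on UNIV h" and "\<And>x. \<bar>h x\<bar> \<le> D"
  shows "integrable \<rho> h"
proof -
  interpret prob_space \<rho> by fact
  have "h \<in> borel_measurable \<rho>"
    using borel_measurable_continuous_onI[OF assms(3)] assms(2) by (simp cong: measurable_cong_sets)
  then show ?thesis
    by (rule integrable_const_bound[where B = D, rotated]) (use assms(4) in auto)
qed

lemma integrable_trig_poly:
  assumes "prob_space \<rho>" "sets \<rho> = sets borel" "P \<in> trig_poly"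
  shows "integrable \<rho> P"
proof -
  obtain C where "\<forall>x. \<bar>P x\<bar> \<le> C"
    using bounded_trig_poly[OF assms(3)] by blast
  then show ?thesis
    using integrable_bounded_continuous[OF assms(1,2) continuous_on_trig_poly[OF assms(3)], of C] by blast
qed

text \<open>
  A form of the continuity theorem of Levy in which tightness is assumed. The limit is tight as a single
  measure, so the same ball serves for all measures involved.
\<close>

theorem weakly_converges_trigI:
  fixes \<mu> :: "nat \<Rightarrow> 'a::euclidean_space measure"
  assumes \<mu>: "\<And>n. prob_space (\<mu> n)" "\<And>n. sets (\<mu> n) = sets borel"
    and \<nu>: "prob_space \<nu>" "sets \<nu> = sets borel"
    and tight: "\<And>e. 0 < e \<Longrightarrow> \<exists>L. \<forall>n. measure (\<mu> n) {x. L < norm x} < e"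
    and cos: "\<And>t. (\<lambda>n. \<integral>x. cos (t \<bullet> x) \<partial>\<mu> n) \<longlonglongrightarrow> (\<integral>x. cos (t \<bullet> x) \<partial>\<nu>)"
    and sin: "\<And>t. (\<lambda>n. \<integral>x. sin (t \<bullet> x) \<partial>\<mu> n) \<longlonglongrightarrow> (\<integral>x. sin (t \<bullet> x) \<partial>\<nu>)"
  shows "weakly_converges \<mu> \<nu>"
  unfolding weakly_converges_def
proof (intro allI impI)
  fix f :: "'a \<Rightarrow> real"
  assume f: "continuous_on UNIV f" "bounded (range f)"
  have trig: "(\<lambda>n. \<integral>x. P x \<partial>\<mu> n) \<longlonglongrightarrow> (\<integral>x. P x \<partial>\<nu>)" if "P \<in> trig_poly" for P
    using that
  proof induction
    case (add P Q)
    show ?case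
      using tendsto_add[OF add(3,4)] integrable_trig_poly[OF \<mu> add(1)] integrable_trig_poly[OF \<mu> add(2)]
        integrable_trig_poly[OF \<nu> add(1)] integrable_trig_poly[OF \<nu> add(2)] by simp
  qed (auto intro: cos sin tendsto_mult_left)
  obtain C where C: "\<And>x. \<bar>f x\<bar> \<le> C" "0 \<le> C"
    using f(2) by (force simp: bounded_pos)
  have approx: "\<bar>(\<integral>x. f x \<partial>\<rho>) - (\<integral>x. P x \<partial>\<rho>)\<bar> \<le> e + (2 * C + e) * measure \<rho> {x. L < norm x}"
    if \<rho>: "prob_space \<rho>" "sets \<rho> = sets borel" and P: "P \<in> trig_poly"
      "\<And>x. x \<in> cball 0 L \<Longrightarrow> \<bar>f x - P x\<bar> \<le> e" "\<And>x. \<bar>P x\<bar> \<le> C + e" and e: "0 < e"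
    for \<rho> :: "'a measure" and P L e
  proof -
    interpret prob_space \<rho> by fact
    have [measurable_cong]: "sets \<rho> = sets borel" by fact
    have A: "{x. L < norm x} \<in> sets \<rho>" by measurable
    have int: "integrable \<rho> f" "integrable \<rho> P"
      using integrable_bounded_continuous[OF \<rho> f(1) C(1)] integrable_trig_poly[OF \<rho> P(1)] .
    have "\<bar>(\<integral>x. f x \<partial>\<rho>) - (\<integral>x. P x \<partial>\<rho>)\<bar> = \<bar>\<integral>x. f x - P x \<partial>\<rho>\<bar>"
      using int by simp
    also have "\<dots> \<le> (\<integral>x. \<bar>f x - P x\<bar> \<partial>\<rho>)"
      by (rule integral_abs_bound)
    also have "\<dots> \<le> (\<integral>x. e + (2 * C + e) * indicator {x. L < norm x} x \<partial>\<rho>)"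
    proof (rule integral_mono)
      show "integrable \<rho> (\<lambda>x. e + (2 * C + e) * indicator {x. L < norm x} x)"
        by (intro Bochner_Integration.integrable_add integrable_mult_right integrable_real_indicator A
            integrable_const) (simp add: emeasure_eq_measure)
      show "\<bar>f x - P x\<bar> \<le> e + (2 * C + e) * indicator {x. L < norm x} x" for x
        using P(2)[of x] C(1)[of x] P(3)[of x] e by (auto simp: indicator_def)
    qed (use int in auto)
    also have "\<dots> = e + (2 * C + e) * measure \<rho> {x. L < norm x}"
      using A by (simp add: prob_space emeasure_eq_measure)
    finally show ?thesis .
  qed
  show "(\<lambda>n. \<integral>x. f x \<partial>\<mu> n) \<longlonglongrightarrow> (\<integral>x. f x \<partial>\<nu>)"
  proof (rule LIMSEQ_I)
    fix r :: real assume r: "0 < r"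
    \<comment> \<open>The three approximation errors below add up to less than the given bound for this choice.\<close>
    define e where "e = min 1 (r / (6 + 4 * C))"
    have "e \<le> r / (6 + 4 * C)" by (simp add: e_def)
    moreover have "0 < 6 + 4 * C" using C(2) by simp
    ultimately have "e * (6 + 4 * C) \<le> r"
      by (simp only: pos_le_divide_eq)
    with \<open>0 < 6 + 4 * C\<close> have e: "0 < e" "e \<le> 1" "(6 + 4 * C) * e \<le> r"
      using r by (auto simp: e_def mult.commute)
    obtain L1 where L1: "\<And>n. measure (\<mu> n) {x. L1 < norm x} < e"
      using tight[OF e(1)] by blast
    interpret N: prob_space \<nu> by fact
    have "\<exists>L2. measure \<nu> {x. L2 < norm x} < e"
    proof -
      have "(\<lambda>n. measure \<nu> {x. real n < norm x}) \<longlonglongrightarrow> measure \<nu> (\<Inter>n. {x. real n < norm x})"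
        by (rule N.finite_Lim_measure_decseq) (auto simp: decseq_def \<nu>(2))
      also have "(\<Inter>n. {x::'a. real n < norm x}) = {}"
        using real_arch_simple by (fastforce simp: not_less[symmetric])
      finally have "(\<lambda>n. measure \<nu> {x. real n < norm x}) \<longlonglongrightarrow> 0" by simp
      from order_tendstoD(2)[OF this e(1)] have "\<exists>n. measure \<nu> {x. real n < norm x} < e"
        by (auto simp: eventually_sequentially)
      then show ?thesis by blast
    qed
    then obtain L2 where L2: "measure \<nu> {x. L2 < norm x} < e" by blast
    define L where "L = max L1 L2"
    have le: "measure \<rho> {x. L < norm x} \<le> measure \<rho> {x. L' < norm x}"
      if "prob_space \<rho>" "sets \<rho> = sets borel" "L' \<le> L" for \<rho> :: "'a measure" and L'
    proof -
      interpret prob_space \<rho> by fact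
      show ?thesis using that by (intro finite_measure_mono) auto
    qed
    have small: "e + (2 * C + e) * measure \<rho> {x. L < norm x} \<le> r / 2 - e"
      if "measure \<rho> {x. L < norm x} \<le> e" for \<rho> :: "'a measure"
    proof -
      have "(2 * C + e) * measure \<rho> {x. L < norm x} \<le> (2 * C + 1) * e"
        using that C(2) e by (intro mult_mono) auto
      then show ?thesis using e by (simp add: algebra_simps)
    qed
    obtain P where P: "P \<in> trig_poly" "\<And>x. x \<in> cball 0 L \<Longrightarrow> \<bar>f x - P x\<bar> \<le> e" "\<And>x. \<bar>P x\<bar> \<le> C + e"
      using trig_poly_approx_bounded[of "cball 0 L" f e C] f(1) e(1) C
      by (metis compact_cball continuous_on_subset subset_UNIV)
    obtain n0 where n0: "\<And>n. n \<ge> n0 \<Longrightarrow> \<bar>(\<integral>x. P x \<partial>\<mu> n) - (\<integral>x. P x \<partial>\<nu>)\<bar> < 2 * e"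
      using LIMSEQ_D[OF trig[OF P(1)], of "2 * e"] e by auto
    show "\<exists>n0. \<forall>n\<ge>n0. norm ((\<integral>x. f x \<partial>\<mu> n) - (\<integral>x. f x \<partial>\<nu>)) < r"
    proof (intro exI allI impI)
      fix n assume n: "n0 \<le> n"
      have "measure (\<mu> n) {x. L < norm x} \<le> e"
        using le[OF \<mu>, of L1 n] L1[of n] by (auto simp: L_def)
      from order_trans[OF approx[OF \<mu> P e(1)] small[OF this]]
      have "\<bar>(\<integral>x. f x \<partial>\<mu> n) - (\<integral>x. P x \<partial>\<mu> n)\<bar> \<le> r / 2 - e" .
      moreover have "measure \<nu> {x. L < norm x} \<le> e"
        using le[OF \<nu>, of L2] L2 by (auto simp: L_def)
      from order_trans[OF approx[OF \<nu> P e(1)] small[OF this]]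
      have "\<bar>(\<integral>x. f x \<partial>\<nu>) - (\<integral>x. P x \<partial>\<nu>)\<bar> \<le> r / 2 - e" .
      ultimately show "norm ((\<integral>x. f x \<partial>\<mu> n) - (\<integral>x. f x \<partial>\<nu>)) < r"
        using n0[OF n] unfolding real_norm_def by linarith
    qed
  qed
qed



section \<open>The spherical uniform distribution\<close>

lemma prob_space_uniform_interval: "prob_space (uniform_measure lborel {0..1::real})"
  by (rule prob_space_uniform_measure) auto

lemma sets_uniform_sphere [measurable_cong]: "sets uniform_sphere = sets borel"
  by (simp add: uniform_sphere_def)

lemma sets_spherical_uniform [measurable_cong]: "sets spherical_uniform = sets borel"
  by (simp add: spherical_uniform_def)

lemma measurable_polar [measurable]:
  "(\<lambda>(r, z). r *\<^sub>R z) \<in> uniform_measure lborel {0..1::real} \<Otimes>\<^sub>M (uniform_sphere :: 'a::euclidean_space measure) \<rightarrow>\<^sub>M borel"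
  by measurable

lemma prob_space_spherical_uniform: "prob_space (spherical_uniform :: 'a::euclidean_space measure)"
proof -
  interpret R: prob_space "uniform_measure lborel {0..1::real}" by (rule prob_space_uniform_interval)
  interpret Z: prob_space "uniform_sphere :: 'a measure" by (rule prob_space_uniform_sphere)
  interpret RZ: pair_prob_space "uniform_measure lborel {0..1::real}" "uniform_sphere :: 'a measure" ..
  show ?thesis
    unfolding spherical_uniform_def by (rule RZ.prob_space_distr) (rule measurable_polar)
qed

lemma AE_uniform_interval: "AE r in uniform_measure lborel {0..1::real}. 0 < r \<and> r < 1"
proof (rule AE_uniform_measureI)
  have "AE r in lborel. r \<noteq> (0::real)" "AE r in lborel. r \<noteq> (1::real)"
    by (rule AE_lborel_singleton)+
  then show "AE r in lborel. r \<in> {0..1::real} \<longrightarrow> 0 < r \<and> r < 1"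
    by eventually_elim auto
qed simp

text \<open>
  The product law lives on pairs of a radius in the open unit interval and a unit vector, where the map to
  polar coordinates can be inverted.
\<close>

lemma AE_polar:
  "AE x in uniform_measure lborel {0..1::real} \<Otimes>\<^sub>M (uniform_sphere :: 'a::euclidean_space measure).
     0 < fst x \<and> fst x < 1 \<and> norm (snd x) = 1"
proof -
  interpret R: prob_space "uniform_measure lborel {0..1::real}" by (rule prob_space_uniform_interval)
  interpret Z: prob_space "uniform_sphere :: 'a measure" by (rule prob_space_uniform_sphere)
  interpret RZ: pair_prob_space "uniform_measure lborel {0..1::real}" "uniform_sphere :: 'a measure" ..
  show ?thesis
  proof (rule RZ.AE_pair_measure)
    show "AE r in uniform_measure lborel {0..1::real}. AE z in (uniform_sphere :: 'a measure).
        0 < fst (r, z) \<and> fst (r, z) < 1 \<and> norm (snd (r, z)) = 1"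
      using AE_uniform_interval
    proof eventually_elim
      case (elim r)
      show ?case using AE_uniform_sphere by eventually_elim (use elim in auto)
    qed
  qed measurable
qed

lemma AE_spherical_uniform:
  "AE u in (spherical_uniform :: 'a::euclidean_space measure). u \<in> ball 0 1 - {0}"
  unfolding spherical_uniform_def
proof (subst AE_distr_iff)
  show "AE x in uniform_measure lborel {0..1::real} \<Otimes>\<^sub>M (uniform_sphere :: 'a measure).
      (case x of (r, z) \<Rightarrow> r *\<^sub>R z) \<in> ball 0 1 - {0}"
    using AE_polar by eventually_elim auto
qed (auto intro: measurable_polar)

lemma integral_uniform_interval:
  fixes p :: "real \<Rightarrow> real"
  assumes [measurable]: "p \<in> borel_measurable borel" and "\<And>r. r \<notin> {0<..<1} \<Longrightarrow> p r = 0"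
  shows "(\<integral>r. p r \<partial>uniform_measure lborel {0..1}) = (\<integral>r. p r \<partial>lborel)"
proof -
  have "uniform_measure lborel {0..1::real} = density lborel (\<lambda>r. ennreal (indicator {0..1} r))"
    by (auto simp: uniform_measure_def indicator_def fun_eq_iff intro!: arg_cong[where f = "density lborel"])
  then have "(\<integral>r. p r \<partial>uniform_measure lborel {0..1}) = (\<integral>r. indicator {0..1} r * p r \<partial>lborel)"
    by (simp add: integral_density)
  also have "(\<lambda>r. indicator {0..1} r * p r) = p"
  proof
    show "indicator {0..1} r * p r = p r" for r
      using assms(2)[of r] by (cases "r \<in> {0..1}") auto
  qed
  finally show ?thesis .
qed

text \<open>
  Integrals of products of a radial and an angular function factor. The set integral is restricted to the
  punctured open ball because \<open>p\<close> need be measurable only on the open unit interval.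
\<close>

lemma spherical_uniform_polar:
  fixes p :: "real \<Rightarrow> real" and q :: "'a::euclidean_space \<Rightarrow> real"
  assumes p: "set_borel_measurable borel {0<..<1} p" "\<And>r. r \<in> {0<..<1} \<Longrightarrow> \<bar>p r\<bar> \<le> C"
    and q [measurable]: "q \<in> borel_measurable borel" and q_bd: "\<And>z. norm z = 1 \<Longrightarrow> \<bar>q z\<bar> \<le> D"
  shows "(LINT u:ball 0 1 - {0}|spherical_uniform. p (norm u) * q (sgn u)) =
    (LBINT r:{0<..<1}. p r) * (\<integral>z. q z \<partial>uniform_sphere)"
proof -
  let ?R = "uniform_measure lborel {0..1::real}" and ?Z = "uniform_sphere :: 'a measure"
  interpret R: prob_space ?R by (rule prob_space_uniform_interval)
  interpret Z: prob_space ?Z by (rule prob_space_uniform_sphere)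
  interpret RZ: pair_prob_space ?R ?Z ..
  define p' where "p' r = indicator {0<..<1} r * p r" for r
  have p' [measurable]: "p' \<in> borel_measurable borel"
    using p(1) by (simp add: set_borel_measurable_def p'_def[abs_def])
  have "(LINT u:ball 0 1 - {0}|spherical_uniform. p (norm u) * q (sgn u)) =
      (\<integral>u. p' (norm u) * q (sgn u) \<partial>spherical_uniform)"
    unfolding set_lebesgue_integral_def p'_def
    by (intro Bochner_Integration.integral_cong) (auto simp: indicator_def)
  also have "\<dots> = (\<integral>x. p' (norm (fst x *\<^sub>R snd x)) * q (sgn (fst x *\<^sub>R snd x)) \<partial>(?R \<Otimes>\<^sub>M ?Z))"
    unfolding spherical_uniform_def by (subst integral_distr) (auto simp: case_prod_beta)
  also have "\<dots> = (\<integral>x. p' (fst x) * q (snd x) \<partial>(?R \<Otimes>\<^sub>M ?Z))"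
  proof (rule integral_cong_AE)
    show "AE x in ?R \<Otimes>\<^sub>M ?Z. p' (norm (fst x *\<^sub>R snd x)) * q (sgn (fst x *\<^sub>R snd x))
        = p' (fst x) * q (snd x)"
      using AE_polar by eventually_elim (simp add: sgn_scaleR, simp add: sgn_div_norm)
  qed measurable
  also have "\<dots> = (\<integral>r. \<integral>z. p' r * q z \<partial>?Z \<partial>?R)"
  proof (subst RZ.integral_fst'[symmetric])
    show "integrable (?R \<Otimes>\<^sub>M ?Z) (\<lambda>x. p' (fst x) * q (snd x))"
    proof (rule RZ.integrable_const_bound)
      show "AE x in ?R \<Otimes>\<^sub>M ?Z. norm (p' (fst x) * q (snd x)) \<le> C * D"
        using AE_polar
      proof eventually_elim
        case (elim x)
        then show ?case
          using p(2)[of "fst x"] q_bd[of "snd x"] by (auto simp: p'_def abs_mult intro!: mult_mono)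
      qed
    qed measurable
  qed simp
  also have "\<dots> = (\<integral>r. p' r \<partial>?R) * (\<integral>z. q z \<partial>?Z)"
    by simp
  also have "(\<integral>r. p' r \<partial>?R) = (\<integral>r. p' r \<partial>lborel)"
    by (rule integral_uniform_interval[OF p']) (auto simp: p'_def)
  also have "\<dots> = (LBINT r:{0<..<1}. p r)"
    by (simp add: set_lebesgue_integral_def p'_def)
  finally show ?thesis .
qed

lemma distr_uniform_measure_invariant:
  assumes [measurable]: "T \<in> borel \<rightarrow>\<^sub>M borel" and A [measurable]: "A \<in> sets borel"
    and T: "distr lborel borel T = lborel" and TA: "\<And>x. T x \<in> A \<longleftrightarrow> x \<in> A"
  shows "distr (uniform_measure lborel A) borel T = uniform_measure lborel A"
proof (rule measure_eqI)
  fix B assume "B \<in> sets (distr (uniform_measure lborel A) borel T)"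
  then have [measurable]: "B \<in> sets borel" by simp
  have "emeasure lborel (A \<inter> T -` B) = emeasure (distr lborel borel T) (A \<inter> B)"
    by (subst emeasure_distr) (auto simp: TA intro!: arg_cong[where f = "emeasure lborel"])
  also have "\<dots> = emeasure lborel (A \<inter> B)"
    by (simp only: T)
  finally have "emeasure lborel (A \<inter> T -` B) = emeasure lborel (A \<inter> B)" .
  moreover have "T -` B \<in> sets borel"
    using measurable_sets[OF assms(1), of B] by simp
  ultimately show "emeasure (distr (uniform_measure lborel A) borel T) B
      = emeasure (uniform_measure lborel A) B"
    by (simp add: emeasure_distr)
qed simp

text \<open>
  A linear isometry commutes with \<open>sgn\<close> and maps the unit ball onto itself.
\<close>

lemma uniform_sphere_invariant:
  fixes T :: "'a::euclidean_space \<Rightarrow> 'a"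
  assumes lin: "linear T" and iso: "\<And>x. norm (T x) = norm x" and T: "distr lborel borel T = lborel"
  shows "distr uniform_sphere borel T = uniform_sphere"
proof -
  have [measurable]: "T \<in> borel \<rightarrow>\<^sub>M borel"
    using lin by (intro borel_measurable_continuous_onI linear_continuous_on linear_conv_bounded_linear[THEN iffD1])
  have sgn_T: "T (sgn x) = sgn (T x)" for x
    by (simp add: sgn_div_norm linear_scale[OF lin] iso)
  let ?U = "uniform_measure lborel (ball (0::'a) 1)"
  have "distr uniform_sphere borel T = distr ?U borel (\<lambda>x. T (sgn x))"
    unfolding uniform_sphere_def by (subst distr_distr) (auto simp: o_def)
  also have "\<dots> = distr (distr ?U borel T) borel sgn"
    by (subst distr_distr) (auto simp: o_def sgn_T)
  also have "distr ?U borel T = ?U"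
    by (rule distr_uniform_measure_invariant) (auto simp: T iso)
  finally show ?thesis by (simp add: uniform_sphere_def)
qed

lemma lborel_sign_change:
  fixes s :: "'a::euclidean_space \<Rightarrow> real"
  assumes s: "\<And>j. j \<in> Basis \<Longrightarrow> \<bar>s j\<bar> = 1"
  shows "distr lborel borel (\<lambda>x. \<Sum>j\<in>Basis. (s j * (x \<bullet> j)) *\<^sub>R j) = lborel"
proof -
  have "s j \<noteq> 0" if "j \<in> Basis" for j
    using s[OF that] by auto
  from lborel_affine_euclidean[of s 0, OF this]
  show ?thesis using s by (simp add: density_1)
qed

text \<open>
  The preimage of a box under an exchange of two coordinates is the box with exchanged side lengths.
\<close>

lemma lborel_transpose_coordinates:
  fixes i k :: "'a::euclidean_space"
  assumes ik: "i \<in> Basis" "k \<in> Basis"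
  shows "distr lborel borel (\<lambda>x. \<Sum>j\<in>Basis. (x \<bullet> Transposition.transpose i k j) *\<^sub>R j)
      = (lborel :: 'a measure)"
    (is "distr _ _ ?T = _")
proof (rule lborel_eqI[symmetric])
  let ?t = "Transposition.transpose i k"
  have t: "?t permutes Basis" using ik by (rule permutes_swap_id)
  have tb: "?t j \<in> Basis" if "j \<in> Basis" for j using permutes_in_image[OF t] that by blast
  have T: "?T x \<bullet> j = x \<bullet> ?t j" if "j \<in> Basis" for x j
    using that by (simp add: inner_sum_left inner_Basis if_distrib cong: if_cong)
  fix l u :: 'a assume le: "\<And>b. b \<in> Basis \<Longrightarrow> l \<bullet> b \<le> u \<bullet> b"
  have "x \<in> ?T -` box l u \<longleftrightarrow> x \<in> box (?T l) (?T u)" for x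
  proof -
    have "x \<in> ?T -` box l u \<longleftrightarrow> (\<forall>j\<in>Basis. l \<bullet> j < x \<bullet> ?t j \<and> x \<bullet> ?t j < u \<bullet> j)"
      by (simp add: mem_box T)
    also have "\<dots> \<longleftrightarrow> (\<forall>j\<in>Basis. l \<bullet> ?t j < x \<bullet> j \<and> x \<bullet> j < u \<bullet> ?t j)"
      using tb by (metis transpose_involutory)
    also have "\<dots> \<longleftrightarrow> x \<in> box (?T l) (?T u)"
      by (simp add: mem_box T)
    finally show ?thesis .
  qed
  then have "?T -` box l u = box (?T l) (?T u)" by blast
  then have "emeasure (distr lborel borel ?T) (box l u) = emeasure lborel (box (?T l) (?T u))"
    by (subst emeasure_distr) auto
  also have "\<dots> = (\<Prod>j\<in>Basis. (u - l) \<bullet> ?t j)"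
    using le tb by (subst emeasure_lborel_box) (auto simp: T inner_diff_left intro!: arg_cong[where f=ennreal] prod.cong)
  also have "\<dots> = (\<Prod>j\<in>Basis. (u - l) \<bullet> j)"
    using prod.permute[OF t, of "\<lambda>j. (u - l) \<bullet> j"] by (simp add: o_def)
  finally show "emeasure (distr lborel borel ?T) (box l u) = (\<Prod>j\<in>Basis. (u - l) \<bullet> j)" .
qed simp

lemma uniform_sphere_integral_invariant:
  fixes T :: "'a::euclidean_space \<Rightarrow> 'a" and f :: "'a \<Rightarrow> real"
  assumes "linear T" "\<And>x. norm (T x) = norm x" "distr lborel borel T
      = lborel" "f \<in> borel_measurable borel"
  shows "(\<integral>z. f (T z) \<partial>uniform_sphere) = (\<integral>z. f z \<partial>uniform_sphere)"
proof -
  have "T \<in> borel \<rightarrow>\<^sub>M borel"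
    using assms(1) by (intro borel_measurable_continuous_onI linear_continuous_on linear_conv_bounded_linear[THEN iffD1])
  then have "(\<integral>z. f z \<partial>distr uniform_sphere borel T) = (\<integral>z. f (T z) \<partial>uniform_sphere)"
    using assms(4) by (subst integral_distr) (auto cong: measurable_cong_sets simp: sets_uniform_sphere)
  then show ?thesis by (simp add: uniform_sphere_invariant[OF assms(1-3)])
qed

lemma norm_signed_coordinates:
  fixes s :: "'a::euclidean_space \<Rightarrow> real"
  assumes t: "t permutes Basis" and s: "\<And>j. j \<in> Basis \<Longrightarrow> \<bar>s j\<bar> = 1"
  shows "norm (\<Sum>j\<in>Basis. (s j * (x \<bullet> t j)) *\<^sub>R j) = norm (x :: 'a)"
proof -
  have "(\<Sum>j\<in>Basis. (s j * (x \<bullet> t j)) *\<^sub>R j) \<bullet> b = s b * (x \<bullet> t b)" if "b \<in> Basis" for b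
    using that by (simp add: inner_sum_left inner_Basis if_distrib cong: if_cong)
  then have "norm (\<Sum>j\<in>Basis. (s j * (x \<bullet> t j)) *\<^sub>R j) = sqrt (\<Sum>j\<in>Basis. (s j * (x \<bullet> t j))\<^sup>2)"
    by (subst norm_eq_sqrt_inner, subst euclidean_inner) (simp only: power2_eq_square cong: sum.cong)
  also have "(\<Sum>j\<in>Basis. (s j * (x \<bullet> t j))\<^sup>2) = (\<Sum>j\<in>Basis. (x \<bullet> t j)\<^sup>2)"
    using s by (intro sum.cong) (auto simp: power_mult_distrib abs_square_eq_1)
  also have "\<dots> = (\<Sum>j\<in>Basis. (x \<bullet> j)\<^sup>2)"
    using sum.permute[OF t, of "\<lambda>j. (x \<bullet> j)\<^sup>2"] by (simp add: o_def)
  finally show ?thesis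
    by (simp only: norm_eq_sqrt_inner[of x] euclidean_inner[of x x] power2_eq_square)
qed

lemma uniform_sphere_sign_change:
  fixes f :: "'a::euclidean_space \<Rightarrow> real"
  assumes "\<And>j. j \<in> Basis \<Longrightarrow> \<bar>s j\<bar> = 1" "f \<in> borel_measurable borel"
  shows "(\<integral>z. f (\<Sum>j\<in>Basis. (s j * (z \<bullet> j)) *\<^sub>R j) \<partial>uniform_sphere) = (\<integral>z. f z \<partial>uniform_sphere)"
proof (rule uniform_sphere_integral_invariant)
  show "linear (\<lambda>z::'a. \<Sum>j\<in>Basis. (s j * (z \<bullet> j)) *\<^sub>R j)"
    by (intro linear_compose_sum) (auto simp: inner_add_left algebra_simps intro!: linearI)
qed (use assms lborel_sign_change norm_signed_coordinates[OF permutes_id, of s] in \<open>auto simp: id_def\<close>)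

lemma uniform_sphere_transpose_coordinates:
  fixes f :: "'a::euclidean_space \<Rightarrow> real"
  assumes "i \<in> Basis" "k \<in> Basis" "f \<in> borel_measurable borel"
  shows "(\<integral>z. f (\<Sum>j\<in>Basis. (z \<bullet> Transposition.transpose i k j) *\<^sub>R j) \<partial>uniform_sphere)
      = (\<integral>z. f z \<partial>uniform_sphere)"
proof (rule uniform_sphere_integral_invariant)
  show "linear (\<lambda>z::'a. \<Sum>j\<in>Basis. (z \<bullet> Transposition.transpose i k j) *\<^sub>R j)"
    by (intro linear_compose_sum) (auto simp: inner_add_left algebra_simps intro!: linearI)
qed (use assms lborel_transpose_coordinates norm_signed_coordinates[OF permutes_swap_id, of i k "\<lambda>_. 1"] in auto)

lemma integrable_uniform_sphere:
  fixes f :: "'a::euclidean_space \<Rightarrow> real"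
  assumes "f \<in> borel_measurable borel" "\<And>z. norm z = 1 \<Longrightarrow> \<bar>f z\<bar> \<le> D"
  shows "integrable uniform_sphere f"
proof -
  interpret prob_space "uniform_sphere :: 'a measure" by (rule prob_space_uniform_sphere)
  have "AE z in uniform_sphere. norm (f z) \<le> D"
    using AE_uniform_sphere by eventually_elim (use assms(2) in auto)
  then show ?thesis
    using assms(1) by (intro integrable_const_bound) (auto cong: measurable_cong_sets simp: sets_uniform_sphere)
qed

lemma abs_coordinate_le_1: "norm z = 1 \<Longrightarrow> j \<in> Basis \<Longrightarrow> \<bar>z \<bullet> j\<bar> \<le> 1"
  using Basis_le_norm[of j z] by simp

text \<open>
  Reflecting one coordinate makes the mixed moments vanish. Exchanging two coordinates makes the second
  moments equal, and they add up to \<open>1\<close> since the direction has norm \<open>1\<close>.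
\<close>

lemma uniform_sphere_coordinate_product:
  fixes i k :: "'a::euclidean_space"
  assumes i: "i \<in> Basis" and k: "k \<in> Basis"
  shows "(\<integral>z. (z \<bullet> i) * (z \<bullet> k) \<partial>uniform_sphere) = (if i = k then 1 / DIM('a) else 0)"
proof (cases "i = k")
  case False
  define s :: "'a \<Rightarrow> real" where "s j = (if j = i then - 1 else 1)" for j
  have "(\<integral>z. (z \<bullet> i) * (z \<bullet> k) \<partial>uniform_sphere) =
      (\<integral>z. ((\<Sum>j\<in>Basis. (s j * (z \<bullet> j)) *\<^sub>R j) \<bullet> i) * ((\<Sum>j\<in>Basis. (s j * (z \<bullet> j)) *\<^sub>R j) \<bullet> k) \<partial>uniform_sphere)"
    by (rule uniform_sphere_sign_change[symmetric]) (auto simp: s_def)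
  also have "\<dots> = - (\<integral>z. (z \<bullet> i) * (z \<bullet> k) \<partial>uniform_sphere)"
    using i k False by (simp add: s_def inner_sum_left inner_Basis if_distrib cong: if_cong)
  finally show ?thesis using False by simp
next
  case True
  have eq: "(\<integral>z. (z \<bullet> j)\<^sup>2 \<partial>uniform_sphere)
      = (\<integral>z. (z \<bullet> i)\<^sup>2 \<partial>uniform_sphere)" if j: "j \<in> Basis" for j :: 'a
  proof -
    have "(\<integral>z. (z \<bullet> i)\<^sup>2 \<partial>uniform_sphere) =
        (\<integral>z. ((\<Sum>b\<in>Basis. (z \<bullet> Transposition.transpose i j b) *\<^sub>R b) \<bullet> i)\<^sup>2 \<partial>uniform_sphere)"
      by (rule uniform_sphere_transpose_coordinates[OF i j, symmetric]) auto
    also have "\<dots> = (\<integral>z. (z \<bullet> j)\<^sup>2 \<partial>uniform_sphere)"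
      using i j by (simp add: inner_sum_left inner_Basis if_distrib cong: if_cong)
    finally show ?thesis by simp
  qed
  interpret prob_space "uniform_sphere :: 'a measure" by (rule prob_space_uniform_sphere)
  have "real DIM('a) * (\<integral>z. (z \<bullet> i)\<^sup>2 \<partial>uniform_sphere)
      = (\<Sum>j\<in>Basis. \<integral>z. (z \<bullet> j)\<^sup>2 \<partial>(uniform_sphere :: 'a measure))"
    using eq by simp
  also have "\<dots> = (\<integral>z. (\<Sum>j\<in>Basis. (z \<bullet> j)\<^sup>2) \<partial>(uniform_sphere :: 'a measure))"
  proof (rule Bochner_Integration.integral_sum[symmetric])
    fix j :: 'a assume j: "j \<in> Basis"
    show "integrable uniform_sphere (\<lambda>z. (z \<bullet> j)\<^sup>2)"
      using j by (intro integrable_uniform_sphere[where D = 1]) (auto simp: abs_square_le_1 abs_coordinate_le_1)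
  qed
  also have "\<dots> = (\<integral>z. 1 \<partial>(uniform_sphere :: 'a measure))"
  proof (rule integral_cong_AE)
    show "AE z in (uniform_sphere :: 'a measure). (\<Sum>j\<in>Basis. (z \<bullet> j)\<^sup>2) = 1"
      using AE_uniform_sphere
    proof eventually_elim
      case (elim z)
      then have "z \<bullet> z = 1" by (simp add: norm_eq_1)
      then show ?case by (simp add: euclidean_inner[of z z] power2_eq_square)
    qed
  qed measurable
  also have "\<dots> = 1" by (simp add: prob_space)
  finally show ?thesis using True by (simp add: power2_eq_square field_simps)
qed

lemma uniform_sphere_moments:
  fixes \<theta> :: "'a::euclidean_space"
  shows "(\<integral>z. \<theta> \<bullet> z \<partial>uniform_sphere) = 0"
    and "(\<integral>z. (\<theta> \<bullet> z)\<^sup>2 \<partial>uniform_sphere) = (norm \<theta>)\<^sup>2 / DIM('a)"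
proof -
  have "(\<integral>z. \<theta> \<bullet> z \<partial>uniform_sphere) = (\<integral>z. \<theta> \<bullet> (\<Sum>j\<in>Basis. ((- 1) * (z \<bullet> j)) *\<^sub>R j) \<partial>uniform_sphere)"
    by (rule uniform_sphere_sign_change[symmetric]) auto
  also have "\<dots> = (\<integral>z. - (\<theta> \<bullet> z) \<partial>uniform_sphere)"
    by (intro Bochner_Integration.integral_cong refl)
      (simp add: sum_negf euclidean_representation)
  finally show "(\<integral>z. \<theta> \<bullet> z \<partial>uniform_sphere) = 0" by simp
  have int: "integrable uniform_sphere (\<lambda>z::'a. (z \<bullet> i) * (z \<bullet> k))" if "i \<in> Basis" "k \<in> Basis" for i k
    using that
    by (intro integrable_uniform_sphere[where D = 1]) (auto simp: abs_mult abs_coordinate_le_1 intro!: mult_le_one)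
  have "(\<theta> \<bullet> z)\<^sup>2 = (\<Sum>i\<in>Basis. \<Sum>k\<in>Basis. ((\<theta> \<bullet> i) * (\<theta> \<bullet> k)) * ((z \<bullet> i) * (z \<bullet> k)))" for z
    by (subst euclidean_inner[of \<theta> z]) (simp add: power2_eq_square sum_product algebra_simps)
  then have "(\<integral>z. (\<theta> \<bullet> z)\<^sup>2 \<partial>uniform_sphere) =
      (\<Sum>i\<in>Basis. \<Sum>k\<in>Basis. ((\<theta> \<bullet> i) * (\<theta> \<bullet> k)) * (\<integral>z. (z \<bullet> i) * (z \<bullet> k) \<partial>uniform_sphere))"
    using int by (simp add: Bochner_Integration.integral_sum Bochner_Integration.integrable_sum)
  also have "\<dots> = (\<Sum>i\<in>Basis. (\<theta> \<bullet> i) * (\<theta> \<bullet> i) / DIM('a))"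
    by (intro sum.cong refl) (simp add: uniform_sphere_coordinate_product if_distrib cong: if_cong)
  also have "\<dots> = (norm \<theta>)\<^sup>2 / DIM('a)"
    by (simp add: power2_norm_eq_inner euclidean_inner[of \<theta> \<theta>] sum_divide_distrib)
  finally show "(\<integral>z. (\<theta> \<bullet> z)\<^sup>2 \<partial>uniform_sphere) = (norm \<theta>)\<^sup>2 / DIM('a)" .
qed

section \<open>Grid averages\<close>

lemma integral_grid_distr:
  fixes f :: "'a::euclidean_space \<Rightarrow> real"
  assumes "f \<in> borel_measurable borel"
  shows "(\<integral>x. f x \<partial>grid_distr n g) = (\<Sum>i<n. f (g i)) / real n"
  unfolding grid_distr_def using assms
  by (subst integral_distr) (auto simp: integral_uniform_count_measure cong: measurable_cong_sets simp: sets_uniform_count_measure_count_space)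

text \<open>
  A continuous function with values in the unit interval that vanishes near the origin and near and outside
  of the unit sphere, and increases to the indicator of the punctured open ball.
\<close>

definition cutoff :: "nat \<Rightarrow> 'a::euclidean_space \<Rightarrow> real" where
  "cutoff k u = max 0 (min 1 (real k * min (norm u) (1 - norm u) - 1))"

lemma cutoff_range: "0 \<le> cutoff k u" "cutoff k u \<le> 1"
  by (auto simp: cutoff_def)

lemma continuous_cutoff: "continuous_on A (cutoff k)"
  unfolding cutoff_def by (intro continuous_intros)

lemma cutoff_eq_0: "real k * min (norm u) (1 - norm u) < 1 \<Longrightarrow> cutoff k u = 0"
  by (auto simp: cutoff_def)

lemma cutoff_tendsto: "u \<in> ball 0 1 - {0} \<Longrightarrow> (\<lambda>k. cutoff k u) \<longlonglongrightarrow> 1"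
proof (rule tendsto_eventually)
  assume u: "u \<in> ball 0 1 - {0}"
  define d where "d = min (norm u) (1 - norm u)"
  have "0 < d" using u by (auto simp: d_def)
  have "cutoff k u = 1" if "nat \<lceil>2 / d\<rceil> \<le> k" for k
  proof -
    have "2 / d \<le> real k" using that by linarith
    then have "2 \<le> real k * d" using \<open>0 < d\<close> by (simp add: field_simps)
    then show ?thesis by (simp add: cutoff_def flip: d_def)
  qed
  then show "\<forall>\<^sub>F k in sequentially. cutoff k u = 1"
    unfolding eventually_sequentially by blast
qed

lemma continuous_cutoff_times:
  fixes f :: "'a::euclidean_space \<Rightarrow> real"
  assumes "continuous_on (ball 0 1 - {0}) f"
  shows "continuous_on UNIV (\<lambda>u. cutoff k u * f u)"
proof -
  let ?B = "{u::'a. real k * min (norm u) (1 - norm u) < 1}"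
  have "open ?B"
    by (intro open_Collect_less continuous_intros)
  moreover have "continuous_on ?B (\<lambda>u. cutoff k u * f u)"
    by (rule continuous_on_eq[of _ "\<lambda>_. 0"]) (auto simp: cutoff_eq_0)
  moreover have "continuous_on (ball 0 1 - {0}) (\<lambda>u. cutoff k u * f u)"
    by (intro continuous_intros continuous_cutoff assms)
  ultimately have "continuous_on ((ball 0 1 - {0}) \<union> ?B) (\<lambda>u. cutoff k u * f u)"
    by (intro continuous_on_open_Un) (auto intro: open_Diff)
  moreover have "(ball 0 1 - {0}) \<union> ?B = UNIV"
    by (auto simp: not_less mult_nonneg_nonpos min_def intro: order_le_less_trans[OF mult_nonneg_nonpos])
  ultimately show ?thesis by simp
qed

text \<open>
  Weak convergence applies to \<open>cutoff k u * f u\<close>, which is continuous everywhere. The error made by the cutoff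
  is at most \<open>C\<close> times the mean of \<open>1 - cutoff k u\<close>, both for the grid and in the limit, and the latter
  tends to \<open>0\<close> since \<open>spherical_uniform\<close> is carried by the punctured open ball.
\<close>

theorem grid_average_tendsto:
  fixes g :: "nat \<Rightarrow> nat \<Rightarrow> 'a::euclidean_space" and f :: "'a \<Rightarrow> real"
  assumes g: "grid_sequence g" and f: "continuous_on (ball 0 1 - {0}) f"
    and C: "\<And>u. u \<in> cball 0 1 \<Longrightarrow> \<bar>f u\<bar> \<le> C"
  shows "(\<lambda>n. (\<Sum>i<n. f (g n i)) / real n) \<longlonglongrightarrow> (LINT u:ball 0 1 - {0}|spherical_uniform. f u)"
proof -
  interpret U: prob_space "spherical_uniform :: 'a measure" by (rule prob_space_spherical_uniform)
  let ?D = "ball 0 1 - {0::'a}"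
  let ?A = "\<lambda>h n. (\<Sum>i<n. h (g n i)) / real n :: real"
  have C0: "0 \<le> C" using C[of 0] by simp
  have g_in: "g n i \<in> cball 0 1" if "i < n" for n i
    using g that by (auto simp: grid_sequence_def)
  have cont_conv: "?A h \<longlonglongrightarrow> (\<integral>u. h u \<partial>spherical_uniform)"
    if "continuous_on UNIV h" "\<And>u. \<bar>h u\<bar> \<le> D" for h D
  proof -
    have "bounded (range h)" using that(2) by (auto simp: bounded_iff)
    then have "(\<lambda>n. \<integral>u. h u \<partial>grid_distr n (g n)) \<longlonglongrightarrow> (\<integral>u. h u \<partial>spherical_uniform)"
      using g that(1) by (auto simp: grid_sequence_def weakly_converges_def)
    then show ?thesis
      using borel_measurable_continuous_onI[OF that(1)] by (simp add: integral_grid_distr)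
  qed
  have cf_bd: "\<bar>cutoff k u * f u\<bar> \<le> C" for k u
  proof (cases "u \<in> cball 0 1")
    case True
    then show ?thesis
      using mult_mono[OF cutoff_range(2) C[OF True], of k u] cutoff_range[of k u] by (simp add: abs_mult)
  next
    case False
    then have "min (norm u) (1 - norm u) \<le> 0" by auto
    then have "cutoff k u = 0"
      by (intro cutoff_eq_0) (meson mult_nonneg_nonpos of_nat_0_le_iff order_le_less_trans zero_less_one)
    then show ?thesis using C0 by simp
  qed
  have [measurable]: "(cutoff k :: 'a \<Rightarrow> real) \<in> borel_measurable borel" for k
    by (rule borel_measurable_continuous_onI[OF continuous_cutoff])
  have [measurable]: "(\<lambda>u. cutoff k u * f u) \<in> borel_measurable borel" for k
    by (rule borel_measurable_continuous_onI[OF continuous_cutoff_times[OF f]])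
  have [measurable]: "(\<lambda>u. indicator ?D u * f u) \<in> borel_measurable borel"
    using borel_measurable_continuous_on_indicator[OF _ f] by simp
  have int_cutoff: "integrable spherical_uniform (cutoff k :: 'a \<Rightarrow> real)" for k
    by (rule U.integrable_const_bound[where B=1]) (auto simp: cutoff_range)
  have U_lim: "(\<lambda>k. \<integral>u. cutoff k u \<partial>(spherical_uniform :: 'a measure)) \<longlonglongrightarrow> 1"
  proof -
    have "(\<lambda>k. \<integral>u. cutoff k u \<partial>(spherical_uniform :: 'a measure))
        \<longlonglongrightarrow> (\<integral>u. 1 \<partial>(spherical_uniform :: 'a measure))"
    proof (rule integral_dominated_convergence[where w="\<lambda>_. 1"])
      show "AE u in spherical_uniform. (\<lambda>k. cutoff k (u::'a)) \<longlonglongrightarrow> 1"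
        using AE_spherical_uniform by eventually_elim (rule cutoff_tendsto)
    qed (auto simp: cutoff_range)
    then show ?thesis by (simp add: U.prob_space)
  qed
  have U_bd: "\<bar>(\<integral>u. cutoff k u * f u \<partial>spherical_uniform) - (LINT u:?D|spherical_uniform. f u)\<bar>
      \<le> C * (1 - (\<integral>u. cutoff k u \<partial>(spherical_uniform :: 'a measure)))" for k
  proof -
    have i1: "integrable spherical_uniform (\<lambda>u. cutoff k u * f u)"
      by (rule U.integrable_const_bound[where B=C]) (use cf_bd in auto)
    have i2: "integrable spherical_uniform (\<lambda>u. indicator ?D u * f u)"
    proof (rule U.integrable_const_bound[where B=C])
      show "AE u in spherical_uniform. norm (indicator ?D u * f u) \<le> C"
        using C C0 by (auto simp: indicator_def)
    qed measurable
    have "\<bar>(\<integral>u. cutoff k u * f u \<partial>spherical_uniform) - (LINT u:?D|spherical_uniform. f u)\<bar>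
      = \<bar>\<integral>u. cutoff k u * f u - indicator ?D u * f u \<partial>spherical_uniform\<bar>"
      using i1 i2 by (simp add: set_lebesgue_integral_def)
    also have "\<dots> \<le> (\<integral>u. \<bar>cutoff k u * f u - indicator ?D u * f u\<bar> \<partial>spherical_uniform)"
      by (rule integral_abs_bound)
    also have "\<dots> \<le> (\<integral>u. C * (1 - cutoff k u) \<partial>(spherical_uniform :: 'a measure))"
    proof (rule integral_mono_AE)
      show "AE u in (spherical_uniform :: 'a measure). \<bar>cutoff k u * f u - indicator ?D u * f u\<bar>
          \<le> C * (1 - cutoff k u)"
        using AE_spherical_uniform
      proof eventually_elim
        case (elim u)
        have "cutoff k u * f u - indicator ?D u * f u = - (f u * (1 - cutoff k u))"
          using elim by (simp add: algebra_simps)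
        then have "\<bar>cutoff k u * f u - indicator ?D u * f u\<bar> = \<bar>f u\<bar> * (1 - cutoff k u)"
          using cutoff_range(2)[of k u] by (simp only: abs_minus_cancel abs_mult)
        then show ?case
          using C[of u] elim cutoff_range(2)[of k u] by (simp add: mult_right_mono)
      qed
    qed (use i1 i2 int_cutoff in auto)
    also have "\<dots> = C * (1 - (\<integral>u. cutoff k u \<partial>(spherical_uniform :: 'a measure)))"
      using int_cutoff by (simp add: U.prob_space)
    finally show ?thesis .
  qed
  have A_bd: "\<bar>?A f n - ?A (\<lambda>u. cutoff k u * f u) n\<bar> \<le> C * (1 - ?A (cutoff k) n)" if "0 < n" for n k
  proof -
    have "\<bar>(\<Sum>i<n. f (g n i)) - (\<Sum>i<n. cutoff k (g n i) * f (g n i))\<bar> \<le> (\<Sum>i<n. \<bar>f (g n i)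
        - cutoff k (g n i) * f (g n i)\<bar>)"
      by (simp only: sum_subtractf[symmetric] sum_abs)
    also have "\<dots> \<le> (\<Sum>i<n. C * (1 - cutoff k (g n i)))"
    proof (rule sum_mono)
      fix i assume "i \<in> {..<n}"
      then have "\<bar>f (g n i)\<bar> \<le> C" using C g_in by auto
      moreover have "f (g n i) - cutoff k (g n i) * f (g n i) = f (g n i) * (1 - cutoff k (g n i))"
        by (simp add: algebra_simps)
      ultimately show "\<bar>f (g n i) - cutoff k (g n i) * f (g n i)\<bar> \<le> C * (1 - cutoff k (g n i))"
        using cutoff_range(2)[of k "g n i"] by (simp add: abs_mult mult_right_mono)
    qed
    also have "\<dots> = C * (real n - (\<Sum>i<n. cutoff k (g n i)))"
      by (simp add: sum_distrib_left[symmetric] sum_subtractf)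
    finally show ?thesis
      using that by (simp add: diff_divide_distrib[symmetric] field_simps)
  qed
  show ?thesis
  proof (rule LIMSEQ_I)
    fix r :: real assume r: "0 < r"
    let ?I = "LINT u:?D|spherical_uniform. f u"
    have "(\<lambda>k. 2 * C * (1 - (\<integral>u. cutoff k u \<partial>(spherical_uniform :: 'a measure)))) \<longlonglongrightarrow> 2 * C * (1 - 1)"
      by (intro tendsto_intros U_lim)
    then have "\<forall>\<^sub>F k in sequentially. 2 * C * (1
        - (\<integral>u. cutoff k u \<partial>(spherical_uniform :: 'a measure))) < r"
      using r by (intro order_tendstoD) simp_all
    then obtain k where k: "2 * C * (1 - (\<integral>u. cutoff k u \<partial>(spherical_uniform :: 'a measure))) < r"
      by (auto simp: eventually_sequentially)
    have "?A (\<lambda>u. cutoff k u * f u) \<longlonglongrightarrow> (\<integral>u. cutoff k u * f u \<partial>spherical_uniform)"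
      by (rule cont_conv[OF continuous_cutoff_times[OF f] cf_bd])
    moreover have "\<bar>cutoff k u\<bar> \<le> 1" for u :: 'a
      using cutoff_range[of k u] by simp
    from cont_conv[OF continuous_cutoff this] have "?A (cutoff k)
        \<longlonglongrightarrow> (\<integral>u. cutoff k u \<partial>(spherical_uniform :: 'a measure))"
      .
    ultimately have "(\<lambda>n. C * (1 - ?A (cutoff k) n) + \<bar>?A (\<lambda>u. cutoff k u * f u) n - ?I\<bar>)
      \<longlonglongrightarrow> C * (1 - (\<integral>u. cutoff k u \<partial>(spherical_uniform :: 'a measure))) + \<bar>(\<integral>u. cutoff k u * f u \<partial>spherical_uniform) - ?I\<bar>"
      by (intro tendsto_intros)
    moreover have "C * (1 - (\<integral>u. cutoff k u \<partial>(spherical_uniform :: 'a measure)))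
        + \<bar>(\<integral>u. cutoff k u * f u \<partial>spherical_uniform) - ?I\<bar> < r"
      using U_bd[of k] k by linarith
    ultimately have "\<forall>\<^sub>F n in sequentially. C * (1 - ?A (cutoff k) n) + \<bar>?A (\<lambda>u. cutoff k u * f u) n
        - ?I\<bar> < r"
      by (rule order_tendstoD)
    then have "\<forall>\<^sub>F n in sequentially. norm (?A f n - ?I) < r"
      using eventually_gt_at_top[of 0]
    proof eventually_elim
      case (elim n)
      then show ?case using A_bd[OF elim(2), of k] unfolding real_norm_def by linarith
    qed
    then show "\<exists>n0. \<forall>n\<ge>n0. norm (?A f n - ?I) < r"
      by (simp add: eventually_sequentially)
  qed
qed


section \<open>Optimal assignments\<close>

definition transport_cost :: "nat \<Rightarrow> (nat \<Rightarrow> 'a::euclidean_space) \<Rightarrow> (nat \<Rightarrow> 'a) \<Rightarrow> (nat \<Rightarrow> nat) \<Rightarrow> real" where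
  "transport_cost n g x p = (\<Sum>j<n. (norm (g (p j) - x j))\<^sup>2)"

definition opt_perm :: "nat \<Rightarrow> (nat \<Rightarrow> 'a::euclidean_space) \<Rightarrow> (nat \<Rightarrow> 'a) \<Rightarrow> nat \<Rightarrow> nat" where
  "opt_perm n g x = arg_min (transport_cost n g x) (\<lambda>p. p permutes {..<n})"

text \<open>
  The choice made by \<open>opt_perm\<close> depends on the sample only through this set, which takes finitely many values;
  measurability of the choice follows, however ties are broken.
\<close>

definition optimal_perms :: "nat \<Rightarrow> (nat \<Rightarrow> 'a::euclidean_space) \<Rightarrow> (nat \<Rightarrow> 'a) \<Rightarrow> (nat \<Rightarrow> nat) set" where
  "optimal_perms n g x =
     {p. p permutes {..<n} \<and> (\<forall>q\<in>{q. q permutes {..<n}}. transport_cost n g x p \<le> transport_cost n g x q)}"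

lemma center_outward_df_opt_perm: "center_outward_df n g x i = g (opt_perm n g x i)"
  by (simp add: center_outward_df_def opt_perm_def transport_cost_def[abs_def])

lemma opt_perm_eq_SOME: "opt_perm n g x = (SOME p. p \<in> optimal_perms n g x)"
  unfolding opt_perm_def arg_min_def is_arg_min_def optimal_perms_def
  by (rule arg_cong[where f = Eps]) (auto simp: fun_eq_iff not_less)

lemma opt_perm_optimal: "opt_perm n g x \<in> optimal_perms n g x"
proof -
  let ?P = "{p. p permutes {..<n}}"
  have "id \<in> ?P" by (simp add: permutes_id)
  then have "arg_min_on (transport_cost n g x) ?P \<in> optimal_perms n g x"
    using arg_min_if_finite[OF finite_perms, of n "transport_cost n g x"]
      arg_min_least[OF finite_perms, of n _ "transport_cost n g x"] unfolding optimal_perms_def by blast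
  then show ?thesis
    by (simp add: opt_perm_def arg_min_on_def)
qed

lemma opt_perm_permutes: "opt_perm n g x permutes {..<n}"
  using opt_perm_optimal[of n g x] by (simp add: optimal_perms_def)

lemma opt_perm_cong:
  assumes "\<And>j. j < n \<Longrightarrow> x j = y j"
  shows "opt_perm n g x = opt_perm n g y"
proof -
  have "transport_cost n g x = transport_cost n g y"
    using assms by (auto simp: transport_cost_def fun_eq_iff intro!: sum.cong)
  then show ?thesis by (simp add: opt_perm_def)
qed

lemma measurable_opt_perm:
  assumes [measurable]: "\<And>j. j < n \<Longrightarrow> (\<lambda>\<omega>. x \<omega> j) \<in> borel_measurable N"
  shows "(\<lambda>\<omega>. opt_perm n g (x \<omega>)) \<in> N \<rightarrow>\<^sub>M count_space UNIV"
proof -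
  let ?P = "{p. p permutes {..<n}}"
  have cost [measurable]: "(\<lambda>\<omega>. transport_cost n g (x \<omega>) p) \<in> borel_measurable N" for p
    unfolding transport_cost_def by measurable
  have "(\<lambda>\<omega>. optimal_perms n g (x \<omega>)) \<in> N \<rightarrow>\<^sub>M count_space (Pow ?P)"
    unfolding measurable_count_space_eq2[OF finite_Pow_iff[THEN iffD2, OF finite_perms]]
  proof (intro conjI ballI)
    fix S assume S: "S \<in> Pow ?P"
    have "(\<lambda>\<omega>. optimal_perms n g (x \<omega>)) -` {S} \<inter> space N =
        {\<omega> \<in> space N. \<forall>p\<in>?P. p \<in> S \<longleftrightarrow> (\<forall>q\<in>?P. transport_cost n g (x \<omega>) p \<le> transport_cost n g (x \<omega>) q)}"
      using S by (auto simp: optimal_perms_def)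
    also have "\<dots> \<in> sets N"
    proof (rule sets.sets_Collect_finite_All[OF _ finite_perms])
      have "Measurable.pred N (\<lambda>\<omega>. \<forall>q\<in>?P. transport_cost n g (x \<omega>) p \<le> transport_cost n g (x \<omega>) q)" for p
        by (rule pred_intros_finite(3)[OF finite_perms]) measurable
      then show "{\<omega> \<in> space N. p \<in> S \<longleftrightarrow> (\<forall>q\<in>?P. transport_cost n g (x \<omega>) p
          \<le> transport_cost n g (x \<omega>) q)} \<in> sets N" for p
        by simp
    qed
    finally show "(\<lambda>\<omega>. optimal_perms n g (x \<omega>)) -` {S} \<inter> space N \<in> sets N" .
  qed (auto simp: optimal_perms_def)
  then show ?thesis
    unfolding opt_perm_eq_SOME by (rule measurable_compose) simp
qed

text \<open>
  The rank statistic as a function of the permutation that assigns grid points to sample points; \<open>a j\<close> is the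
  score of the \<open>j\<close>-th grid point.
\<close>

definition score_statistic :: "(nat \<Rightarrow> 'a::euclidean_space) \<Rightarrow> nat \<Rightarrow> nat set \<Rightarrow> (nat \<Rightarrow> nat) \<Rightarrow> 'a" where
  "score_statistic a n I p = srs_scale n I *\<^sub>R (\<Sum>i\<in>I. a (p i) - (1 / real n) *\<^sub>R (\<Sum>j<n. a j))"

lemma rank_statistic_eq:
  "rank_statistic J nR n g y x =
     score_statistic (\<lambda>j. vector_score J (g j)) n (positive_indices n y) (opt_perm n g (\<lambda>i. y i *\<^sub>R x i))"
proof -
  let ?I = "positive_indices n y"
  have sub: "?I \<subseteq> {..<n}" by (auto simp: positive_indices_def)
  have card: "real (card ({..<n} - ?I)) = real n - real (card ?I)"
    using card_mono[OF finite_lessThan sub] finite_subset[OF sub] by (simp add: card_Diff_subset sub of_nat_diff)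
  have score: "J (co_rank nR n g z i / (real nR + 1)) *\<^sub>R co_sign n g z i
      = vector_score J (g (opt_perm n g z i))" for z i
    by (simp add: co_rank_def co_sign_def vector_score_def center_outward_df_opt_perm add_nonneg_eq_0_iff)
  show ?thesis
    unfolding rank_statistic_def Let_def score_statistic_def srs_scale_def score card grid_score_def sum_subtractf
    by (simp add: sum_constant_scaleR)
qed

text \<open>
  The statistic is a function of two measurable objects with finitely many values, the set of positive
  signs and the optimal permutation, so that \<open>J\<close> may be an arbitrary function.
\<close>

lemma measurable_rank_statistic:
  fixes g :: "nat \<Rightarrow> 'a::euclidean_space"
  assumes y [measurable]: "\<And>i. (\<lambda>\<omega>. y \<omega> i) \<in> borel_measurable N"
    and x [measurable]: "\<And>i. (\<lambda>\<omega>. x \<omega> i) \<in> borel_measurable N"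
  shows "(\<lambda>\<omega>. rank_statistic J nR n g (y \<omega>) (x \<omega>)) \<in> borel_measurable N"
proof -
  have "(\<lambda>\<omega>. positive_indices n (y \<omega>)) \<in> N \<rightarrow>\<^sub>M count_space (Pow {..<n})"
    unfolding measurable_count_space_eq2[OF finite_Pow_iff[THEN iffD2, OF finite_lessThan]]
  proof (intro conjI ballI)
    fix S assume S: "S \<in> Pow {..<n}"
    have "(\<lambda>\<omega>. positive_indices n (y \<omega>)) -` {S} \<inter> space N = {\<omega> \<in> space N. \<forall>i\<in>{..<n}. i \<in> S \<longleftrightarrow> y \<omega> i = 1}"
      using S by (auto simp: positive_indices_def)
    also have "\<dots> \<in> sets N" by measurable
    finally show "(\<lambda>\<omega>. positive_indices n (y \<omega>)) -` {S} \<inter> space N \<in> sets N" .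
  qed (auto simp: positive_indices_def)
  then show ?thesis
    unfolding rank_statistic_eq
  proof (rule measurable_compose_countable'[rotated])
    show "(\<lambda>\<omega>. score_statistic (\<lambda>j. vector_score J (g j)) n S (opt_perm n g (\<lambda>i. y \<omega> i *\<^sub>R x \<omega> i))) \<in> borel_measurable N" for S
      by (rule measurable_compose[OF measurable_opt_perm]) auto
  qed (simp add: countable_finite)
qed

section \<open>Conditioning on an independent variable\<close>

lemma (in prob_space) joint_distr_of_indep_set:
  assumes X [measurable]: "X \<in> M \<rightarrow>\<^sub>M LX" and Y [measurable]: "Y \<in> M \<rightarrow>\<^sub>M LY"
    and ind: "indep_set (sets (vimage_algebra (space M) X LX)) (sets (vimage_algebra (space M) Y LY))"
  shows "distr M LX X \<Otimes>\<^sub>M distr M LY Y = distr M (LX \<Otimes>\<^sub>M LY) (\<lambda>\<omega>. (X \<omega>, Y \<omega>))"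
proof (rule pair_measure_eqI)
  interpret DX: prob_space "distr M LX X" by (rule prob_space_distr) fact
  interpret DY: prob_space "distr M LY Y" by (rule prob_space_distr) fact
  show "sigma_finite_measure (distr M LX X)" "sigma_finite_measure (distr M LY Y)" ..
  show "sets (distr M LX X \<Otimes>\<^sub>M distr M LY Y) = sets (distr M (LX \<Otimes>\<^sub>M LY) (\<lambda>\<omega>. (X \<omega>, Y \<omega>)))"
    by simp
  fix A B assume "A \<in> sets (distr M LX X)" "B \<in> sets (distr M LY Y)"
  then have A: "A \<in> sets LX" and B: "B \<in> sets LY" by simp_all
  have "prob ((X -` A \<inter> space M) \<inter> (Y -` B \<inter> space M))
      = prob (X -` A \<inter> space M) * prob (Y -` B \<inter> space M)"
    using ind in_vimage_algebra[OF A, of X "space M"] in_vimage_algebra[OF B, of Y "space M"]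
    unfolding indep_sets2_eq by blast
  moreover have "(\<lambda>\<omega>. (X \<omega>, Y \<omega>)) -` (A \<times> B) \<inter> space M = (X -` A \<inter> space M) \<inter> (Y -` B \<inter> space M)"
    by auto
  ultimately show "emeasure (distr M LX X) A * emeasure (distr M LY Y) B =
      emeasure (distr M (LX \<Otimes>\<^sub>M LY) (\<lambda>\<omega>. (X \<omega>, Y \<omega>))) (A \<times> B)"
    using A B by (simp add: emeasure_distr emeasure_eq_measure ennreal_mult)
qed

text \<open>
  By Fubini's theorem for the joint law, which is a product: fixing the value \<open>y\<close> of \<open>Y\<close> in \<open>f\<close> does not affect
  the law of \<open>X\<close>.
\<close>

lemma conditional_distr_of_independent:
  assumes M: "prob_space M" and X [measurable]: "X \<in> M \<rightarrow>\<^sub>M LX" and Y [measurable]: "Y \<in> M \<rightarrow>\<^sub>M LY"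
    and ind: "prob_space.indep_set M (sets (vimage_algebra (space M) X LX)) (sets (vimage_algebra (space M) Y LY))"
    and f: "(\<lambda>(y, x). f y x) \<in> LY \<Otimes>\<^sub>M LX \<rightarrow>\<^sub>M N"
  shows "conditional_distr M LY Y N (\<lambda>\<omega>. f (Y \<omega>) (X \<omega>)) (\<lambda>y. distr M N (\<lambda>\<omega>. f y (X \<omega>)))"
proof -
  interpret prob_space M by fact
  note joint = joint_distr_of_indep_set[OF X Y ind, symmetric]
  interpret DX: prob_space "distr M LX X" by (rule prob_space_distr) fact
  interpret DY: prob_space "distr M LY Y" by (rule prob_space_distr) fact
  interpret P: pair_prob_space "distr M LX X" "distr M LY Y" ..
  have f' [measurable]: "(\<lambda>(x, y). f y x) \<in> LX \<Otimes>\<^sub>M LY \<rightarrow>\<^sub>M N"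
    using measurable_compose[OF measurable_pair_swap' f] by (simp add: case_prod_beta)
  have T: "(\<lambda>\<omega>. f (Y \<omega>) (X \<omega>)) \<in> M \<rightarrow>\<^sub>M N"
    using measurable_compose[OF measurable_Pair[OF Y X] f] by simp
  have fy: "(\<lambda>x. f y x) \<in> LX \<rightarrow>\<^sub>M N" if "y \<in> space LY" for y
    using measurable_compose[OF measurable_Pair1'[OF that] f] by simp
  have kernel: "(\<lambda>y. distr M N (\<lambda>\<omega>. f y (X \<omega>))) \<in> LY \<rightarrow>\<^sub>M prob_algebra N"
  proof (rule measurable_distr_prob_space2)
    show "(\<lambda>_. M) \<in> LY \<rightarrow>\<^sub>M prob_algebra M"
      by (rule measurable_const) (simp add: space_prob_algebra M)
    show "(\<lambda>(y, \<omega>). f y (X \<omega>)) \<in> LY \<Otimes>\<^sub>M M \<rightarrow>\<^sub>M N"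
      using measurable_compose[OF measurable_Pair[OF measurable_fst measurable_compose[OF measurable_snd X]] f]
      by (simp add: case_prod_beta)
  qed
  have "emeasure M {\<omega> \<in> space M. Y \<omega> \<in> A \<and> f (Y \<omega>) (X \<omega>) \<in> B} =
      (\<integral>\<^sup>+y\<in>A. emeasure (distr M N (\<lambda>\<omega>. f y (X \<omega>))) B \<partial>distr M LY Y)"
    if A [measurable]: "A \<in> sets LY" and B [measurable]: "B \<in> sets N" for A B
  proof -
    define E where "E = {z \<in> space (LX \<Otimes>\<^sub>M LY). snd z \<in> A \<and> f (snd z) (fst z) \<in> B}"
    have E [measurable]: "E \<in> sets (LX \<Otimes>\<^sub>M LY)"
    proof -
      have [measurable]: "(\<lambda>z. f (snd z) (fst z)) \<in> LX \<Otimes>\<^sub>M LY \<rightarrow>\<^sub>M N"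
        using f' by (simp add: case_prod_beta)
      show ?thesis unfolding E_def by measurable
    qed
    have "{\<omega> \<in> space M. Y \<omega> \<in> A \<and> f (Y \<omega>) (X \<omega>) \<in> B} = (\<lambda>\<omega>. (X \<omega>, Y \<omega>)) -` E \<inter> space M"
      using measurable_space[OF X] measurable_space[OF Y] by (auto simp: E_def space_pair_measure)
    then have "emeasure M {\<omega> \<in> space M. Y \<omega> \<in> A \<and> f (Y \<omega>) (X \<omega>) \<in> B} =
        emeasure (distr M (LX \<Otimes>\<^sub>M LY) (\<lambda>\<omega>. (X \<omega>, Y \<omega>))) E"
      by (simp add: emeasure_distr)
    also have "\<dots> = (\<integral>\<^sup>+y. emeasure (distr M LX X) ((\<lambda>x. (x, y)) -` E) \<partial>distr M LY Y)"
      unfolding joint by (rule P.emeasure_pair_measure_alt2) simp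
    also have "\<dots> = (\<integral>\<^sup>+y\<in>A. emeasure (distr M N (\<lambda>\<omega>. f y (X \<omega>))) B \<partial>distr M LY Y)"
    proof (rule nn_integral_cong)
      fix y assume "y \<in> space (distr M LY Y)"
      then have y: "y \<in> space LY" by simp
      note [measurable] = fy[OF y]
      have "(\<lambda>x. (x, y)) -` E = (if y \<in> A then (\<lambda>x. f y x) -` B \<inter> space LX else {})"
        using y by (auto simp: E_def space_pair_measure)
      moreover have "emeasure (distr M LX X) ((\<lambda>x. f y x) -` B \<inter> space LX)
          = emeasure (distr M N (\<lambda>\<omega>. f y (X \<omega>))) B"
      proof -
        have "(\<lambda>\<omega>. f y (X \<omega>)) \<in> M \<rightarrow>\<^sub>M N"
          by (rule measurable_compose[OF X fy[OF y]])
        moreover have "X -` ((\<lambda>x. f y x) -` B \<inter> space LX) \<inter> space M = (\<lambda>\<omega>. f y (X \<omega>)) -` B \<inter> space M"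
          using measurable_space[OF X] by auto
        ultimately show ?thesis
          using measurable_sets[OF fy[OF y] B] by (simp add: emeasure_distr)
      qed
      ultimately show "emeasure (distr M LX X) ((\<lambda>x. (x, y)) -` E)
          = emeasure (distr M N (\<lambda>\<omega>. f y (X \<omega>))) B * indicator A y"
        by simp
    qed
    finally show ?thesis .
  qed
  with T kernel show ?thesis by (simp add: conditional_distr_def)
qed

section \<open>Uniqueness and exchangeability of the optimal assignment\<close>

lemma transport_cost_permute:
  assumes "\<pi> permutes {..<n}"
  shows "transport_cost n g (\<lambda>i. x (\<pi> i)) p = transport_cost n g x (p \<circ> inv \<pi>)"
proof -
  have "transport_cost n g x (p \<circ> inv \<pi>) = (\<Sum>j<n. (norm (g ((p \<circ> inv \<pi>) (\<pi> j)) - x (\<pi> j)))\<^sup>2)"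
    unfolding transport_cost_def
    using sum.permute[OF assms, of "\<lambda>j. (norm (g ((p \<circ> inv \<pi>) j) - x j))\<^sup>2"] by (simp add: o_def)
  then show ?thesis
    using permutes_inverses(2)[OF assms] by (simp add: transport_cost_def)
qed

text \<open>
  The sums of squared norms are the same for all permutations, so costs differ only in their linear part.
\<close>

lemma transport_cost_eq_iff:
  assumes p: "p permutes {..<n}" and q: "q permutes {..<n}"
  shows "transport_cost n g x p = transport_cost n g x q \<longleftrightarrow> (\<Sum>j<n. (g (p j) - g (q j)) \<bullet> x j) = 0"
proof -
  have expand: "transport_cost n g x r = (\<Sum>j<n. (norm (g j))\<^sup>2) + (\<Sum>j<n. (norm (x j))\<^sup>2)
      - 2 * (\<Sum>j<n. g (r j) \<bullet> x j)"
    if r: "r permutes {..<n}" for r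
  proof -
    have "(\<Sum>j<n. (norm (g j))\<^sup>2) = (\<Sum>j<n. (norm (g (r j)))\<^sup>2)"
      using sum.permute[OF r, of "\<lambda>j. (norm (g j))\<^sup>2"] by (simp add: o_def)
    then show ?thesis
      by (simp add: transport_cost_def power2_norm_eq_inner inner_diff_left inner_diff_right inner_commute
          sum.distrib sum_subtractf sum_distrib_left algebra_simps)
  qed
  show ?thesis
    unfolding expand[OF p] expand[OF q] by (auto simp: inner_diff_left sum_subtractf)
qed

text \<open>
  One summand is independent of the sum of the others, and its law has no atoms because hyperplanes are
  Lebesgue null sets.
\<close>

lemma (in prob_space) AE_linear_combination_neq_0:
  fixes Z :: "nat \<Rightarrow> 'a \<Rightarrow> 'b::euclidean_space"
  assumes ind: "indep_vars (\<lambda>_. borel) Z UNIV"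
    and ac: "\<And>i. absolutely_continuous lborel (distr M borel (Z i))"
    and k: "k < n" "w k \<noteq> 0"
  shows "AE \<omega> in M. (\<Sum>j<n. w j \<bullet> Z j \<omega>) \<noteq> 0"
proof -
  have Z [measurable]: "random_variable borel (Z i)" for i
    using ind by (auto simp: indep_vars_def)
  let ?A = "\<lambda>\<omega>. w k \<bullet> Z k \<omega>" and ?R = "\<lambda>\<omega>. \<Sum>j\<in>{..<n} - {k}. w j \<bullet> Z j \<omega>"
  have "indep_vars (\<lambda>_. borel) (\<lambda>j \<omega>. w j \<bullet> Z j \<omega>) (insert k ({..<n} - {k}))"
    by (rule indep_vars_subset[OF indep_vars_compose2[OF ind]]) auto
  then have "indep_var borel ?A borel ?R"
    by (intro indep_vars_sum) auto
  then have joint: "distr M (borel \<Otimes>\<^sub>M borel) (\<lambda>\<omega>. (?A \<omega>, ?R \<omega>)) = distr M borel ?A \<Otimes>\<^sub>M distr M borel ?R"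
    by (simp add: indep_var_distribution_eq)
  interpret DA: prob_space "distr M borel ?A" by (rule prob_space_distr) simp
  interpret DR: prob_space "distr M borel ?R" by (rule prob_space_distr) simp
  interpret P: pair_prob_space "distr M borel ?A" "distr M borel ?R" ..
  have atom: "emeasure (distr M borel ?A) {c} = 0" for c
  proof -
    have "negligible {z. w k \<bullet> z = c}"
      using k by (intro negligible_hyperplane) auto
    moreover have "{z. w k \<bullet> z = c} \<in> sets borel" by measurable
    ultimately have "{z. w k \<bullet> z = c} \<in> null_sets lborel"
      by (simp add: negligible_iff_null_sets null_sets_completion_iff)
    then have "{z. w k \<bullet> z = c} \<in> null_sets (distr M borel (Z k))"
      using ac[of k] by (auto simp: absolutely_continuous_def)
    then have "emeasure (distr M borel (Z k)) {z. w k \<bullet> z = c} = 0" by auto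
    moreover have "?A -` {c} \<inter> space M = Z k -` {z. w k \<bullet> z = c} \<inter> space M" by auto
    ultimately show ?thesis by (simp add: emeasure_distr)
  qed
  let ?E = "{z :: real \<times> real. fst z + snd z = 0}"
  have "{z \<in> space (borel \<Otimes>\<^sub>M borel). fst z + snd z = (0::real)} \<in> sets (borel \<Otimes>\<^sub>M borel)"
    by measurable
  then have E: "?E \<in> sets (borel \<Otimes>\<^sub>M borel)"
    by (simp add: space_pair_measure)
  have "emeasure M {\<omega> \<in> space M. \<not> (\<Sum>j<n. w j \<bullet> Z j \<omega>) \<noteq> 0}
      = emeasure (distr M (borel \<Otimes>\<^sub>M borel) (\<lambda>\<omega>. (?A \<omega>, ?R \<omega>))) ?E"
  proof -
    have "(\<Sum>j<n. w j \<bullet> Z j \<omega>) = ?A \<omega> + ?R \<omega>" for \<omega>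
      using k(1) by (intro sum.remove) auto
    then show ?thesis
      using E by (subst emeasure_distr) (auto intro!: arg_cong[where f = "emeasure M"])
  qed
  also have "\<dots> = (\<integral>\<^sup>+r. emeasure (distr M borel ?A) ((\<lambda>a. (a, r)) -` ?E) \<partial>distr M borel ?R)"
    unfolding joint using E by (intro P.emeasure_pair_measure_alt2) simp
  also have "(\<lambda>r::real. (\<lambda>a. (a, r)) -` ?E) = (\<lambda>r. {- r})"
    by (auto simp: fun_eq_iff)
  finally have "emeasure M {\<omega> \<in> space M. \<not> (\<Sum>j<n. w j \<bullet> Z j \<omega>) \<noteq> 0} = 0"
    by (simp add: atom)
  then show ?thesis
    by (intro AE_I[OF subset_refl]) auto
qed

text \<open>
  With repeated grid points several permutations are optimal, but they describe the same map from the sample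
  to the grid: otherwise equality of costs would be a nontrivial linear relation.
\<close>

lemma (in prob_space) AE_unique_optimum:
  fixes Z :: "nat \<Rightarrow> 'a \<Rightarrow> 'b::euclidean_space"
  assumes ind: "indep_vars (\<lambda>_. borel) Z UNIV"
    and ac: "\<And>i. absolutely_continuous lborel (distr M borel (Z i))"
  shows "AE \<omega> in M. \<forall>p\<in>optimal_perms n g (\<lambda>i. Z i \<omega>). \<forall>q\<in>optimal_perms n g (\<lambda>i. Z i \<omega>). \<forall>j<n. g (p j) = g (q j)"
proof -
  let ?P = "{p. p permutes {..<n}}"
  have "AE \<omega> in M. \<forall>p\<in>?P. \<forall>q\<in>?P. (\<exists>k<n. g (p k) \<noteq> g (q k)) \<longrightarrow> (\<Sum>j<n. (g (p j) - g (q j)) \<bullet> Z j \<omega>) \<noteq> 0"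
  proof (intro AE_finite_allI finite_perms)
    fix p q
    show "AE \<omega> in M. (\<exists>k<n. g (p k) \<noteq> g (q k)) \<longrightarrow> (\<Sum>j<n. (g (p j) - g (q j)) \<bullet> Z j \<omega>) \<noteq> 0"
    proof (cases "\<exists>k<n. g (p k) \<noteq> g (q k)")
      case True
      then obtain k where "k < n" "g (p k) - g (q k) \<noteq> 0" by auto
      from AE_linear_combination_neq_0[OF ind ac, of k n "\<lambda>j. g (p j) - g (q j)", OF this]
      show ?thesis by simp
    qed simp
  qed
  then show ?thesis
  proof eventually_elim
    case (elim \<omega>)
    show ?case
    proof (intro ballI allI impI)
      fix p q j assume p: "p \<in> optimal_perms n g (\<lambda>i. Z i \<omega>)" and q: "q \<in> optimal_perms n g (\<lambda>i. Z i \<omega>)" and "j < n"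
      then have pq: "p permutes {..<n}" "q permutes {..<n}"
        and "transport_cost n g (\<lambda>i. Z i \<omega>) p = transport_cost n g (\<lambda>i. Z i \<omega>) q"
        by (auto simp: optimal_perms_def intro!: antisym)
      then have "(\<Sum>j<n. (g (p j) - g (q j)) \<bullet> Z j \<omega>) = 0"
        using transport_cost_eq_iff[OF pq, of g "\<lambda>i. Z i \<omega>"] by blast
      with elim pq \<open>j < n\<close> show "g (p j) = g (q j)" by blast
    qed
  qed
qed

lemma (in prob_space) distr_permuted_sample:
  assumes ind: "indep_vars (\<lambda>_. borel) Z UNIV"
    and ident: "\<And>i. distr M borel (Z i) = \<mu>"
    and \<pi>: "\<pi> permutes {..<n::nat}"
  shows "distr M (\<Pi>\<^sub>M i\<in>{..<n}. borel) (\<lambda>\<omega>. \<lambda>i\<in>{..<n}. Z (\<pi> i) \<omega>) =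
    distr M (\<Pi>\<^sub>M i\<in>{..<n}. borel) (\<lambda>\<omega>. \<lambda>i\<in>{..<n}. Z i \<omega>)"
proof (cases "n = 0")
  case True
  then show ?thesis by (simp add: restrict_def)
next
  case False
  have Z [measurable]: "random_variable borel (Z i)" for i
    using ind by (auto simp: indep_vars_def)
  let ?PB = "\<Pi>\<^sub>M i\<in>{..<n}. borel"
  have \<mu>: "sets \<mu> = sets borel" "prob_space \<mu>"
    using ident[of 0] prob_space_distr[OF Z] by auto
  have bij: "inj_on \<pi> {..<n}" "\<pi> \<in> {..<n} \<rightarrow> {..<n}"
    using permutes_inj_on[OF \<pi>] permutes_in_image[OF \<pi>] by auto
  have eq: "distr M ?PB (\<lambda>\<omega>. \<lambda>i\<in>{..<n}. Z i \<omega>) = (\<Pi>\<^sub>M i\<in>{..<n}. \<mu>)"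
    using indep_vars_iff_distr_eq_PiM[where I = "{..<n}" and M' = "\<lambda>_. borel" and X = Z] indep_vars_subset[OF ind, of "{..<n}"] False
    by (simp add: ident lessThan_empty_iff)
  have "distr M ?PB (\<lambda>\<omega>. \<lambda>i\<in>{..<n}. Z (\<pi> i) \<omega>) =
      distr (distr M ?PB (\<lambda>\<omega>. \<lambda>i\<in>{..<n}. Z i \<omega>)) ?PB (\<lambda>x. \<lambda>i\<in>{..<n}. x (\<pi> i))"
  proof (subst distr_distr)
    show "(\<lambda>x. \<lambda>i\<in>{..<n}. x (\<pi> i)) \<in> ?PB \<rightarrow>\<^sub>M ?PB"
      using bij(2) by (intro measurable_restrict measurable_component_singleton) auto
    show "distr M ?PB (\<lambda>\<omega>. \<lambda>i\<in>{..<n}. Z (\<pi> i) \<omega>) =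
        distr M ?PB ((\<lambda>x. \<lambda>i\<in>{..<n}. x (\<pi> i)) \<circ> (\<lambda>\<omega>. \<lambda>i\<in>{..<n}. Z i \<omega>))"
      using bij(2) by (intro distr_cong) (auto simp: o_def restrict_def fun_eq_iff)
  qed measurable
  also have "\<dots> = distr (\<Pi>\<^sub>M i\<in>{..<n}. \<mu>) (\<Pi>\<^sub>M i\<in>{..<n}. \<mu>) (\<lambda>x. \<lambda>i\<in>{..<n}. x (\<pi> i))"
    unfolding eq by (intro distr_cong refl sets_PiM_cong) (simp add: \<mu>)
  also have "\<dots> = (\<Pi>\<^sub>M i\<in>{..<n}. \<mu>)"
    by (rule distr_PiM_reindex) (use bij \<mu> in auto)
  finally show ?thesis by (simp add: eq)
qed

text \<open>
  Permuting the sample by \<open>\<pi>\<close> preserves its law and turns the optimal assignment \<open>p\<close> into \<open>p \<circ> \<pi>\<close>, up to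
  permutations with the same grid points. Averaging over \<open>\<pi>\<close> makes the integrand equal to the mean over all
  permutations, whatever the sample. The assumption on \<open>\<Phi>\<close> says that it depends only on the map to the grid.
\<close>

theorem (in prob_space) expectation_opt_perm:
  fixes Z :: "nat \<Rightarrow> 'a \<Rightarrow> 'b::euclidean_space" and \<Phi> :: "(nat \<Rightarrow> nat) \<Rightarrow> real"
  assumes ind: "indep_vars (\<lambda>_. borel) Z UNIV"
    and ident: "\<And>i. distr M borel (Z i) = \<mu>"
    and ac: "absolutely_continuous lborel \<mu>"
    and \<Phi>: "\<And>p q. p permutes {..<n} \<Longrightarrow> q permutes {..<n} \<Longrightarrow> (\<And>i. i < n \<Longrightarrow> g (p i) = g (q i)) \<Longrightarrow> \<Phi> p = \<Phi> q"
  shows "expectation (\<lambda>\<omega>. \<Phi> (opt_perm n g (\<lambda>i. Z i \<omega>))) = perm_mean n \<Phi>"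
proof -
  have Z [measurable]: "random_variable borel (Z i)" for i
    using ind by (auto simp: indep_vars_def)
  let ?P = "{p. p permutes {..<n}}"
  have acZ: "absolutely_continuous lborel (distr M borel (Z i))" for i
    by (simp add: ident ac)
  let ?s = "\<lambda>\<omega>. opt_perm n g (\<lambda>i. Z i \<omega>)"
  have meas_s [measurable]: "?s \<in> M \<rightarrow>\<^sub>M count_space UNIV"
    by (rule measurable_opt_perm) simp
  have meas: "(\<lambda>\<omega>. \<Psi> (?s \<omega>)) \<in> borel_measurable M" for \<Psi> :: "(nat \<Rightarrow> nat) \<Rightarrow> real"
    by (rule measurable_compose[OF meas_s]) simp
  have integrable: "integrable M (\<lambda>\<omega>. \<Psi> (?s \<omega>))" for \<Psi> :: "(nat \<Rightarrow> nat) \<Rightarrow> real"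
  proof (rule integrable_const_bound[where B = "\<Sum>p\<in>?P. \<bar>\<Psi> p\<bar>"])
    have "\<bar>\<Psi> (?s \<omega>)\<bar> \<le> (\<Sum>p\<in>?P. \<bar>\<Psi> p\<bar>)" for \<omega>
      using opt_perm_permutes by (intro member_le_sum finite_perms) auto
    then show "AE \<omega> in M. norm (\<Psi> (?s \<omega>)) \<le> (\<Sum>p\<in>?P. \<bar>\<Psi> p\<bar>)" by simp
  qed (rule meas)
  have invariant: "expectation (\<lambda>\<omega>. \<Phi> (?s \<omega>))
      = expectation (\<lambda>\<omega>. \<Phi> (?s \<omega> \<circ> \<pi>))" if \<pi>: "\<pi> permutes {..<n}" for \<pi>
  proof -
    let ?PB = "\<Pi>\<^sub>M i\<in>{..<n}. (borel :: 'b measure)"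
    have H: "(\<lambda>x. \<Phi> (opt_perm n g x)) \<in> borel_measurable ?PB"
      by (rule measurable_compose[OF measurable_opt_perm]) auto
    have "expectation (\<lambda>\<omega>. \<Phi> (?s \<omega>)) = expectation (\<lambda>\<omega>. \<Phi> (opt_perm n g (\<lambda>i\<in>{..<n}. Z i \<omega>)))"
      by (simp cong: opt_perm_cong)
    also have "\<dots> = (\<integral>x. \<Phi> (opt_perm n g x) \<partial>distr M ?PB (\<lambda>\<omega>. \<lambda>i\<in>{..<n}. Z i \<omega>))"
      using H by (subst integral_distr) auto
    also have "\<dots> = (\<integral>x. \<Phi> (opt_perm n g x) \<partial>distr M ?PB (\<lambda>\<omega>. \<lambda>i\<in>{..<n}. Z (\<pi> i) \<omega>))"
      by (simp only: distr_permuted_sample[OF ind ident \<pi>])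
    also have "\<dots> = expectation (\<lambda>\<omega>. \<Phi> (opt_perm n g (\<lambda>i\<in>{..<n}. Z (\<pi> i) \<omega>)))"
      using H by (subst integral_distr) auto
    also have "\<dots> = expectation (\<lambda>\<omega>. \<Phi> (opt_perm n g (\<lambda>i. Z (\<pi> i) \<omega>)))"
      by (simp cong: opt_perm_cong)
    also have "\<dots> = expectation (\<lambda>\<omega>. \<Phi> (?s \<omega> \<circ> \<pi>))"
    proof (rule integral_cong_AE)
      show "AE \<omega> in M. \<Phi> (opt_perm n g (\<lambda>i. Z (\<pi> i) \<omega>)) = \<Phi> (?s \<omega> \<circ> \<pi>)"
        using AE_unique_optimum[OF ind acZ, of n g]
      proof eventually_elim
        case (elim \<omega>)
        let ?r = "opt_perm n g (\<lambda>i. Z (\<pi> i) \<omega>)"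
        have r: "?r permutes {..<n}" by (rule opt_perm_permutes)
        have "?r \<circ> inv \<pi> \<in> optimal_perms n g (\<lambda>i. Z i \<omega>)"
          unfolding optimal_perms_def
        proof (intro CollectI conjI ballI)
          show "?r \<circ> inv \<pi> permutes {..<n}"
            by (rule permutes_compose[OF permutes_inv[OF \<pi>] r])
          fix q assume "q \<in> ?P"
          then have q: "q \<circ> \<pi> permutes {..<n}" by (intro permutes_compose \<pi>) simp
          have "transport_cost n g (\<lambda>i. Z (\<pi> i) \<omega>) ?r \<le> transport_cost n g (\<lambda>i. Z (\<pi> i) \<omega>) (q \<circ> \<pi>)"
            using opt_perm_optimal[of n g "\<lambda>i. Z (\<pi> i) \<omega>"] q by (auto simp: optimal_perms_def)
          then show "transport_cost n g (\<lambda>i. Z i \<omega>) (?r \<circ> inv \<pi>) \<le> transport_cost n g (\<lambda>i. Z i \<omega>) q"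
            using permutes_inv_o(1)[OF \<pi>]
            by (simp add: transport_cost_permute[OF \<pi>, of g "\<lambda>i. Z i \<omega>"] comp_assoc)
        qed
        then have eq: "g ((?r \<circ> inv \<pi>) j) = g (?s \<omega> j)" if "j < n" for j
          using elim opt_perm_optimal that by blast
        show ?case
        proof (rule \<Phi>[OF r permutes_compose[OF \<pi> opt_perm_permutes]])
          fix i assume "i < n"
          then have "\<pi> i < n" using permutes_in_image[OF \<pi>, of i] by simp
          from eq[OF this] show "g (?r i) = g ((?s \<omega> \<circ> \<pi>) i)"
            using permutes_inverses(2)[OF \<pi>] by simp
        qed
      qed
      show "(\<lambda>\<omega>. \<Phi> (opt_perm n g (\<lambda>i. Z (\<pi> i) \<omega>))) \<in> borel_measurable M"
        by (rule measurable_compose[OF measurable_opt_perm]) auto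
      show "(\<lambda>\<omega>. \<Phi> (?s \<omega> \<circ> \<pi>)) \<in> borel_measurable M" by (rule meas)
    qed
    finally show ?thesis .
  qed
  have int: "integrable M (\<lambda>\<omega>. \<Phi> (?s \<omega> \<circ> \<pi>))" for \<pi>
    by (rule integrable)
  have "expectation (\<lambda>\<omega>. \<Phi> (?s \<omega>)) = perm_mean n (\<lambda>\<pi>. expectation (\<lambda>\<omega>. \<Phi> (?s \<omega> \<circ> \<pi>)))"
    using perm_mean_cong[of n "\<lambda>\<pi>. expectation (\<lambda>\<omega>. \<Phi> (?s \<omega> \<circ> \<pi>))" "\<lambda>_. expectation (\<lambda>\<omega>. \<Phi> (?s \<omega>))"]
    by (simp add: invariant[symmetric] perm_mean_const)
  also have "\<dots> = expectation (\<lambda>\<omega>. perm_mean n (\<lambda>\<pi>. \<Phi> (?s \<omega> \<circ> \<pi>)))"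
    unfolding perm_mean_def by (simp add: Bochner_Integration.integral_sum int)
  also have "\<dots> = expectation (\<lambda>\<omega>. perm_mean n \<Phi>)"
    by (simp add: perm_mean_compose_left[OF opt_perm_permutes])
  finally show ?thesis by (simp add: prob_space)
qed



section \<open>Moments of the score statistic\<close>

lemma perm_mean_Re: "Re (perm_mean n f) = perm_mean n (\<lambda>p. Re (f p))"
  and perm_mean_Im: "Im (perm_mean n f) = perm_mean n (\<lambda>p. Im (f p))"
  by (simp_all add: perm_mean_def)

lemma inner_score_statistic:
  "\<theta> \<bullet> score_statistic a n I p =
     srs_scale n I * (\<Sum>i\<in>I. \<theta> \<bullet> a (p i) - (\<Sum>j<n. \<theta> \<bullet> a j) / real n)"
  by (simp add: score_statistic_def inner_sum_right inner_diff_right)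

lemma centred_bound:
  fixes a :: "nat \<Rightarrow> real"
  assumes a: "\<And>j. j < n \<Longrightarrow> \<bar>a j\<bar> \<le> C" and j: "j < n"
  shows "\<bar>a j - (\<Sum>i<n. a i) / real n\<bar> \<le> 2 * C"
proof -
  have "\<bar>\<Sum>i<n. a i\<bar> \<le> real n * C"
    using order_trans[OF sum_abs sum_mono[of "{..<n}" "\<lambda>i. \<bar>a i\<bar>" "\<lambda>_. C"]] a by simp
  then have "\<bar>(\<Sum>i<n. a i) / real n\<bar> \<le> C"
    using j by (simp add: abs_divide divide_le_eq mult.commute)
  then show ?thesis using a[OF j] by linarith
qed

lemma centred_sum: "(\<Sum>j<n. a j - (\<Sum>i<n. a i) / real n) = (0::real)"
  by (cases "n = 0") (simp_all add: sum_subtractf)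

lemma centred_sum_squares:
  fixes a :: "nat \<Rightarrow> real"
  shows "(\<Sum>j<n. (a j - (\<Sum>i<n. a i) / real n)\<^sup>2) / real n = (\<Sum>j<n. (a j)\<^sup>2) / real n
      - ((\<Sum>j<n. a j) / real n)\<^sup>2"
proof (cases "n = 0")
  case False
  define m where "m = (\<Sum>i<n. a i) / real n"
  have m: "(\<Sum>i<n. a i) = real n * m" using False by (simp add: m_def)
  have "(\<Sum>j<n. (a j - m)\<^sup>2) = (\<Sum>j<n. (a j)\<^sup>2) - 2 * m * (\<Sum>j<n. a j) + real n * m\<^sup>2"
    by (simp add: power2_diff sum.distrib sum_subtractf sum_distrib_left algebra_simps)
  also have "\<dots> = (\<Sum>j<n. (a j)\<^sup>2) - real n * m\<^sup>2"
    unfolding m by (simp add: power2_eq_square)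
  finally show ?thesis
    using False by (simp add: m_def[symmetric] diff_divide_distrib)
qed simp

text \<open>
  This bound is the source of tightness. Each coordinate is a standardised sum of a real population, or zero
  if the sample is empty or exhausts the population.
\<close>

lemma score_statistic_second_moment:
  fixes a :: "nat \<Rightarrow> 'a::euclidean_space"
  assumes I: "I \<subseteq> {..<n}" and a: "\<And>j. j < n \<Longrightarrow> norm (a j) \<le> C"
  shows "perm_mean n (\<lambda>p. (norm (score_statistic a n I p))\<^sup>2) \<le> real DIM('a) * (8 * C\<^sup>2)"
proof -
  have coordinate: "perm_mean n (\<lambda>p. (e \<bullet> score_statistic a n I p)\<^sup>2) \<le> 8 * C\<^sup>2" if e: "e \<in> Basis" for e
  proof (cases "I = {} \<or> I = {..<n}")
    case True
    then have "score_statistic a n I p = 0" for p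
      by (auto simp: score_statistic_def srs_scale_def)
    then show ?thesis by (simp add: perm_mean_const)
  next
    case False
    have ea: "\<bar>e \<bullet> a j\<bar> \<le> C" if "j < n" for j
      using order_trans[OF Basis_le_norm[OF e] a[OF that]] by (simp add: inner_commute)
    interpret sampling n I "\<lambda>j. e \<bullet> a j - (\<Sum>j<n. e \<bullet> a j) / real n" "2 * C"
    proof
      show "\<bar>e \<bullet> a j - (\<Sum>j<n. e \<bullet> a j) / real n\<bar> \<le> 2 * C" if "j < n" for j
        by (rule centred_bound[OF ea that])
    qed (rule I, rule centred_sum)
    have "perm_mean n (\<lambda>p. (c * S p)\<^sup>2) \<le> 2 * (2 * C)\<^sup>2"
      using False by (intro variance_bound) auto
    then show ?thesis
      unfolding inner_score_statistic S_def by (simp add: power_mult_distrib)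
  qed
  have "(norm (score_statistic a n I p))\<^sup>2 = (\<Sum>e\<in>Basis. (e \<bullet> score_statistic a n I p)\<^sup>2)" for p
    unfolding power2_norm_eq_inner
    by (subst euclidean_inner) (simp add: power2_eq_square inner_commute)
  then have "perm_mean n (\<lambda>p. (norm (score_statistic a n I p))\<^sup>2) =
      (\<Sum>e\<in>Basis. perm_mean n (\<lambda>p. (e \<bullet> score_statistic a n I p)\<^sup>2))"
    by (simp add: perm_mean_sum)
  also have "\<dots> \<le> (\<Sum>e\<in>(Basis :: 'a set). 8 * C\<^sup>2)"
    by (intro sum_mono coordinate)
  finally show ?thesis by simp
qed

lemma score_statistic_characteristic_function:
  fixes a :: "nat \<Rightarrow> nat \<Rightarrow> 'a::euclidean_space"
  assumes sub: "\<And>n. I n \<subseteq> {..<n}"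
    and I: "filterlim (\<lambda>n. card (I n)) at_top sequentially"
    and K: "filterlim (\<lambda>n. card ({..<n} - I n)) at_top sequentially"
    and a: "\<And>n j. j < n \<Longrightarrow> norm (a n j) \<le> C"
    and m1: "(\<lambda>n. (\<Sum>j<n. \<theta> \<bullet> a n j) / real n) \<longlonglongrightarrow> 0"
    and m2: "(\<lambda>n. (\<Sum>j<n. (\<theta> \<bullet> a n j)\<^sup>2) / real n) \<longlonglongrightarrow> \<sigma>2"
  shows "(\<lambda>n. perm_mean n (\<lambda>p. iexp (\<theta> \<bullet> score_statistic (a n) n (I n) p)))
      \<longlonglongrightarrow> complex_of_real (exp (- \<sigma>2 / 2))"
proof -
  have \<theta>a: "\<bar>\<theta> \<bullet> a n j\<bar> \<le> norm \<theta> * C" if "j < n" for n j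
    using Cauchy_Schwarz_ineq2[of \<theta> "a n j"] mult_left_mono[OF a[OF that], of "norm \<theta>"] by simp
  have "(\<lambda>n. (\<Sum>j<n. (\<theta> \<bullet> a n j)\<^sup>2) / real n - ((\<Sum>j<n. \<theta> \<bullet> a n j) / real n)\<^sup>2) \<longlonglongrightarrow> \<sigma>2 - 0\<^sup>2"
    by (intro tendsto_intros m1 m2)
  then have "(\<lambda>n. (\<Sum>j<n. (\<theta> \<bullet> a n j - (\<Sum>j<n. \<theta> \<bullet> a n j) / real n)\<^sup>2) / real n) \<longlonglongrightarrow> \<sigma>2"
    by (simp add: centred_sum_squares)
  from simple_random_sampling_clt[where b = "\<lambda>n j. \<theta> \<bullet> a n j - (\<Sum>j<n. \<theta> \<bullet> a n j) / real n",
      OF sub centred_sum centred_bound[OF \<theta>a] I K this]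
  show ?thesis by (simp only: inner_score_statistic)
qed

section \<open>Scores of the grid\<close>

text \<open>
  The bound includes the endpoint \<open>1\<close>, where \<open>J\<close> has an arbitrary value: a grid may have points on the unit
  sphere, and only their scores have to be bounded.
\<close>

lemma bounded_variation_bounded:
  assumes "bounded_variation_on {0..<1} J"
  obtains C where "\<And>u. u \<in> {0..1} \<Longrightarrow> \<bar>J u\<bar> \<le> C"
proof -
  obtain B where B: "\<And>(n::nat) t. (\<forall>i\<le>n. t i \<in> {0..<1}) \<Longrightarrow> (\<forall>i<n. t i \<le> t (Suc i)) \<Longrightarrow>
      (\<Sum>i<n. \<bar>J (t (Suc i)) - J (t i)\<bar>) \<le> B"
    using assms unfolding bounded_variation_on_def by blast
  have "\<bar>J u - J 0\<bar> \<le> B" if "u \<in> {0..<1}" for u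
    using B[of 1 "\<lambda>i. if i = 0 then 0 else u"] that by auto
  then have *: "\<bar>J u\<bar> \<le> \<bar>J 0\<bar> + B" if "u \<in> {0..<1}" for u
    using that by (smt (verit))
  show thesis
  proof
    fix u :: real assume "u \<in> {0..1}"
    then show "\<bar>J u\<bar> \<le> max (\<bar>J 0\<bar> + B) \<bar>J 1\<bar>"
      using *[of u] by (cases "u = 1") auto
  qed
qed

lemma norm_vector_score_le:
  assumes "\<And>u. u \<in> {0..1} \<Longrightarrow> \<bar>J u\<bar> \<le> C" and "z \<in> cball 0 1"
  shows "norm (vector_score J z) \<le> C"
proof -
  have "\<bar>J (norm z)\<bar> \<le> C" "0 \<le> C"
    using assms(1)[of "norm z"] assms(1)[of 0] assms(2) by auto
  then show ?thesis by (auto simp: vector_score_def norm_sgn)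
qed

lemma continuous_on_vector_score:
  assumes "continuous_on {0<..<1} J"
  shows "continuous_on (ball 0 1 - {0}) (vector_score J :: 'a::euclidean_space \<Rightarrow> 'a)"
  unfolding vector_score_def
proof (intro continuous_intros)
  show "continuous_on (ball 0 1 - {0}) (\<lambda>u::'a. J (norm u))"
    by (rule continuous_on_compose2[OF assms]) (auto intro!: continuous_intros)
qed auto

lemma grid_score_moments:
  fixes g :: "nat \<Rightarrow> nat \<Rightarrow> 'a::euclidean_space"
  assumes g: "grid_sequence g" and J_cont: "continuous_on {0<..<1} J"
    and C: "\<And>u. u \<in> {0..1} \<Longrightarrow> \<bar>J u\<bar> \<le> C"
  shows "(\<lambda>n. (\<Sum>j<n. \<theta> \<bullet> vector_score J (g n j)) / real n) \<longlonglongrightarrow> 0"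
    and "(\<lambda>n. (\<Sum>j<n. (\<theta> \<bullet> vector_score J (g n j))\<^sup>2) / real n)
      \<longlonglongrightarrow> (LBINT u:{0<..<1}. (J u)\<^sup>2) * ((norm \<theta>)\<^sup>2 / DIM('a))"
proof -
  have score_bd: "\<bar>\<theta> \<bullet> vector_score J u\<bar> \<le> norm \<theta> * C" if "u \<in> cball 0 1" for u :: 'a
    using Cauchy_Schwarz_ineq2[of \<theta> "vector_score J u"]
      mult_left_mono[OF norm_vector_score_le[where J = J and C = C, OF C that] norm_ge_zero[of \<theta>]] by simp
  have inner_sphere: "\<bar>\<theta> \<bullet> z\<bar> \<le> norm \<theta>" if "norm z = 1" for z
    using Cauchy_Schwarz_ineq2[of \<theta> z] that by simp
  have meas: "set_borel_measurable borel {0<..<1} J" "set_borel_measurable borel {0<..<1} (\<lambda>u. (J u)\<^sup>2)"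
    unfolding set_borel_measurable_def
    by (intro borel_measurable_continuous_on_indicator continuous_intros J_cont; simp)+
  have score: "\<theta> \<bullet> vector_score J u = J (norm u) * (\<theta> \<bullet> sgn u)" for u :: 'a
    by (simp add: vector_score_def)
  have "(\<lambda>n. (\<Sum>j<n. \<theta> \<bullet> vector_score J (g n j)) / real n)
      \<longlonglongrightarrow> (LINT u:ball 0 1 - {0}|spherical_uniform. \<theta> \<bullet> vector_score J u)"
    by (rule grid_average_tendsto[OF g _ score_bd])
      (intro continuous_intros continuous_on_vector_score J_cont)
  also have "(LINT u:ball 0 1 - {0}|spherical_uniform. \<theta> \<bullet> vector_score J u) = 0"
    unfolding score
    by (subst spherical_uniform_polar[where C = C and D = "norm \<theta>"])
      (auto simp: meas inner_sphere uniform_sphere_moments intro: C)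
  finally show "(\<lambda>n. (\<Sum>j<n. \<theta> \<bullet> vector_score J (g n j)) / real n) \<longlonglongrightarrow> 0" .
  have "(\<lambda>n. (\<Sum>j<n. (\<theta> \<bullet> vector_score J (g n j))\<^sup>2) / real n)
      \<longlonglongrightarrow> (LINT u:ball 0 1 - {0}|spherical_uniform. (\<theta> \<bullet> vector_score J u)\<^sup>2)"
  proof (rule grid_average_tendsto[OF g])
    show "continuous_on (ball 0 1 - {0}) (\<lambda>u. (\<theta> \<bullet> vector_score J u)\<^sup>2)"
      by (intro continuous_intros continuous_on_vector_score J_cont)
    show "\<bar>(\<theta> \<bullet> vector_score J u)\<^sup>2\<bar> \<le> (norm \<theta> * C)\<^sup>2" if "u \<in> cball 0 1" for u
      using power_mono[OF score_bd[OF that] abs_ge_zero, of 2] by simp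
  qed
  also have "(LINT u:ball 0 1 - {0}|spherical_uniform. (\<theta> \<bullet> vector_score J u)\<^sup>2) =
      (LBINT u:{0<..<1}. (J u)\<^sup>2) * (\<integral>z. (\<theta> \<bullet> z)\<^sup>2 \<partial>uniform_sphere)"
    unfolding score power_mult_distrib
  proof (rule spherical_uniform_polar)
    show "\<bar>(J r)\<^sup>2\<bar> \<le> C\<^sup>2" if "r \<in> {0<..<1}" for r
    proof -
      have "\<bar>J r\<bar> \<le> C" using C that by simp
      from power_mono[OF this abs_ge_zero, of 2] show ?thesis by simp
    qed
    show "\<bar>(\<theta> \<bullet> z)\<^sup>2\<bar> \<le> (norm \<theta>)\<^sup>2" if "norm z = 1" for z
      using power_mono[OF inner_sphere[OF that] abs_ge_zero, of 2] by simp
  qed (use meas in auto)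
  finally show "(\<lambda>n. (\<Sum>j<n. (\<theta> \<bullet> vector_score J (g n j))\<^sup>2) / real n)
      \<longlonglongrightarrow> (LBINT u:{0<..<1}. (J u)\<^sup>2) * ((norm \<theta>)\<^sup>2 / DIM('a))"
    by (simp only: uniform_sphere_moments)
qed

section \<open>The limiting normal distribution\<close>

lemma measurable_vec_lambda_PiM [measurable]:
  "(\<lambda>z. \<chi> i. z i) \<in> (\<Pi>\<^sub>M i\<in>(UNIV :: 'd::finite set). std_normal_distribution) \<rightarrow>\<^sub>M (borel :: (real ^ 'd) measure)"
proof (subst borel_measurable_euclidean_space, rule ballI)
  fix b :: "real ^ 'd" assume "b \<in> Basis"
  then obtain i where "b = axis i 1" by (auto simp: Basis_vec_def)
  then have "(\<lambda>z :: 'd \<Rightarrow> real. (\<chi> i. z i) \<bullet> b) = (\<lambda>z. z i)"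
    by (simp add: inner_axis)
  moreover have "(\<lambda>z. z i) \<in> (\<Pi>\<^sub>M i\<in>(UNIV :: 'd set). std_normal_distribution) \<rightarrow>\<^sub>M std_normal_distribution"
    by (rule measurable_component_singleton) simp
  ultimately show "(\<lambda>z. (\<chi> i. z i) \<bullet> b) \<in> borel_measurable (\<Pi>\<^sub>M i\<in>(UNIV :: 'd set). std_normal_distribution)"
    by simp
qed

lemma prob_space_std_normal_vec: "prob_space (std_normal_vec :: (real ^ 'd::finite) measure)"
proof -
  interpret prob_space std_normal_distribution
    using real_dist_normal_dist by (simp add: real_distribution_def)
  show ?thesis
    unfolding std_normal_vec_def
    by (intro prob_space.prob_space_distr prob_space_PiM measurable_vec_lambda_PiM prob_space_axioms)
qed

lemma sets_std_normal_vec [measurable_cong]: "sets std_normal_vec = sets borel"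
  by (simp add: std_normal_vec_def)

text \<open>
  The exponential of the inner product is a product over the independent coordinates.
\<close>

lemma characteristic_function_std_normal_vec:
  fixes \<theta> :: "real ^ 'd::finite"
  shows "(\<integral>z. iexp (\<theta> \<bullet> z) \<partial>std_normal_vec) = complex_of_real (exp (- (norm \<theta>)\<^sup>2 / 2))"
proof -
  let ?D = "std_normal_distribution"
  interpret D: prob_space ?D
    using real_dist_normal_dist by (simp add: real_distribution_def)
  interpret product_sigma_finite "\<lambda>_::'d. ?D" ..
  have "(\<integral>z. iexp (\<theta> \<bullet> z) \<partial>std_normal_vec) = (\<integral>z. iexp (\<theta> \<bullet> (\<chi> i. z i)) \<partial>(\<Pi>\<^sub>M i\<in>UNIV. ?D))"
    unfolding std_normal_vec_def by (rule integral_distr) measurable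
  also have "(\<lambda>z. iexp (\<theta> \<bullet> (\<chi> i. z i))) = (\<lambda>z. \<Prod>i\<in>UNIV. iexp ((\<theta> $ i) * z i))"
    by (simp add: inner_vec_def sum_distrib_left flip: exp_sum)
  also have "(\<integral>z. (\<Prod>i\<in>UNIV. iexp ((\<theta> $ i) * z i)) \<partial>(\<Pi>\<^sub>M i\<in>UNIV. ?D)) = (\<Prod>i\<in>UNIV. char ?D (\<theta> $ i))"
    unfolding char_def
  proof (rule product_integral_prod)
    show "integrable ?D (\<lambda>x. iexp ((\<theta> $ i) * x))" for i
      by (rule D.integrable_const_bound[where B = 1]) auto
  qed simp
  also have "\<dots> = complex_of_real (\<Prod>i\<in>UNIV. exp (- ((\<theta> $ i)\<^sup>2) / 2))"
    by (simp add: char_std_normal_distribution)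
  also have "(\<Prod>i\<in>UNIV. exp (- ((\<theta> $ i)\<^sup>2) / 2)) = exp (- (norm \<theta>)\<^sup>2 / 2)"
    unfolding power2_norm_eq_inner inner_vec_def
    by (simp add: exp_sum[symmetric] sum_divide_distrib sum_negf power2_eq_square)
  finally show ?thesis .
qed

lemma isotropic_normal:
  fixes v :: real
  assumes v: "0 \<le> v"
  obtains N :: "(real ^ 'd::finite) measure" where
    "multivariate_normal 0 (v *\<^sub>R mat 1) N" "prob_space N" "sets N = sets borel"
    "\<And>\<theta>. (\<integral>x. cos (\<theta> \<bullet> x) \<partial>N) = exp (- (v * (norm \<theta>)\<^sup>2) / 2)"
    "\<And>\<theta>. (\<integral>x. sin (\<theta> \<bullet> x) \<partial>N) = 0"
proof -
  interpret Z: prob_space "std_normal_vec :: (real ^ 'd) measure" by (rule prob_space_std_normal_vec)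
  define A :: "real ^ 'd ^ 'd" where "A = sqrt v *\<^sub>R mat 1"
  define N :: "(real ^ 'd) measure" where "N = distr std_normal_vec borel (\<lambda>z. 0 + A *v z)"
  have A: "A *v z = sqrt v *\<^sub>R z" for z
    by (simp add: A_def scaleR_matrix_vector_assoc[symmetric])
  have AA: "v *\<^sub>R mat 1 = A ** transpose A"
    using v by (simp add: A_def transpose_scalar matrix_scalar_ac scalar_matrix_assoc[symmetric] transpose_mat)
  have cf: "(\<integral>x. iexp (\<theta> \<bullet> x) \<partial>N) = complex_of_real (exp (- (v * (norm \<theta>)\<^sup>2) / 2))" for \<theta>
  proof -
    have "(\<integral>x. iexp (\<theta> \<bullet> x) \<partial>N) = (\<integral>z. iexp (\<theta> \<bullet> (0 + A *v z)) \<partial>std_normal_vec)"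
      unfolding N_def by (rule integral_distr) (simp_all add: A)
    also have "\<dots> = (\<integral>z. iexp ((sqrt v *\<^sub>R \<theta>) \<bullet> z) \<partial>std_normal_vec)"
      by (simp add: A)
    also have "\<dots> = complex_of_real (exp (- (v * (norm \<theta>)\<^sup>2) / 2))"
      unfolding characteristic_function_std_normal_vec using v by (simp add: power_mult_distrib)
    finally show ?thesis .
  qed
  have N: "prob_space N" "sets N = sets borel"
    unfolding N_def by (auto intro!: Z.prob_space_distr simp: A)
  interpret N: prob_space N by fact
  note [measurable_cong] = N(2)
  have int: "integrable N (\<lambda>x. iexp (\<theta> \<bullet> x))" for \<theta>
    by (rule N.integrable_const_bound[where B = 1]) auto
  show thesis
  proof
    show "multivariate_normal 0 (v *\<^sub>R mat 1) N"
      unfolding multivariate_normal_def using AA N_def by blast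
    show "(\<integral>x. cos (\<theta> \<bullet> x) \<partial>N) = exp (- (v * (norm \<theta>)\<^sup>2) / 2)" for \<theta>
      using integral_Re[OF int[of \<theta>]] cf[of \<theta>] by (simp add: Re_exp)
    show "(\<integral>x. sin (\<theta> \<bullet> x) \<partial>N) = 0" for \<theta>
      using integral_Im[OF int[of \<theta>]] cf[of \<theta>] by (simp add: Im_exp)
  qed (fact N)+
qed

section \<open>The conditional law of the statistic\<close>

lemma distr_sign_flip:
  fixes X :: "'w \<Rightarrow> 'a::euclidean_space"
  assumes X [measurable]: "X \<in> borel_measurable M" and M: "prob_space M" and sym: "centrally_symmetric M X"
  shows "distr M borel (\<lambda>\<omega>. - X \<omega>) = distr M borel X"
proof (rule measure_eqI)
  interpret prob_space M by fact
  fix A assume "A \<in> sets (distr M borel (\<lambda>\<omega>. - X \<omega>))"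
  then have [measurable]: "A \<in> sets borel" by simp
  have "measure M {\<omega> \<in> space M. X \<omega> \<in> A} = measure M {\<omega> \<in> space M. - X \<omega> \<in> A}"
    using sym by (simp add: centrally_symmetric_def)
  then show "emeasure (distr M borel (\<lambda>\<omega>. - X \<omega>)) A = emeasure (distr M borel X) A"
    by (simp add: emeasure_distr emeasure_eq_measure vimage_def Int_def conj_commute)
qed simp

text \<open>
  By central symmetry the signed sample \<open>y i *\<^sub>R X i\<close> is again independent with the law of \<open>X 0\<close>, so the
  optimal permutation can be averaged out.
\<close>

lemma (in prob_space) conditional_law_rank_statistic:
  fixes X :: "nat \<Rightarrow> 'a \<Rightarrow> 'b::euclidean_space" and h :: "'b \<Rightarrow> real"
  assumes ind: "indep_vars (\<lambda>_. borel) X UNIV"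
    and ident: "\<And>i. distr M borel (X i) = distr M borel (X 0)"
    and ac: "absolutely_continuous lborel (distr M borel (X 0))"
    and sym: "centrally_symmetric M (X 0)"
    and y: "\<And>i. y i = 1 \<or> y i = - 1"
    and h: "h \<in> borel_measurable borel"
  shows "(\<integral>t. h t \<partial>distr M borel (\<lambda>\<omega>. rank_statistic J nR n g y (\<lambda>i. X i \<omega>))) =
    perm_mean n (\<lambda>p. h (score_statistic (\<lambda>j. vector_score J (g j)) n (positive_indices n y) p))"
proof -
  have X [measurable]: "random_variable borel (X i)" for i
    using ind by (auto simp: indep_vars_def)
  let ?Z = "\<lambda>i \<omega>. y i *\<^sub>R X i \<omega>"
  have indZ: "indep_vars (\<lambda>_. borel) ?Z UNIV"
    by (rule indep_vars_compose2[OF ind]) auto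
  have identZ: "distr M borel (?Z i) = distr M borel (X 0)" for i
  proof (cases "y i = 1")
    case False
    then have "distr M borel (?Z i) = distr (distr M borel (X i)) borel uminus"
      using y[of i] by (subst distr_distr) (auto simp: o_def)
    also have "\<dots> = distr M borel (\<lambda>\<omega>. - X 0 \<omega>)"
      unfolding ident[of i] by (subst distr_distr) (auto simp: o_def)
    also have "\<dots> = distr M borel (X 0)"
      by (rule distr_sign_flip[OF X prob_space_axioms sym])
    finally show ?thesis .
  qed (simp add: ident[of i])
  let ?T = "\<lambda>\<omega>. rank_statistic J nR n g y (\<lambda>i. X i \<omega>)"
  have T: "?T \<in> borel_measurable M"
    by (rule measurable_rank_statistic) simp_all
  have "(\<integral>t. h t \<partial>distr M borel ?T) = expectation (\<lambda>\<omega>. h (?T \<omega>))"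
    by (rule integral_distr[OF T h])
  also have "\<dots> = perm_mean n (\<lambda>p. h (score_statistic (\<lambda>j. vector_score J (g j)) n (positive_indices n y) p))"
    unfolding rank_statistic_eq
  proof (rule expectation_opt_perm[OF indZ identZ ac])
    fix p q assume "\<And>i. i < n \<Longrightarrow> g (p i) = g (q i)"
    then show "h (score_statistic (\<lambda>j. vector_score J (g j)) n (positive_indices n y) p) =
        h (score_statistic (\<lambda>j. vector_score J (g j)) n (positive_indices n y) q)"
      unfolding score_statistic_def
      by (intro arg_cong[where f = h] arg_cong2[where f = scaleR] sum.cong refl) (auto simp: positive_indices_def)
  qed
  finally show ?thesis .
qed

lemma filterlim_card_initial_segment:
  assumes "infinite A"
  shows "filterlim (\<lambda>n::nat. card {i \<in> {..<n}. i \<in> A}) at_top sequentially"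
  unfolding filterlim_at_top
proof
  fix Z
  obtain B where B: "finite B" "card B = Z" "B \<subseteq> A"
    using infinite_arbitrarily_large[OF assms] by blast
  obtain m where m: "\<And>i. i \<in> B \<Longrightarrow> i < m"
    using B(1) finite_nat_bounded by blast
  have "Z \<le> card {i \<in> {..<n}. i \<in> A}" if "m \<le> n" for n
    unfolding B(2)[symmetric] using B m that by (intro card_mono) force+
  then show "\<forall>\<^sub>F n in sequentially. Z \<le> card {i \<in> {..<n}. i \<in> A}"
    unfolding eventually_sequentially by blast
qed

text \<open>
  Characteristic functions converge by the sampling theorem, applied to the population of inner products
  with \<open>\<theta>\<close>; tightness follows from the second moment bound and Chebyshev's inequality.
\<close>

theorem (in prob_space) rank_statistic_weak_limit:
  fixes X :: "nat \<Rightarrow> 'a \<Rightarrow> 'b::euclidean_space" and N :: "'b measure"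
  assumes ind: "indep_vars (\<lambda>_. borel) X UNIV"
    and ident: "\<And>i. distr M borel (X i) = distr M borel (X 0)"
    and ac: "absolutely_continuous lborel (distr M borel (X 0))"
    and sym: "centrally_symmetric M (X 0)"
    and g: "grid_sequence g" and J_cont: "continuous_on {0<..<1} J"
    and J_bv: "bounded_variation_on {0..<1} J"
    and N: "prob_space N" "sets N = sets borel"
    and N_cos: "\<And>\<theta>. (\<integral>x. cos (\<theta> \<bullet> x) \<partial>N)
        = exp (- ((LBINT u:{0<..<1}. (J u)\<^sup>2) / DIM('b) * (norm \<theta>)\<^sup>2) / 2)"
    and N_sin: "\<And>\<theta>. (\<integral>x. sin (\<theta> \<bullet> x) \<partial>N) = 0"
    and y: "\<And>i. y i = 1 \<or> y i = - 1" "infinite {i. y i = 1}" "infinite {i. y i = - 1}"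
  shows "weakly_converges (\<lambda>n. distr M borel (\<lambda>\<omega>. rank_statistic J (nR n) n (g n) y (\<lambda>i. X i \<omega>))) N"
proof -
  have X [measurable]: "random_variable borel (X i)" for i
    using ind by (auto simp: indep_vars_def)
  let ?\<mu> = "\<lambda>n. distr M borel (\<lambda>\<omega>. rank_statistic J (nR n) n (g n) y (\<lambda>i. X i \<omega>))"
  let ?a = "\<lambda>n j. vector_score J (g n j)" and ?I = "\<lambda>n. positive_indices n y"
  let ?T = "\<lambda>n p. score_statistic (?a n) n (?I n) p"
  have T: "(\<lambda>\<omega>. rank_statistic J (nR n) n (g n) y (\<lambda>i. X i \<omega>)) \<in> borel_measurable M" for n
    by (rule measurable_rank_statistic) simp_all
  have law: "(\<integral>t. h t \<partial>?\<mu> n)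
      = perm_mean n (\<lambda>p. h (?T n p))" if "h \<in> borel_measurable borel" for h :: "'b \<Rightarrow> real" and n
    by (rule conditional_law_rank_statistic[OF ind ident ac sym y(1) that])
  obtain C where C: "\<And>u. u \<in> {0..1} \<Longrightarrow> \<bar>J u\<bar> \<le> C"
    using bounded_variation_bounded[OF J_bv] by blast
  have a: "norm (?a n j) \<le> C" if "j < n" for n j
    using g that by (intro norm_vector_score_le[where J = J] C) (auto simp: grid_sequence_def)
  have sub: "?I n \<subseteq> {..<n}" for n by (auto simp: positive_indices_def)
  have I: "filterlim (\<lambda>n. card (?I n)) at_top sequentially"
    using filterlim_card_initial_segment[OF y(2)] by (simp add: positive_indices_def)
  have "{..<n} - ?I n = {i \<in> {..<n}. i \<in> {i. y i = - 1}}" for n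
  proof -
    have "y i \<noteq> 1 \<longleftrightarrow> y i = - 1" for i using y(1)[of i] by auto
    then show ?thesis by (auto simp: positive_indices_def)
  qed
  then have K: "filterlim (\<lambda>n. card ({..<n} - ?I n)) at_top sequentially"
    using filterlim_card_initial_segment[OF y(3)] by simp
  have cf: "(\<lambda>n. perm_mean n (\<lambda>p. iexp (\<theta> \<bullet> ?T n p)))
      \<longlonglongrightarrow> complex_of_real (exp (- ((LBINT u:{0<..<1}. (J u)\<^sup>2) * ((norm \<theta>)\<^sup>2 / DIM('b))) / 2))" for \<theta>
    by (rule score_statistic_characteristic_function[OF sub I K a grid_score_moments[OF g J_cont C]])
  show ?thesis
  proof (rule weakly_converges_trigI)
    show "prob_space (?\<mu> n)" for n by (rule prob_space_distr[OF T])
    show "(\<lambda>n. \<integral>x. cos (\<theta> \<bullet> x) \<partial>?\<mu> n) \<longlonglongrightarrow> (\<integral>x. cos (\<theta> \<bullet> x) \<partial>N)" for \<theta>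
      using tendsto_Re[OF cf[of \<theta>]] by (simp add: law perm_mean_Re Re_exp N_cos)
    show "(\<lambda>n. \<integral>x. sin (\<theta> \<bullet> x) \<partial>?\<mu> n) \<longlonglongrightarrow> (\<integral>x. sin (\<theta> \<bullet> x) \<partial>N)" for \<theta>
      using tendsto_Im[OF cf[of \<theta>]] by (simp add: law perm_mean_Im Im_exp N_sin)
    fix e :: real assume e: "0 < e"
    define D where "D = real DIM('b) * (8 * C\<^sup>2)"
    define L where "L = sqrt (D / e) + 1"
    have "0 \<le> D" by (simp add: D_def)
    then have L: "0 < L" "D / L\<^sup>2 < e"
    proof -
      have "0 \<le> sqrt (D / e)" using \<open>0 \<le> D\<close> e by simp
      then show "0 < L" unfolding L_def by linarith
      have "D / e = (sqrt (D / e))\<^sup>2" using \<open>0 \<le> D\<close> e by simp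
      also have "\<dots> < L\<^sup>2"
        using \<open>0 \<le> sqrt (D / e)\<close> unfolding L_def by (intro power_strict_mono) auto
      finally show "D / L\<^sup>2 < e" using e \<open>0 < L\<close> by (simp add: field_simps)
    qed
    have "measure (?\<mu> n) {x. L < norm x} < e" for n
    proof -
      have "measure (?\<mu> n) {x. L < norm x} = (\<integral>x. indicator {x. L < norm x} x \<partial>?\<mu> n)"
        by simp
      also have "\<dots> = perm_mean n (\<lambda>p. indicator {x. L < norm x} (?T n p))"
        by (rule law) measurable
      also have "\<dots> \<le> perm_mean n (\<lambda>p. inverse (L\<^sup>2) * (norm (?T n p))\<^sup>2)"
      proof (rule perm_mean_mono)
        show "indicator {x. L < norm x} (?T n p) \<le> inverse (L\<^sup>2) * (norm (?T n p))\<^sup>2" for p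
        proof (cases "L < norm (?T n p)")
          case True
          then have "L\<^sup>2 \<le> (norm (?T n p))\<^sup>2" using L(1) by (intro power_mono) auto
          then show ?thesis using True L(1) by (simp add: field_simps)
        qed simp
      qed
      also have "\<dots> = inverse (L\<^sup>2) * perm_mean n (\<lambda>p. (norm (?T n p))\<^sup>2)"
        by (rule perm_mean_mult)
      also have "\<dots> \<le> inverse (L\<^sup>2) * D"
        unfolding D_def by (intro mult_left_mono score_statistic_second_moment sub a) simp_all
      also have "\<dots> < e" using L(2) by (simp add: field_simps)
      finally show ?thesis .
    qed
    then show "\<exists>L. \<forall>n. measure (?\<mu> n) {x. L < norm x} < e" by blast
  qed (simp_all add: N)
qed

section \<open>Random signs\<close>

text \<open>
  The probability that \<open>c\<close> is missed at \<open>k\<close> consecutive times is \<open>(1 / 2) ^ k\<close>.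
\<close>

lemma (in prob_space) AE_infinitely_often:
  fixes Y :: "nat \<Rightarrow> 'a \<Rightarrow> real"
  assumes ind: "indep_vars (\<lambda>_. borel) Y UNIV"
    and half: "\<And>i. prob {\<omega> \<in> space M. Y i \<omega> = c} = 1 / 2"
  shows "AE \<omega> in M. \<exists>i\<ge>m. Y i \<omega> = c"
proof -
  have Y [measurable]: "random_variable borel (Y i)" for i
    using ind by (auto simp: indep_vars_def)
  let ?E = "{\<omega> \<in> space M. \<not> (\<exists>i\<ge>m. Y i \<omega> = c)}"
  have E: "?E \<in> events" by measurable
  have "prob ?E \<le> (1 / 2) ^ k" for k
  proof (cases "k = 0")
    case False
    have "prob ?E \<le> prob (\<Inter>i\<in>{m..<m + k}. Y i -` (- {c}) \<inter> space M)"
      using False by (intro finite_measure_mono sets.finite_INT measurable_sets[OF Y]) auto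
    also have "\<dots> = (\<Prod>i\<in>{m..<m + k}. prob (Y i -` (- {c}) \<inter> space M))"
      by (rule indep_varsD[OF ind]) (use False in auto)
    also have "\<dots> = (\<Prod>i\<in>{m..<m + k}. 1 / 2)"
    proof (rule prod.cong[OF refl])
      fix i
      have "Y i -` (- {c}) \<inter> space M = space M - {\<omega> \<in> space M. Y i \<omega> = c}" by auto
      then show "prob (Y i -` (- {c}) \<inter> space M) = 1 / 2"
        by (simp add: prob_compl half)
    qed
    finally show ?thesis by simp
  qed simp
  moreover have "(\<lambda>k. (1 / 2 :: real) ^ k) \<longlonglongrightarrow> 0"
    by (rule LIMSEQ_realpow_zero) auto
  ultimately have "prob ?E \<le> 0"
    by (intro tendsto_lowerbound[of "\<lambda>k. (1 / 2 :: real) ^ k"]) auto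
  then have "emeasure M ?E = 0"
    by (simp add: emeasure_eq_measure measure_le_0_iff)
  then show ?thesis using E by (intro AE_I[OF subset_refl]) auto
qed

lemma (in prob_space) AE_random_signs:
  fixes Y :: "nat \<Rightarrow> 'a \<Rightarrow> real"
  assumes ind: "indep_vars (\<lambda>_. borel) Y UNIV"
    and pos: "\<And>i. prob {\<omega> \<in> space M. Y i \<omega> = 1} = 1 / 2"
    and neg: "\<And>i. prob {\<omega> \<in> space M. Y i \<omega> = - 1} = 1 / 2"
  shows "AE y in distr M (\<Pi>\<^sub>M i\<in>UNIV. borel) (\<lambda>\<omega> i. Y i \<omega>).
    (\<forall>i. y i = 1 \<or> y i = - 1) \<and> infinite {i. y i = 1} \<and> infinite {i. y i = - 1}"
proof -
  have Y [measurable]: "random_variable borel (Y i)" for i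
    using ind by (auto simp: indep_vars_def)
  have joint: "(\<lambda>\<omega> i. Y i \<omega>) \<in> M \<rightarrow>\<^sub>M (\<Pi>\<^sub>M i\<in>UNIV. borel)"
    by (rule measurable_PiM_single') auto
  have sign: "AE \<omega> in M. Y i \<omega> = 1 \<or> Y i \<omega> = - 1" for i
  proof -
    have "prob ({\<omega> \<in> space M. Y i \<omega> = 1} \<union> {\<omega> \<in> space M. Y i \<omega> = - 1}) =
        prob {\<omega> \<in> space M. Y i \<omega> = 1} + prob {\<omega> \<in> space M. Y i \<omega> = - 1}"
      by (rule finite_measure_Union) auto
    also have "\<dots> = 1"
      by (simp add: pos neg)
    finally have "prob ({\<omega> \<in> space M. Y i \<omega> = 1} \<union> {\<omega> \<in> space M. Y i \<omega> = - 1}) = 1" .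
    then have "AE \<omega> in M. \<omega> \<in> {\<omega> \<in> space M. Y i \<omega> = 1} \<union> {\<omega> \<in> space M. Y i \<omega> = - 1}"
      by (intro AE_prob_1) simp
    then show ?thesis by eventually_elim auto
  qed
  let ?Q = "\<lambda>y :: nat \<Rightarrow> real. (\<forall>i. y i = 1 \<or> y i = - 1) \<and> (\<forall>m. \<exists>i\<ge>m. y i = 1) \<and> (\<forall>m. \<exists>i\<ge>m. y i = - 1)"
  have "AE \<omega> in M. ?Q (\<lambda>i. Y i \<omega>)"
    using sign AE_infinitely_often[OF ind pos] AE_infinitely_often[OF ind neg]
    by (simp add: AE_all_countable)
  moreover have "{y \<in> space (\<Pi>\<^sub>M i\<in>UNIV. borel). ?Q y} \<in> sets (\<Pi>\<^sub>M i\<in>(UNIV :: nat set). (borel :: real measure))"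
    by measurable
  ultimately have "AE y in distr M (\<Pi>\<^sub>M i\<in>UNIV. borel) (\<lambda>\<omega> i. Y i \<omega>). ?Q y"
    by (subst AE_distr_iff[OF joint]) auto
  then show ?thesis
    by eventually_elim (auto simp: infinite_nat_iff_unbounded_le)
qed

section \<open>Asymptotic normality of the rank statistic\<close>

theorem proposition2:
  fixes M :: "'w measure"
    and X :: "nat \<Rightarrow> 'w \<Rightarrow> real ^ 'd"
    and Y :: "nat \<Rightarrow> 'w \<Rightarrow> real"
    and g :: "nat \<Rightarrow> nat \<Rightarrow> real ^ 'd"
    and nR :: "nat \<Rightarrow> nat"
    and J :: "real \<Rightarrow> real"
  assumes prob: "prob_space M"
    and X_indep: "prob_space.indep_vars M (\<lambda>_. borel) X UNIV"
    and X_ident: "\<And>i. distr M borel (X i) = distr M borel (X 0)"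
    and X_ac: "absolutely_continuous lborel (distr M borel (X 0))"
    and X_sym: "centrally_symmetric M (X 0)"
    and Y_indep: "prob_space.indep_vars M (\<lambda>_. borel) Y UNIV"
    and Y_pos: "\<And>i. measure M {\<omega> \<in> space M. Y i \<omega> = 1} = 1 / 2"
    and Y_neg: "\<And>i. measure M {\<omega> \<in> space M. Y i \<omega> = - 1} = 1 / 2"
    and XY_indep: "prob_space.indep_set M
        (sets (vimage_algebra (space M) (\<lambda>\<omega> i. X i \<omega>) (\<Pi>\<^sub>M i\<in>UNIV. borel)))
        (sets (vimage_algebra (space M) (\<lambda>\<omega> i. Y i \<omega>) (\<Pi>\<^sub>M i\<in>UNIV. borel)))"
    and grid: "grid_sequence g"
    and J_cont: "continuous_on {0<..<1} J"
    and J_bv: "bounded_variation_on {0..<1} J"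
    and J_sq: "set_integrable lborel {0<..<1} (\<lambda>u. (J u)\<^sup>2)"
  shows "\<exists>N \<kappa>.
      multivariate_normal 0
        (((LBINT u:{0<..<1}. (J u)\<^sup>2) / real CARD('d)) *\<^sub>R (mat 1 :: real ^ 'd ^ 'd)) N \<and>
      (\<forall>n. conditional_distr M (\<Pi>\<^sub>M i\<in>UNIV. borel) (\<lambda>\<omega> i. Y i \<omega>) borel
             (\<lambda>\<omega>. rank_statistic J (nR n) n (g n) (\<lambda>i. Y i \<omega>) (\<lambda>i. X i \<omega>)) (\<kappa> n)) \<and>
      (AE y in distr M (\<Pi>\<^sub>M i\<in>UNIV. borel) (\<lambda>\<omega> i. Y i \<omega>).
         weakly_converges (\<lambda>n. \<kappa> n y) N)"
proof -
  interpret prob_space M by fact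
  let ?PX = "\<Pi>\<^sub>M i\<in>(UNIV :: nat set). (borel :: (real ^ 'd) measure)"
  let ?PY = "\<Pi>\<^sub>M i\<in>(UNIV :: nat set). (borel :: real measure)"
  define v where "v = (LBINT u:{0<..<1}. (J u)\<^sup>2) / real CARD('d)"
  have "0 \<le> v"
    unfolding v_def set_lebesgue_integral_def by (auto intro!: divide_nonneg_nonneg integral_nonneg_AE)
  then obtain N :: "(real ^ 'd) measure" where N: "multivariate_normal 0 (v *\<^sub>R mat 1) N"
      "prob_space N" "sets N = sets borel"
    and N_cos: "\<And>\<theta>. (\<integral>x. cos (\<theta> \<bullet> x) \<partial>N) = exp (- (v * (norm \<theta>)\<^sup>2) / 2)"
    and N_sin: "\<And>\<theta>. (\<integral>x. sin (\<theta> \<bullet> x) \<partial>N) = 0"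
    using isotropic_normal by blast
  let ?T = "\<lambda>n y x. rank_statistic J (nR n) n (g n) y x"
  define \<kappa> where "\<kappa> n y = distr M borel (\<lambda>\<omega>. ?T n y (\<lambda>i. X i \<omega>))" for n y
  have X: "random_variable borel (X i)" and Y: "random_variable borel (Y i)" for i
    using X_indep Y_indep by (auto simp: indep_vars_def)
  have X': "(\<lambda>\<omega> i. X i \<omega>) \<in> M \<rightarrow>\<^sub>M ?PX" and Y': "(\<lambda>\<omega> i. Y i \<omega>) \<in> M \<rightarrow>\<^sub>M ?PY"
    using X Y by (auto intro!: measurable_PiM_single')
  have "conditional_distr M ?PY (\<lambda>\<omega> i. Y i \<omega>) borel (\<lambda>\<omega>. ?T n (\<lambda>i. Y i \<omega>) (\<lambda>i. X i \<omega>)) (\<kappa> n)" for n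
    unfolding \<kappa>_def
  proof (rule conditional_distr_of_independent[OF prob X' Y' XY_indep])
    show "(\<lambda>(y, x). ?T n y x) \<in> ?PY \<Otimes>\<^sub>M ?PX \<rightarrow>\<^sub>M borel"
      unfolding case_prod_beta by (rule measurable_rank_statistic) measurable
  qed
  moreover have "AE y in distr M ?PY (\<lambda>\<omega> i. Y i \<omega>). weakly_converges (\<lambda>n. \<kappa> n y) N"
    using AE_random_signs[OF Y_indep Y_pos Y_neg]
  proof eventually_elim
    case (elim y)
    then show ?case
      unfolding \<kappa>_def
      by (intro rank_statistic_weak_limit[OF X_indep X_ident X_ac X_sym grid J_cont J_bv N(2,3)])
        (auto simp: N_cos N_sin v_def)
  qed
  ultimately show ?thesis
    using N(1) unfolding v_def by blast
qed

end
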